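(* Let $\sigma_1(f)(x)=f(x+1)$ and $\sigma_2(f)(x)=f(x+\alpha)$ with $\alpha\in\mathbb{C}\setminus\mathbb{Q}$. Consider systems of two scalar linear difference equations $$(\ast)\qquad \sigma_j^{m_j}(f)+b_{j,m_j-1}\sigma_j^{m_j-1}(f)+\dots+b_{j,0}f=0,\quad j=1,2,\qquad b_{j,i}\in\mathbb{C}(x).$$ (1) If $\alpha$ is nonreal and $f$ is a meromorphic function on $\mathbb{C}$ that solves a system $(\ast)$, then $$f(x)=\sum_{i=1}^I\sum_{k=0}^K r_{i,k}(x)\,g_{i,k}(x)\,\zeta(x)^k e^{\alpha_i x}\rho(\delta_i,x)$$ where $\alpha_i,\delta_i\in\mathbb{C}$, $r_{i,k}\in\mathbb{C}(x)$, the $g_{i,k}$ are elliptic functions, and the elliptic functions and the functions $\zeta$ and $\rho$ are taken with respect to the periods $1$ and $\alpha$. Conversely, any such function satisfies a pair of linear difference equations $(\ast)$ with rational coefficients. (2) If $f$ is a meromorphic function on $\mathbb{C}$ that solves a system $(\ast)$, and $\alpha$ is real or $f$ has only finitely many poles, then $$f(x)=\sum_{i=1}^I r_i(x)e^{\alpha_ix}$$ where $\alpha_i\in\mathbb{C}$ and $r_i\in\mathbb{C}(x)$. (3) If $f\in\mathbb{C}[[x^{-1}]][x]$ satisfies a system $(\ast)$, then $f$ is rational.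
   Context: For nonreal $\alpha$: elliptic functions are the meromorphic functions on $\mathbb{C}$ that are $1$- and $\alpha$-periodic. $\wp$ is the Weierstrass function for the periods $1,\alpha$: the unique $1$- and $\alpha$-periodic meromorphic function whose only pole in the parallelogram with vertices $\pm\frac12\pm\frac\alpha2$ is a double pole at $0$, with $\wp(x)=x^{-2}+O(x)$ as $x\to0$. $\zeta$ is the odd antiderivative of $\wp$. The Weierstrass sigma function $\sigma_W$ is the entire function, vanishing at the origin, with $\sigma_W'/\sigma_W=-\zeta$ and $\sigma_W'(0)=1$. Finally $\rho(\delta,x)=\sigma_W(x+\delta)/\sigma_W(x)$. $\mathbb{C}[[x^{-1}]][x]$ is the field of formal Laurent series in $x^{-1}$, with $\mathbb{C}(x)$ embedded by expansion at $x=\infty$ and with the shifts acting by re-expansion in powers of $x^{-1}$. *)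

theory Defs
  imports
    "HOL-Complex_Analysis.Complex_Analysis"
    "HOL-Computational_Algebra.Computational_Algebra"
    "HOL-Computational_Algebra.Field_as_Ring"
    "HOL-Library.Landau_Symbols"
begin

text \<open>
  Meromorphic functions are represented by total functions \<^typ>\<open>complex \<Rightarrow> complex\<close>. Their values
  at poles (and on any set without accumulation points) carry no information, so an identity
  between meromorphic functions is stated as an identity off such a set, i.e. along
  \<^term>\<open>cosparse (UNIV :: complex set)\<close>.
\<close>

type_synonym ratfun = "complex poly fract"

definition ratfun_eval :: "ratfun \<Rightarrow> complex \<Rightarrow> complex" where
  "ratfun_eval r x = poly (fst (quot_of_fract r)) x / poly (snd (quot_of_fract r)) x"

definition shift :: "complex \<Rightarrow> (complex \<Rightarrow> complex) \<Rightarrow> complex \<Rightarrow> complex" where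
  "shift c f = (\<lambda>x. f (x + c))"

definition solves_difference_eq ::
    "complex \<Rightarrow> nat \<Rightarrow> (nat \<Rightarrow> ratfun) \<Rightarrow> (complex \<Rightarrow> complex) \<Rightarrow> bool" where
  "solves_difference_eq c m b f \<longleftrightarrow>
     (\<forall>\<^sub>\<approx>x\<in>UNIV. (shift c ^^ m) f x + (\<Sum>i<m. ratfun_eval (b i) x * (shift c ^^ i) f x) = 0)"

definition solves_system :: "complex \<Rightarrow> (complex \<Rightarrow> complex) \<Rightarrow> bool" where
  "solves_system \<alpha> f \<longleftrightarrow>
     (\<exists>m\<^sub>1>0. \<exists>b\<^sub>1. solves_difference_eq 1 m\<^sub>1 b\<^sub>1 f) \<and>
     (\<exists>m\<^sub>2>0. \<exists>b\<^sub>2. solves_difference_eq \<alpha> m\<^sub>2 b\<^sub>2 f)"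

definition elliptic :: "complex \<Rightarrow> (complex \<Rightarrow> complex) \<Rightarrow> bool" where
  "elliptic \<alpha> g \<longleftrightarrow> g meromorphic_on UNIV \<and>
     (\<forall>\<^sub>\<approx>x\<in>UNIV. g (x + 1) = g x) \<and> (\<forall>\<^sub>\<approx>x\<in>UNIV. g (x + \<alpha>) = g x)"

text \<open>
  The following three functions are only meaningful for nonreal \<open>\<alpha>\<close>; the periods are \<open>1\<close> and \<open>\<alpha>\<close>.
  Requiring \<open>\<wp>\<close> and \<open>\<zeta>\<close> to be \<^emph>\<open>nicely\<close> meromorphic (continuous outside the poles, value 0 at
  the poles) singles out one representative, so that the descriptions are definite.
\<close>

definition weierstrass_p :: "complex \<Rightarrow> complex \<Rightarrow> complex" where
  "weierstrass_p \<alpha> = (THE P. P nicely_meromorphic_on UNIV \<and> elliptic \<alpha> P \<and>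
     (\<forall>z \<in> convex hull {1/2 + \<alpha>/2, 1/2 - \<alpha>/2, -1/2 + \<alpha>/2, -1/2 - \<alpha>/2}.
        is_pole P z \<longleftrightarrow> z = 0) \<and>
     zorder P 0 = -2 \<and>
     (\<lambda>x. P x - 1 / x ^ 2) \<in> O[at 0](\<lambda>x. x))"

text \<open>
  Mind the sign: \<open>\<zeta>' = \<wp>\<close>, so this is the negative of the classical Weierstrass zeta function.
\<close>

definition weierstrass_zeta :: "complex \<Rightarrow> complex \<Rightarrow> complex" where
  "weierstrass_zeta \<alpha> = (THE Z. Z nicely_meromorphic_on UNIV \<and> (\<forall>x. Z (-x) = - Z x) \<and>
     (\<forall>x. \<not> is_pole (weierstrass_p \<alpha>) x \<longrightarrow>
        (Z has_field_derivative weierstrass_p \<alpha> x) (at x)))"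

definition weierstrass_sigma :: "complex \<Rightarrow> complex \<Rightarrow> complex" where
  "weierstrass_sigma \<alpha> = (THE S. S holomorphic_on UNIV \<and> S 0 = 0 \<and> deriv S 0 = 1 \<and>
     (\<forall>\<^sub>\<approx>x\<in>UNIV. deriv S x / S x = - weierstrass_zeta \<alpha> x))"

definition weierstrass_rho :: "complex \<Rightarrow> complex \<Rightarrow> complex \<Rightarrow> complex" where
  "weierstrass_rho \<alpha> \<delta> x = weierstrass_sigma \<alpha> (x + \<delta>) / weierstrass_sigma \<alpha> x"

text \<open>
  The field \<open>\<complex>[[x\<^sup>-\<^sup>1]][x]\<close> is \<^typ>\<open>complex fls\<close> with \<^term>\<open>fls_X\<close> playing the role of \<open>x\<^sup>-\<^sup>1\<close> and
  hence \<^term>\<open>fls_X_inv\<close> that of \<open>x\<close>.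
\<close>

definition poly_at_infinity :: "complex poly \<Rightarrow> complex fls" where
  "poly_at_infinity p = poly (map_poly fls_const p) fls_X_inv"

definition ratfun_at_infinity :: "ratfun \<Rightarrow> complex fls" where
  "ratfun_at_infinity r =
     poly_at_infinity (fst (quot_of_fract r)) / poly_at_infinity (snd (quot_of_fract r))"

text \<open>
  With \<open>t = x\<^sup>-\<^sup>1\<close>, the shift \<open>x \<mapsto> x + c\<close> amounts to the substitution \<open>t \<mapsto> t / (1 + c t)\<close>.
\<close>

definition fls_shift_at_infinity :: "complex \<Rightarrow> complex fls \<Rightarrow> complex fls" where
  "fls_shift_at_infinity c F = fls_compose_fps F (fps_X / (1 + fps_const c * fps_X))"

text \<open>Sanity check: the substitution does send \<open>x\<close> to \<open>x + c\<close>.\<close>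

lemma fls_shift_at_infinity_X_inv:
  "fls_shift_at_infinity c fls_X_inv = fls_X_inv + fls_const c"
proof -
  define H :: "complex fps" where "H = 1 + fps_const c * fps_X"
  have H: "H * inverse H = 1"
    unfolding H_def by (rule inverse_mult_eq_1') simp
  hence H0: "inverse H \<noteq> 0" by force
  have "fps_nth H 0 \<noteq> 0" by (simp add: H_def)
  hence G: "fps_X / H = fps_X * inverse H" by (simp add: fps_divide_unit)
  have "fps_to_fls (fps_X * inverse H) * (fls_X_inv + fls_const c) =
          fps_to_fls (inverse H) * (fls_X * fls_X_inv + fls_X * fls_const c)"
    unfolding fls_times_fps_to_fls by (simp add: algebra_simps)
  also have "fls_X * fls_X_inv + fls_X * fls_const c = fps_to_fls H"
    by (simp add: H_def fls_times_fps_to_fls fls_X_times_conv_shift)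
  also have "fps_to_fls (inverse H) * fps_to_fls H = 1"
    using H by (simp flip: fls_times_fps_to_fls add: mult.commute)
  finally have "inverse (fps_to_fls (fps_X * inverse H)) = fls_X_inv + fls_const c"
    by (rule inverse_unique)
  moreover have "fls_shift_at_infinity c fls_X_inv = inverse (fps_to_fls (fps_X * inverse H))"
    unfolding fls_shift_at_infinity_def H_def[symmetric] G fls_inverse_X[symmetric]
    using H0 by (subst fls_compose_fps_inverse) auto
  ultimately show ?thesis by simp
qed

definition fls_solves_difference_eq ::
    "complex \<Rightarrow> nat \<Rightarrow> (nat \<Rightarrow> ratfun) \<Rightarrow> complex fls \<Rightarrow> bool" where
  "fls_solves_difference_eq c m b F \<longleftrightarrow>
     (fls_shift_at_infinity c ^^ m) F +
       (\<Sum>i<m. ratfun_at_infinity (b i) * (fls_shift_at_infinity c ^^ i) F) = 0"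

definition fls_solves_system :: "complex \<Rightarrow> complex fls \<Rightarrow> bool" where
  "fls_solves_system \<alpha> F \<longleftrightarrow>
     (\<exists>m\<^sub>1>0. \<exists>b\<^sub>1. fls_solves_difference_eq 1 m\<^sub>1 b\<^sub>1 F) \<and>
     (\<exists>m\<^sub>2>0. \<exists>b\<^sub>2. fls_solves_difference_eq \<alpha> m\<^sub>2 b\<^sub>2 F)"

end

theory Submission
  imports Defs
begin

text \<open>
  The functions (or Laurent series) modulo sparse sets form a torsion-free module over \<open>\<complex>[x]\<close> on
  which two shifts \<open>S\<close>, \<open>T\<close> act semilinearly. The main point is that a solution \<open>f\<close> of a system has a
  nonzero polynomial multiple \<open>h = q f\<close> that is annihilated by nonzero polynomials in \<open>S\<close> and in \<open>T\<close>
  with \<^emph>\<open>constant\<close> coefficients.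

  For this, all \<open>S\<^sup>i T\<^sup>j f\<close> lie in a \<open>\<complex>(x)\<close>-space of finite dimension. Computing the denominators of
  \<open>S\<^sup>i T\<^sup>j f\<close> along two different lattice paths shows that, after multiplying \<open>f\<close> by a suitable \<open>q\<close>, they
  are bounded; as the degrees grow linearly in \<open>i + j\<close>, the \<open>N\<^sup>2\<close> elements with \<open>i, j < N\<close> satisfy a
  linear relation \<open>P(S, T) h = 0\<close> over \<open>\<complex>\<close>. Multiplication by \<open>x\<close> acts on operators as the derivation
  \<open>\<delta> = c\<^sub>1 S \<partial>\<^sub>S + c\<^sub>2 T \<partial>\<^sub>T\<close>, and no algebraic curve in the torus is invariant under \<open>\<delta>\<close> because
  \<open>c\<^sub>2 / c\<^sub>1\<close> is irrational. Hence a relation with polynomial coefficients for \<open>h\<close>, differentiated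
  repeatedly along \<open>\<delta>\<close>, together with \<open>P\<close> cuts out finitely many points only.

  It remains to solve \<open>(S - a)\<^sup>m h = 0 = (T - b)\<^sup>n h\<close>. A Laurent series \<open>h\<close> must be a polynomial. If \<open>\<alpha>\<close> is
  real or \<open>f\<close> has finitely many poles, then \<open>h\<close> is entire, as the poles would propagate under the
  shifts, and Liouville's theorem gives \<open>h = p(x) e\<^bsup>cx\<^esup>\<close>. In general, dividing by \<open>e\<^bsup>cx\<^esup> \<rho>(\<delta>, x)\<close> reduces
  to \<open>a = b = 1\<close>, where \<open>h\<close> is a polynomial in \<open>x\<close> and \<open>\<zeta>\<close> over the elliptic functions by Newton
  interpolation. The functions \<open>\<wp>\<close>, \<open>\<zeta>\<close>, \<open>\<sigma>\<^sub>W\<close> are obtained from the product of the theta function.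
\<close>

section \<open>Modules with a semilinear shift\<close>

text \<open>Constant coefficients cannot be expected for f itself: no nonzero polynomial in S kills
  1/x, because the translated poles do not cancel. Nor does one equation suffice: the Gamma function
  satisfies one of order 1, yet no nonzero polynomial multiple of it satisfies one with constant
  coefficients. A single shift offers N iterates against degrees of order N; two shifts offer N^2.

  The constant coefficient equations lead to pairs (a, b) of nonzero eigenvalues. The exponential
  e^(cx) realizes only the pairs (e^c, e^(c \<alpha>)). For nonreal \<alpha> the family e^(cx)
  \<rho>(\<delta>, x) realizes all of them: taking logarithms leaves a linear system for (c,
  \<delta>) with determinant B2 - \<alpha> B1, where B1 and B2 are the exponents in the
  quasi-periodicity of \<sigma>. That it is nonzero is Legendre's relation, here read off the theta
  product, whose exponents are 0 and, up to sign, 2 pi i. For entire functions a true joint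
  eigenfunction shows that the pair is of the special form.\<close>

lemma underdetermined_system_solution:
  fixes M :: "'j \<Rightarrow> 't \<Rightarrow> 'a::idom"
  assumes "finite T" "finite J" "card T < card J"
  shows "\<exists>c. (\<exists>j\<in>J. c j \<noteq> 0) \<and> (\<forall>t\<in>T. (\<Sum>j\<in>J. c j * M j t) = 0)"
  using assms
proof (induction T arbitrary: J M rule: finite_induct)
  case empty
  then obtain j where "j \<in> J" by fastforce
  then show ?case by (intro exI[of _ "\<lambda>_. 1"]) auto
next
  case (insert t T J M)
  show ?case
  proof (cases "\<exists>j0\<in>J. M j0 t \<noteq> 0")
    case False
    have "card T < card J" using insert.hyps insert.prems by simp
    then obtain c where "\<exists>j\<in>J. c j \<noteq> 0" "\<forall>t\<in>T. (\<Sum>j\<in>J. c j * M j t) = 0"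
      using insert.IH[of J M] insert.prems(1) by blast
    then show ?thesis using False by (intro exI[of _ c]) auto
  next
    case True
    then obtain j0 where j0: "j0 \<in> J" "M j0 t \<noteq> 0" by auto
    define J' where "J' = J - {j0}"
    have J: "J = insert j0 J'" "j0 \<notin> J'" "finite J'" using j0 insert by (auto simp: J'_def)
    have "card T < card J'" using insert j0 J by (simp add: card_insert_if)
    then obtain c where c: "\<exists>j\<in>J'. c j \<noteq> 0"
       "\<And>s. s \<in> T \<Longrightarrow> (\<Sum>j\<in>J'. c j * (M j0 t * M j s - M j t * M j0 s)) = 0"
      using insert.IH[of J' "\<lambda>j s. M j0 t * M j s - M j t * M j0 s"] J(3) by auto
    \<comment> \<open>Equation t is eliminated with the pivot \<open>M j0 t\<close> by
      cross-multiplication. No division occurs, so the lemma serves over C[x] in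
      \<open>shift_relation\<close> as well as over C in
      \<open>constant_coefficient_relation\<close>.\<close>
    define c' where "c' j = (if j = j0 then - (\<Sum>i\<in>J'. c i * M i t) else c j * M j0 t)" for j
    have sum: "(\<Sum>j\<in>J. c' j * M j s) =
        - (\<Sum>i\<in>J'. c i * M i t) * M j0 s + (\<Sum>j\<in>J'. c j * M j0 t * M j s)" for s
    proof -
      have "(\<Sum>j\<in>J'. c' j * M j s) = (\<Sum>j\<in>J'. c j * M j0 t * M j s)"
        using J(2) by (intro sum.cong) (auto simp: c'_def)
      then show ?thesis using J by (simp add: c'_def)
    qed
    have "(\<Sum>j\<in>J. c' j * M j s) = 0" if "s \<in> insert t T" for s
    proof (cases "s = t")
      case True
      then show ?thesis unfolding sum
        by (simp add: sum_distrib_left sum_distrib_right mult_ac sum_negf)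
    next
      case False
      with that have "s \<in> T" by auto
      have "(\<Sum>j\<in>J. c' j * M j s) = (\<Sum>j\<in>J'. c j * (M j0 t * M j s - M j t * M j0 s))"
        unfolding sum
        by (simp add: sum_distrib_left sum_distrib_right right_diff_distrib sum_subtractf mult_ac)
      then show ?thesis using c(2)[OF \<open>s \<in> T\<close>] by simp
    qed
    moreover have "\<exists>j\<in>J. c' j \<noteq> 0" using c(1) j0 J by (auto simp: c'_def)
    ultimately show ?thesis by blast
  qed
qed

lemma ex_last_nonzero:
  fixes c :: "nat \<Rightarrow> 'a::zero"
  assumes "\<exists>k\<le>m. c k \<noteq> 0"
  obtains n where "n \<le> m" "c n \<noteq> 0" "\<And>k. n < k \<Longrightarrow> k \<le> m \<Longrightarrow> c k = 0"
proof -
  define n where "n = (GREATEST k. k \<le> m \<and> c k \<noteq> 0)"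
  have "n \<le> m" "c n \<noteq> 0"
    using GreatestI_ex_nat[of "\<lambda>k. k \<le> m \<and> c k \<noteq> 0" m] assms unfolding n_def by auto
  moreover have "c k = 0" if "n < k" "k \<le> m" for k
    using Greatest_le_nat[of "\<lambda>k. k \<le> m \<and> c k \<noteq> 0" k m] that unfolding n_def[symmetric] by force
  ultimately show ?thesis using that by blast
qed

definition euler_op :: "complex \<Rightarrow> complex poly \<Rightarrow> complex poly" where
  "euler_op c p = smult c (pCons 0 (pderiv p))"

lemma coeff_euler_op: "coeff (euler_op c p) n = c * of_nat n * coeff p n"
  by (cases n) (simp_all add: euler_op_def coeff_pderiv)

lemma euler_op_pCons: "euler_op c (pCons a p) = pCons 0 (euler_op c p + smult c p)"
  by (rule poly_eqI) (simp add: coeff_euler_op coeff_pCons algebra_simps split: nat.splits)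

lemma euler_op_0 [simp]: "euler_op c 0 = 0" by (simp add: euler_op_def)

text \<open>The outer variable of a \<open>complex poly poly\<close> stands for T, the inner one for
  S.\<close>

definition euler_deriv :: "complex \<Rightarrow> complex \<Rightarrow> complex poly poly \<Rightarrow> complex poly poly" where
  "euler_deriv c d P = map_poly (euler_op c) P + smult [:d:] (pCons 0 (pderiv P))"

lemma coeff_euler_deriv:
  "coeff (euler_deriv c d P) n = euler_op c (coeff P n) + smult (d * of_nat n) (coeff P n)"
  by (cases n) (simp_all add: euler_deriv_def coeff_pderiv coeff_map_poly mult_ac
        of_nat_poly)

lemma euler_deriv_0 [simp]: "euler_deriv c d 0 = 0"
  by (rule poly_eqI) (simp add: coeff_euler_deriv)

lemma euler_deriv_pCons:
  "euler_deriv c d (pCons p P) = pCons (euler_op c p) (euler_deriv c d P + smult [:d:] P)"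
  by (rule poly_eqI)
     (simp add: coeff_euler_deriv coeff_pCons algebra_simps smult_add_left split: nat.splits)

abbreviation pshift :: "complex \<Rightarrow> complex poly \<Rightarrow> complex poly" where
  "pshift c p \<equiv> pcompose p [:c, 1:]"

lemma pshift_pshift: "pshift c (pshift d p) = pshift (c + d) p"
  by (simp add: pcompose_assoc[symmetric] pcompose_pCons add.commute)

lemma pshift_0 [simp]: "pshift 0 p = p"
  by (simp add: pcompose_idR)

lemma pshift_eq_0_iff [simp]: "pshift c p = 0 \<longleftrightarrow> p = 0"
  by (subst pcompose_eq_0_iff) auto

lemma degree_pshift [simp]: "degree (pshift c p) = degree p"
  by (simp add: degree_pcompose)

text \<open>A bare module over C[x], so that functions and Laurent series are instances by plain
  multiplication. Torsion-freeness and injectivity of S provide the cancellation that a field would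
  give.\<close>

locale op_module = module scale
  for scale :: "complex poly \<Rightarrow> 'b::ab_group_add \<Rightarrow> 'b" (infixr \<open>\<odot>\<close> 75) +
  fixes S :: "'b \<Rightarrow> 'b" and c1 :: complex
  assumes torsion_free: "p \<odot> v = 0 \<Longrightarrow> p = 0 \<or> v = 0"
    and S_add: "S (v + w) = S v + S w"
    and S_scale: "S (p \<odot> v) = pshift c1 p \<odot> S v"
    and S_eq_0: "S v = 0 \<Longrightarrow> v = 0"
begin

sublocale S: additive S by standard (rule S_add)

lemma S_0 [simp]: "S 0 = 0" by (rule S.zero)

lemma S_const: "S ([:c:] \<odot> v) = [:c:] \<odot> S v"
  by (simp add: S_scale)

text \<open>The operator p(S), evaluated by Horner's scheme. The coefficients of p are constants, so
  these operators commute with one another.\<close>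

definition act :: "complex poly \<Rightarrow> 'b \<Rightarrow> 'b" where
  "act p v = fold_coeffs (\<lambda>a u. [:a:] \<odot> v + S u) p 0"

lemma act_0 [simp]: "act 0 v = 0" by (simp add: act_def)

lemma act_pCons [simp]: "act (pCons a p) v = [:a:] \<odot> v + S (act p v)"
  by (cases "p = 0 \<and> a = 0") (auto simp: act_def)

lemma act_v0 [simp]: "act p 0 = 0"
  by (induction p) (simp_all)

lemma act_add: "act (p + q) v = act p v + act q v"
proof (induction p q rule: poly_induct2)
  case (pCons a p b q)
  have "[:a + b:] \<odot> v = [:a:] \<odot> v + [:b:] \<odot> v"
    by (simp flip: scale_left_distrib)
  with pCons show ?case by (simp add: S_add algebra_simps)
qed auto

lemma act_smult: "act (smult c p) v = [:c:] \<odot> act p v"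
  by (induction p) (simp_all add: S_const algebra_simps)

lemma act_add_right: "act p (v + w) = act p v + act p w"
  by (induction p) (simp_all add: S_add algebra_simps)

lemma act_const: "act p ([:c:] \<odot> v) = [:c:] \<odot> act p v"
  by (induction p) (simp_all add: S_const algebra_simps)

lemma act_mult: "act (p * q) v = act p (act q v)"
  by (induction p) (simp_all add: act_add act_smult)

lemma act_1 [simp]: "act 1 v = v"
  using scale_one[of v] by (simp add: one_pCons)

lemma act_sum: "act (\<Sum>i\<in>I. p i) v = (\<Sum>i\<in>I. act (p i) v)"
  by (induction I rule: infinite_finite_induct) (simp_all add: act_add)

lemma act_monom: "act (monom c n) v = [:c:] \<odot> (S ^^ n) v"
  by (induction n) (simp_all add: monom_0 monom_Suc S_const)

lemma act_X_scale:
  "act p ([:0, 1:] \<odot> v) = [:0, 1:] \<odot> act p v + act (euler_op c1 p) v"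
proof (induction p)
  case (pCons a p)
  have *: "[:c1, 1:] \<odot> u = [:c1:] \<odot> u + [:0, 1:] \<odot> u" for u
    by (simp flip: scale_left_distrib)
  have X: "S ([:0, 1:] \<odot> u) = [:c1:] \<odot> S u + [:0, 1:] \<odot> S u" for u
    by (simp add: S_scale pcompose_pCons *)
  show ?case using pCons
    by (simp add: euler_op_pCons act_add act_smult S_add X S_const algebra_simps)
qed auto

lemma funpow_S_scale: "(S ^^ n) (p \<odot> v) = pshift (of_nat n * c1) p \<odot> (S ^^ n) v"
  by (induction n) (simp_all add: S_scale pshift_pshift algebra_simps)

lemma funpow_S_const: "(S ^^ n) ([:c:] \<odot> v) = [:c:] \<odot> (S ^^ n) v"
  by (simp add: funpow_S_scale)

lemma funpow_S_sum: "(S ^^ n) (\<Sum>i\<in>I. f i) = (\<Sum>i\<in>I. (S ^^ n) (f i))"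
  by (induction n) (simp_all add: S.sum)

lemma funpow_S_0 [simp]: "(S ^^ n) 0 = 0"
  by (induction n) simp_all

lemma funpow_S_eq_0: "(S ^^ n) v = 0 \<Longrightarrow> v = 0"
  by (induction n) (auto dest: S_eq_0)

section \<open>Spans over C(x), with denominators cleared\<close>

definition almost_in :: "'b set \<Rightarrow> 'b \<Rightarrow> bool" where
  "almost_in B v \<longleftrightarrow> (\<exists>e. e \<noteq> 0 \<and> e \<odot> v \<in> span B)"

lemma almost_in_span: "v \<in> span B \<Longrightarrow> almost_in B v"
  unfolding almost_in_def by (intro exI[of _ 1]) auto

lemma almost_in_add:
  assumes "almost_in B v" "almost_in B w"
  shows "almost_in B (v + w)"
proof -
  obtain d e where *: "d \<noteq> 0" "d \<odot> v \<in> span B" "e \<noteq> 0" "e \<odot> w \<in> span B"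
    using assms unfolding almost_in_def by blast
  have "(d * e) \<odot> (v + w) = e \<odot> (d \<odot> v) + d \<odot> (e \<odot> w)"
    by (simp add: algebra_simps)
  also have "\<dots> \<in> span B" by (rule span_add[OF span_scale[OF *(2)] span_scale[OF *(4)]])
  finally show ?thesis unfolding almost_in_def using * by (intro exI[of _ "d * e"]) simp
qed

lemma almost_in_scale:
  assumes "almost_in B v"
  shows "almost_in B (p \<odot> v)"
proof -
  obtain e where "e \<noteq> 0" "e \<odot> v \<in> span B" using assms unfolding almost_in_def by blast
  then show ?thesis unfolding almost_in_def
    by (intro exI[of _ e]) (simp add: scale_left_commute[of e] span_scale del: scale_scale)
qed

lemma almost_in_scaleD: "almost_in B (p \<odot> v) \<Longrightarrow> p \<noteq> 0 \<Longrightarrow> almost_in B v"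
  unfolding almost_in_def scale_scale by (blast dest: mult_eq_0_iff[THEN iffD1])

lemma almost_in_subspace: "subspace {v. almost_in B v}"
  by (intro subspaceI) (auto intro: almost_in_add almost_in_scale almost_in_span span_zero)

lemma almost_in_span_mono:
  assumes "\<And>b. b \<in> A \<Longrightarrow> almost_in B b" "v \<in> span A"
  shows "almost_in B v"
  using span_minimal[OF _ almost_in_subspace, of A B] assms by blast

lemma almost_in_trans:
  assumes "\<And>b. b \<in> A \<Longrightarrow> almost_in B b" "almost_in A v"
  shows "almost_in B v"
proof -
  obtain e where e: "e \<noteq> 0" "e \<odot> v \<in> span A" using assms(2) unfolding almost_in_def by blast
  have "almost_in B (e \<odot> v)" by (rule almost_in_span_mono[OF assms(1) e(2)])
  then show ?thesis using e almost_in_scaleD by blast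
qed

lemma common_denominator:
  assumes "finite A" "\<And>v. v \<in> A \<Longrightarrow> almost_in B v"
  shows "\<exists>a. a \<noteq> 0 \<and> (\<forall>v\<in>A. a \<odot> v \<in> span B)"
  using assms
proof (induction A rule: finite_induct)
  case empty
  then show ?case by (intro exI[of _ 1]) auto
next
  case (insert x A)
  have "\<exists>a. a \<noteq> 0 \<and> (\<forall>v\<in>A. a \<odot> v \<in> span B)"
    by (rule insert.IH) (simp add: insert.prems)
  then obtain a where a: "a \<noteq> 0" "\<And>v. v \<in> A \<Longrightarrow> a \<odot> v \<in> span B" by blast
  have "almost_in B x" by (simp add: insert.prems)
  then obtain e where e: "e \<noteq> 0" "e \<odot> x \<in> span B"
    unfolding almost_in_def by blast
  have "(a * e) \<odot> v \<in> span B" if "v \<in> A" for v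
    using span_scale[OF a(2)[OF that], of e] by (simp add: mult.commute)
  moreover have "(a * e) \<odot> x \<in> span B"
    using span_scale[OF e(2), of a] by simp
  moreover have "a * e \<noteq> 0" using a e by simp
  ultimately show ?case by blast
qed

lemma S_span:
  assumes "\<And>b. b \<in> A \<Longrightarrow> almost_in B (S b)" "v \<in> span A"
  shows "almost_in B (S v)"
proof -
  have "subspace {v. almost_in B (S v)}"
    by (intro subspaceI)
       (auto simp: S_add S_scale intro: almost_in_add almost_in_scale almost_in_span span_zero)
  then show ?thesis using span_minimal[of A "{v. almost_in B (S v)}"] assms by blast
qed

lemma almost_in_S:
  assumes "\<And>b. b \<in> B \<Longrightarrow> almost_in B (S b)" "almost_in B v"
  shows "almost_in B (S v)"
proof -
  obtain e where e: "e \<noteq> 0" "e \<odot> v \<in> span B" using assms(2) unfolding almost_in_def by blast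
  have "almost_in B (S (e \<odot> v))" by (rule S_span[OF assms(1) e(2)])
  then show ?thesis using e by (auto simp: S_scale dest: almost_in_scaleD)
qed

lemma almost_in_funpow_S:
  assumes "\<And>b. b \<in> B \<Longrightarrow> almost_in B (S b)" "almost_in B v"
  shows "almost_in B ((S ^^ n) v)"
  by (induction n) (simp_all add: assms(2) almost_in_S[OF assms(1)])

lemma almost_in_act:
  assumes "\<And>b. b \<in> B \<Longrightarrow> almost_in B (S b)" "almost_in B v"
  shows "almost_in B (act p v)"
proof (induction p)
  case (pCons a p)
  then show ?case using almost_in_add[OF almost_in_scale[OF assms(2)] almost_in_S[OF assms(1)]]
    by simp
qed (simp add: almost_in_span span_zero)

text \<open>The \<open>card B + 1\<close> iterates of u lie in a space of dimension at most
  \<open>card B\<close> over C(x).\<close>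

lemma shift_relation:
  assumes "finite B" "\<And>b. b \<in> B \<Longrightarrow> almost_in B (S b)" "almost_in B u"
  shows "\<exists>m c. (\<exists>i\<le>m. c i \<noteq> 0) \<and> (\<Sum>i\<le>m. c i \<odot> (S ^^ i) u) = 0"
proof -
  have "\<exists>e r. e \<noteq> 0 \<and> e \<odot> (S ^^ i) u = (\<Sum>b\<in>B. r b \<odot> b)" for i
    using almost_in_funpow_S[OF assms(2,3), of i]
    unfolding almost_in_def span_finite[OF assms(1)] by auto
  then obtain e r where er: "\<And>i. e i \<noteq> 0" "\<And>i. e i \<odot> (S ^^ i) u = (\<Sum>b\<in>B. r i b \<odot> b)"
    by metis
  obtain c where c: "\<exists>i\<in>{..card B}. c i \<noteq> 0" "\<And>b. b \<in> B \<Longrightarrow> (\<Sum>i\<le>card B. c i * r i b) = 0"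
    using underdetermined_system_solution[OF assms(1), of "{..card B}" r] by auto
  have "(\<Sum>i\<le>card B. (c i * e i) \<odot> (S ^^ i) u) = (\<Sum>i\<le>card B. c i \<odot> (e i \<odot> (S ^^ i) u))"
    by simp
  also have "\<dots> = (\<Sum>i\<le>card B. \<Sum>b\<in>B. (c i * r i b) \<odot> b)"
    unfolding er by (simp add: scale_sum_right)
  also have "\<dots> = (\<Sum>b\<in>B. (\<Sum>i\<le>card B. c i * r i b) \<odot> b)"
    by (subst sum.swap) (simp add: scale_sum_left)
  also have "\<dots> = 0" by (simp add: c)
  finally show ?thesis using c(1) er(1)
    by (intro exI[of _ "card B"] exI[of _ "\<lambda>i. c i * e i"]) auto
qed

definition const_finite :: "'b \<Rightarrow> bool" where
  "const_finite v \<longleftrightarrow> (\<exists>p. p \<noteq> 0 \<and> act p v = 0)"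

text \<open>Sorted by powers of x instead of powers of S, the relation has operators
  \<open>act (r k)\<close> as coefficients; in this shape \<open>relation_derivative\<close> can
  differentiate it.\<close>

lemma relation_by_powers:
  assumes "\<exists>i\<le>m. c i \<noteq> 0" "(\<Sum>i\<le>m. c i \<odot> (S ^^ i) u) = 0"
  shows "\<exists>n r. r n \<noteq> 0 \<and> (\<Sum>k\<le>n. [:0, 1:] ^ k \<odot> act (r k) u) = 0"
proof -
  define K where "K = Max (degree ` c ` {..m})"
  have K: "degree (c i) \<le> K" if "i \<le> m" for i
    unfolding K_def using that by (intro Max_ge) auto
  define r where "r k = (\<Sum>i\<le>m. monom (coeff (c i) k) i)" for k
  have coeff_r: "coeff (r k) i = (if i \<le> m then coeff (c i) k else 0)" for k i
    by (auto simp: r_def coeff_sum)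
  have act_r: "act (r k) u = (\<Sum>i\<le>m. [:coeff (c i) k:] \<odot> (S ^^ i) u)" for k
    by (simp add: r_def act_sum act_monom)
  have ci: "c i = (\<Sum>k\<le>K. [:0, 1:] ^ k * [:coeff (c i) k:])" if "i \<le> m" for i
  proof -
    have "c i = (\<Sum>k\<le>K. monom (coeff (c i) k) k)"
      using K[OF that] by (subst poly_as_sum_of_monoms') auto
    then show ?thesis by (simp add: monom_altdef)
  qed
  have "(\<Sum>i\<le>m. c i \<odot> (S ^^ i) u) =
      (\<Sum>i\<le>m. \<Sum>k\<le>K. ([:0, 1:] ^ k * [:coeff (c i) k:]) \<odot> (S ^^ i) u)"
    by (intro sum.cong refl, subst ci) (auto simp: scale_sum_left)
  also have "\<dots> = (\<Sum>k\<le>K. [:0, 1:] ^ k \<odot> act (r k) u)"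
    by (subst sum.swap) (simp add: act_r scale_sum_right)
  finally have rel: "(\<Sum>k\<le>K. [:0, 1:] ^ k \<odot> act (r k) u) = 0" using assms by simp
  obtain i where i: "i \<le> m" "c i \<noteq> 0" using assms by auto
  have "coeff (r (degree (c i))) i \<noteq> 0" using i by (simp add: coeff_r)
  then have "r (degree (c i)) \<noteq> 0" by auto
  then have "\<exists>k\<le>K. r k \<noteq> 0" using K[OF i(1)] by blast
  then obtain n where n: "n \<le> K" "r n \<noteq> 0" and gt: "\<And>k. n < k \<Longrightarrow> k \<le> K \<Longrightarrow> r k = 0"
    using ex_last_nonzero[of K r] by blast
  have "(\<Sum>k\<le>n. [:0, 1:] ^ k \<odot> act (r k) u) = (\<Sum>k\<le>K. [:0, 1:] ^ k \<odot> act (r k) u)"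
    using n gt by (intro sum.mono_neutral_left) auto
  then show ?thesis using n rel by auto
qed

end

section \<open>Constant coefficient relations for two shifts\<close>

locale two_shifts = op_module scale S c1 + T: op_module scale T c2
  for scale :: "complex poly \<Rightarrow> 'b::ab_group_add \<Rightarrow> 'b" (infixr \<open>\<odot>\<close> 75)
    and S T :: "'b \<Rightarrow> 'b" and c1 c2 :: complex +
  assumes commute: "S (T v) = T (S v)"
    and incommensurable: "of_int k * c1 + of_int l * c2 = 0 \<Longrightarrow> k = 0 \<and> l = 0"
begin

lemma swapped: "two_shifts scale T S c2 c1"
  using incommensurable
  by unfold_locales (simp_all add: commute, metis add.commute)

lemma act_T: "act p (T v) = T (act p v)"
  by (induction p) (simp_all add: T.S_const T.S_add commute algebra_simps)

section \<open>Polynomials in two commuting shifts\<close>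

definition act2 :: "complex poly poly \<Rightarrow> 'b \<Rightarrow> 'b" where
  "act2 P v = fold_coeffs (\<lambda>p u. act p v + T u) P 0"

lemma act2_0 [simp]: "act2 0 v = 0" by (simp add: act2_def)

lemma act2_pCons [simp]: "act2 (pCons p P) v = act p v + T (act2 P v)"
  by (cases "P = 0 \<and> p = 0") (auto simp: act2_def)

lemma act2_v0 [simp]: "act2 P 0 = 0"
  by (induction P) (simp_all)

lemma act2_add: "act2 (P + Q) v = act2 P v + act2 Q v"
  by (induction P Q rule: poly_induct2) (simp_all add: T.S_add act_add)

lemma act2_smult: "act2 (smult p P) v = act p (act2 P v)"
  by (induction P) (simp_all add: act_mult act_add_right act_T)

lemma act2_add_right: "act2 P (v + w) = act2 P v + act2 P w"
  by (induction P) (simp_all add: T.S_add act_add_right algebra_simps)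

lemma act2_sum_right: "act2 P (\<Sum>i\<in>I. f i) = (\<Sum>i\<in>I. act2 P (f i))"
  by (induction I rule: infinite_finite_induct) (simp_all add: act2_add_right)

lemma act2_mult: "act2 (P * Q) v = act2 P (act2 Q v)"
  by (induction P) (simp_all add: act2_add act2_smult)

lemma act2_1 [simp]: "act2 1 v = v"
  by (simp add: one_pCons[where 'a = "complex poly"])

lemma act2_minus: "act2 (- P) v = - act2 P v"
  using act2_add[of "-P" P v] by (simp add: eq_neg_iff_add_eq_0)

lemma act2_diff: "act2 (P - Q) v = act2 P v - act2 Q v"
  using act2_add[of P "-Q" v] by (simp add: act2_minus)

lemma act2_sum: "act2 (\<Sum>i\<in>I. P i) v = (\<Sum>i\<in>I. act2 (P i) v)"
  by (induction I rule: infinite_finite_induct) (simp_all add: act2_add)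

lemma act2_monom: "act2 (monom p n) v = (T ^^ n) (act p v)"
  by (induction n) (simp_all add: monom_0 monom_Suc)

lemma act2_X_scale:
  "act2 P ([:0, 1:] \<odot> v) = [:0, 1:] \<odot> act2 P v + act2 (euler_deriv c1 c2 P) v"
proof (induction P)
  case (pCons p P)
  have *: "[:c2, 1:] \<odot> u = [:c2:] \<odot> u + [:0, 1:] \<odot> u" for u
    by (simp flip: scale_left_distrib)
  have X: "T ([:0, 1:] \<odot> u) = [:c2:] \<odot> T u + [:0, 1:] \<odot> T u" for u
    by (simp add: T.S_scale pcompose_pCons *)
  have "act [:c:] v = [:c:] \<odot> v" for c v by simp
  then show ?case using pCons
    by (simp add: euler_deriv_pCons act2_add act2_smult T.S_add X act_X_scale T.S_const
        algebra_simps del: act_pCons)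
qed auto

text \<open>Elements of order below m in x. They absorb the lower terms that appear when an operator
  is moved past a power of x.\<close>

definition filt :: "'b \<Rightarrow> nat \<Rightarrow> 'b set" where
  "filt u m = {\<Sum>i<m. [:0, 1:] ^ i \<odot> act2 (R i) u | R. True}"

lemma filt_0: "0 \<in> filt u m"
  unfolding filt_def by (auto intro!: exI[of _ "\<lambda>_. 0"])

lemma filt_add:
  assumes "v \<in> filt u m" "w \<in> filt u m"
  shows "v + w \<in> filt u m"
proof -
  obtain R R' where "v = (\<Sum>i<m. [:0, 1:] ^ i \<odot> act2 (R i) u)"
      "w = (\<Sum>i<m. [:0, 1:] ^ i \<odot> act2 (R' i) u)"
    using assms unfolding filt_def by auto
  then have "v + w = (\<Sum>i<m. [:0, 1:] ^ i \<odot> act2 (R i + R' i) u)"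
    by (simp add: act2_add scale_right_distrib sum.distrib)
  then show ?thesis unfolding filt_def by (intro CollectI exI[of _ "\<lambda>i. R i + R' i"]) simp
qed

lemma filt_sum: "(\<And>i. i \<in> I \<Longrightarrow> f i \<in> filt u m) \<Longrightarrow> (\<Sum>i\<in>I. f i) \<in> filt u m"
  by (induction I rule: infinite_finite_induct) (auto intro: filt_0 filt_add)

lemma filt_term:
  assumes "k < m"
  shows "[:0, 1:] ^ k \<odot> act2 Q u \<in> filt u m"
proof -
  have "(\<Sum>i<m. [:0, 1:] ^ i \<odot> act2 (if i = k then Q else 0) u) =
      (\<Sum>i<m. if i = k then [:0, 1:] ^ k \<odot> act2 Q u else 0)"
    by (intro sum.cong) auto
  also have "\<dots> = [:0, 1:] ^ k \<odot> act2 Q u" using assms by simp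
  finally have "[:0, 1:] ^ k \<odot> act2 Q u =
      (\<Sum>i<m. [:0, 1:] ^ i \<odot> act2 (if i = k then Q else 0) u)" by simp
  then show ?thesis unfolding filt_def
    by (intro CollectI exI[of _ "\<lambda>i. if i = k then Q else 0"]) simp
qed

lemma filt_mono:
  assumes "v \<in> filt u m" "m \<le> n"
  shows "v \<in> filt u n"
proof -
  obtain R where "v = (\<Sum>i<m. [:0, 1:] ^ i \<odot> act2 (R i) u)"
    using assms unfolding filt_def by auto
  then show ?thesis using assms(2) by (auto intro!: filt_sum filt_term)
qed

lemma filt_X:
  assumes "v \<in> filt u m"
  shows "[:0, 1:] \<odot> v \<in> filt u (Suc m)"
proof -
  obtain R where "v = (\<Sum>i<m. [:0, 1:] ^ i \<odot> act2 (R i) u)"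
    using assms unfolding filt_def by auto
  then have "[:0, 1:] \<odot> v = (\<Sum>i<m. [:0, 1:] ^ Suc i \<odot> act2 (R i) u)"
    by (simp only: scale_sum_right scale_scale power_Suc)
  also have "\<dots> \<in> filt u (Suc m)" by (intro filt_sum filt_term) auto
  finally show ?thesis .
qed

text \<open>Leibniz rule: Q x^k = x^k Q + k x^(k-1) \<delta>Q + lower terms, with \<delta> =
  \<open>euler_deriv c1 c2\<close>. For k = 0 the truncated \<open>k - 1\<close> is harmless because
  of the factor k.\<close>

lemma act2_X_power:
  "\<exists>z\<in>filt u (k - 1). act2 Q ([:0, 1:] ^ k \<odot> act2 R u) =
     [:0, 1:] ^ k \<odot> act2 (Q * R) u +
     [:0, 1:] ^ (k - 1) \<odot> act2 (of_nat k * euler_deriv c1 c2 Q * R) u + z"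
proof (induction k arbitrary: Q)
  case 0
  then show ?case using filt_0 by (auto simp: act2_mult)
next
  case (Suc k)
  let ?D = "euler_deriv c1 c2"
  obtain z where z: "z \<in> filt u (k - 1)" "act2 Q ([:0, 1:] ^ k \<odot> act2 R u) =
     [:0, 1:] ^ k \<odot> act2 (Q * R) u + [:0, 1:] ^ (k - 1) \<odot> act2 (of_nat k * ?D Q * R) u + z"
    using Suc by blast
  obtain z' where z': "z' \<in> filt u (k - 1)" "act2 (?D Q) ([:0, 1:] ^ k \<odot> act2 R u) =
     [:0, 1:] ^ k \<odot> act2 (?D Q * R) u +
     [:0, 1:] ^ (k - 1) \<odot> act2 (of_nat k * ?D (?D Q) * R) u + z'"
    using Suc by blast
  define y where "y = [:0, 1:] ^ (k - 1) \<odot> act2 (of_nat k * ?D (?D Q) * R) u"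
  have y: "y \<in> filt u k"
    by (cases k) (auto simp: y_def filt_0 intro!: filt_term)
  have xz: "[:0, 1:] \<odot> z \<in> filt u k"
  proof (cases k)
    case 0
    then have "z = 0" using z(1) by (auto simp: filt_def)
    then show ?thesis by (simp add: filt_0)
  next
    case (Suc k')
    then show ?thesis using filt_X[OF z(1)] by simp
  qed
  have z'': "z' \<in> filt u k" using z'(1) by (rule filt_mono) simp
  have "act2 Q ([:0, 1:] ^ Suc k \<odot> act2 R u) = act2 Q ([:0, 1:] \<odot> ([:0, 1:] ^ k \<odot> act2 R u))"
    by (simp only: power_Suc scale_scale)
  also have "\<dots> = [:0, 1:] \<odot> act2 Q ([:0, 1:] ^ k \<odot> act2 R u) +
      act2 (?D Q) ([:0, 1:] ^ k \<odot> act2 R u)" by (rule act2_X_scale)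
  also have "\<dots> = [:0, 1:] ^ Suc k \<odot> act2 (Q * R) u +
      ([:0, 1:] \<odot> ([:0, 1:] ^ (k - 1) \<odot> act2 (of_nat k * ?D Q * R) u)
       + [:0, 1:] ^ k \<odot> act2 (?D Q * R) u) + ([:0, 1:] \<odot> z + y + z')"
    unfolding z z' y_def
    by (simp only: scale_right_distrib scale_scale power_Suc add_ac)
  also have "[:0, 1:] \<odot> ([:0, 1:] ^ (k - 1) \<odot> act2 (of_nat k * ?D Q * R) u)
       + [:0, 1:] ^ k \<odot> act2 (?D Q * R) u = [:0, 1:] ^ k \<odot> act2 (of_nat (Suc k) * ?D Q * R) u"
  proof (cases k)
    case (Suc k')
    have "of_nat (Suc k) * ?D Q * R = of_nat k * ?D Q * R + ?D Q * R" by (simp add: algebra_simps)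
    then show ?thesis unfolding Suc
      by (simp only: act2_add scale_right_distrib diff_Suc_1 scale_scale power_Suc)
  qed simp
  finally have "act2 Q ([:0, 1:] ^ Suc k \<odot> act2 R u) =
     [:0, 1:] ^ Suc k \<odot> act2 (Q * R) u +
     [:0, 1:] ^ (Suc k - 1) \<odot> act2 (of_nat (Suc k) * ?D Q * R) u + ([:0, 1:] \<odot> z + y + z')"
    by simp
  moreover have "[:0, 1:] \<odot> z + y + z' \<in> filt u (Suc k - 1)"
    using xz y z'' by (auto intro!: filt_add)
  ultimately show ?case by blast
qed

text \<open>Applying P lowers the degree of the relation in x by one: the top term contains P u = 0,
  and the Leibniz term m x^(m-1) \<delta>P R_m becomes the new top. After m rounds m! (\<delta>P)^m
  R_m u = 0 is left.\<close>

lemma relation_derivative: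
  assumes "(\<Sum>k\<le>m. [:0, 1:] ^ k \<odot> act2 (R k) u) = 0" "act2 P u = 0"
  shows "act2 (euler_deriv c1 c2 P ^ m * R m) u = 0"
  using assms(1)
proof (induction m arbitrary: R)
  case 0
  then show ?case by simp
next
  case (Suc m)
  let ?D = "euler_deriv c1 c2"
  have P: "act2 (P * Q) u = 0" for Q
    by (subst mult.commute) (simp add: act2_mult assms(2))
  have "\<forall>k. \<exists>z\<in>filt u (k - 1). act2 P ([:0, 1:] ^ k \<odot> act2 (R k) u) =
     [:0, 1:] ^ (k - 1) \<odot> act2 (of_nat k * ?D P * R k) u + z"
    using act2_X_power[of u _ P] by (auto simp: P)
  then obtain z where z: "\<And>k. z k \<in> filt u (k - 1)"
     "\<And>k. act2 P ([:0, 1:] ^ k \<odot> act2 (R k) u) =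
     [:0, 1:] ^ (k - 1) \<odot> act2 (of_nat k * ?D P * R k) u + z k"
    by metis
  have "z k \<in> filt u m" if "k \<le> Suc m" for k
    using filt_mono[OF z(1)] that by auto
  then have zs: "(\<Sum>k\<le>Suc m. z k) \<in> filt u m" by (intro filt_sum) auto
  have low: "(\<Sum>k\<le>m. [:0, 1:] ^ (k - 1) \<odot> act2 (of_nat k * ?D P * R k) u) \<in> filt u m"
  proof (intro filt_sum)
    fix k assume "k \<in> {..m}"
    then show "[:0, 1:] ^ (k - 1) \<odot> act2 (of_nat k * ?D P * R k) u \<in> filt u m"
      by (cases k) (auto simp: filt_0 intro!: filt_term)
  qed
  have "0 = act2 P (\<Sum>k\<le>Suc m. [:0, 1:] ^ k \<odot> act2 (R k) u)"
    unfolding Suc.prems by simp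
  also have "\<dots> = [:0, 1:] ^ m \<odot> act2 (of_nat (Suc m) * ?D P * R (Suc m)) u +
     ((\<Sum>k\<le>m. [:0, 1:] ^ (k - 1) \<odot> act2 (of_nat k * ?D P * R k) u) + (\<Sum>k\<le>Suc m. z k))"
    unfolding act2_sum_right z sum.distrib by (simp add: add_ac)
  finally have eq: "\<dots> = 0" by simp
  have "(\<Sum>k\<le>m. [:0, 1:] ^ (k - 1) \<odot> act2 (of_nat k * ?D P * R k) u) + (\<Sum>k\<le>Suc m. z k) \<in> filt u m"
    using zs low by (rule filt_add[rotated])
  then obtain R' where R': "(\<Sum>k\<le>m. [:0, 1:] ^ (k - 1) \<odot> act2 (of_nat k * ?D P * R k) u) +
      (\<Sum>k\<le>Suc m. z k) = (\<Sum>i<m. [:0, 1:] ^ i \<odot> act2 (R' i) u)"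
    unfolding filt_def by auto
  define R'' where "R'' k = (if k = m then of_nat (Suc m) * ?D P * R (Suc m) else R' k)" for k
  have "(\<Sum>k\<le>m. [:0, 1:] ^ k \<odot> act2 (R'' k) u) =
      (\<Sum>k<m. [:0, 1:] ^ k \<odot> act2 (R'' k) u) + [:0, 1:] ^ m \<odot> act2 (R'' m) u"
    by (simp only: lessThan_Suc_atMost[symmetric] sum.lessThan_Suc)
  also have "(\<Sum>k<m. [:0, 1:] ^ k \<odot> act2 (R'' k) u) = (\<Sum>k<m. [:0, 1:] ^ k \<odot> act2 (R' k) u)"
    by (intro sum.cong) (auto simp: R''_def)
  finally have "(\<Sum>k\<le>m. [:0, 1:] ^ k \<odot> act2 (R'' k) u) = 0"
    using eq unfolding R' R''_def by (simp only: add_ac simp_thms if_True)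
  then have "act2 (?D P ^ m * R'' m) u = 0" by (rule Suc.IH)
  moreover have "?D P ^ m * R'' m = smult [:of_nat (Suc m):] (?D P ^ Suc m * R (Suc m))"
    unfolding R''_def by (simp add: of_nat_poly[symmetric] of_nat_mult_conv_smult[symmetric] mult_ac del: of_nat_Suc)
  ultimately have "[:of_nat (Suc m):] \<odot> act2 (?D P ^ Suc m * R (Suc m)) u = 0"
    by (simp only: act2_smult act_pCons act_0 S_0 add_0_right)
  then show ?case by (auto dest: torsion_free simp del: of_nat_Suc)
qed

lemma incommensurable_nat:
  assumes "c1 * of_nat a + c2 * of_nat j = c1 * of_nat b + c2 * of_nat d"
  shows "a = b \<and> j = d"
proof -
  have "of_int (int a - int b) * c1 + of_int (int j - int d) * c2 = 0"
    using assms by (simp add: algebra_simps)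
  from incommensurable[OF this] show ?thesis by simp
qed

lemma coeff_mult_top:
  fixes p q :: "complex poly"
  assumes "degree p \<le> a" "degree q \<le> b"
  shows "coeff (p * q) (a + b) = coeff p a * coeff q b"
proof -
  have "coeff (p * q) (a + b) = (\<Sum>i\<le>a + b. coeff p i * coeff q (a + b - i))"
    by (simp add: coeff_mult)
  also have "\<dots> = (\<Sum>i\<in>{a}. coeff p i * coeff q (a + b - i))"
  proof (intro sum.mono_neutral_right ballI)
    fix i assume "i \<in> {..a + b} - {a}"
    then have "i > a \<or> a + b - i > b" by auto
    then show "coeff p i * coeff q (a + b - i) = 0"
      using assms by (auto simp: coeff_eq_0)
  qed auto
  finally show ?thesis by simp
qed

lemma degree_euler_op: "degree (euler_op c p) \<le> degree p"
  by (rule degree_le) (simp add: coeff_euler_op coeff_eq_0)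

text \<open>A pseudo-remainder of \<delta>P modulo P in the variable T: the two products have the
  same coefficient at T^(deg P).\<close>

definition reduce :: "complex poly poly \<Rightarrow> complex poly poly" where
  "reduce P = smult (lead_coeff P) (euler_deriv c1 c2 P)
     - smult (euler_op c1 (lead_coeff P) + smult (c2 * of_nat (degree P)) (lead_coeff P)) P"

lemma reduce_lt:
  assumes "P \<noteq> 0"
  shows "reduce P = 0 \<or> degree (reduce P) < degree P"
proof (cases "reduce P = 0")
  case False
  have "coeff (reduce P) n = 0" if "n \<ge> degree P" for n
  proof (cases "n = degree P")
    case True
    then show ?thesis by (simp add: reduce_def coeff_euler_deriv algebra_simps)
  next
    case False
    then show ?thesis using that by (simp add: reduce_def coeff_euler_deriv coeff_eq_0)
  qed
  then have "degree (reduce P) < degree P"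
    using False leading_coeff_0_iff[of "reduce P"] by (meson not_le)
  then show ?thesis by simp
qed simp

text \<open>This is where the incommensurability of the two shifts enters: in the torus the vector field
  \<open>c\<^sub>1 S \<partial>\<^sub>S + c\<^sub>2 T \<partial>\<^sub>T\<close> leaves no algebraic curve invariant.\<close>
lemma reduce_eq_0:
  assumes "reduce P = 0"
  shows "P = monom (lead_coeff P) (degree P)"
proof (rule poly_eqI)
  fix j
  let ?d = "degree P"
  have "coeff P j = 0" if "j < ?d"
  proof (rule ccontr)
    assume nz: "coeff P j \<noteq> 0"
    define p q where "p = coeff P j" and "q = lead_coeff P"
    have "coeff (reduce P) j = 0" using assms by simp
    then have "q * (euler_op c1 p + smult (c2 * of_nat j) p) =
        (euler_op c1 q + smult (c2 * of_nat ?d) q) * p"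
      by (simp add: reduce_def coeff_euler_deriv p_def q_def)
    \<comment> \<open>Compare the top coefficients in S. Since \<open>euler_op\<close> multiplies a
      leading coefficient in degree n by c1 n, the two sides carry the weights c1 deg p + c2 j and
      c1 deg q + c2 deg P.\<close>
    then have "coeff (q * (euler_op c1 p + smult (c2 * of_nat j) p)) (degree q + degree p) =
        coeff ((euler_op c1 q + smult (c2 * of_nat ?d) q) * p) (degree q + degree p)" by simp
    then have "lead_coeff q * (lead_coeff p * (c1 * of_nat (degree p) + c2 * of_nat j)) =
        lead_coeff q * (lead_coeff p * (c1 * of_nat (degree q) + c2 * of_nat ?d))"
      by (subst (asm) (1 2) coeff_mult_top)
         (auto intro!: degree_add_le degree_euler_op degree_smult_le[THEN order_trans]
           simp: coeff_euler_op algebra_simps)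
    moreover have "p \<noteq> 0" "q \<noteq> 0" using nz that by (auto simp: p_def q_def)
    ultimately have "c1 * of_nat (degree p) + c2 * of_nat j =
       c1 * of_nat (degree q) + c2 * of_nat ?d" by simp
    then show False using incommensurable_nat that by blast
  qed
  then show "coeff P j = coeff (monom (lead_coeff P) ?d) j"
    by (cases "j < ?d") (auto simp: coeff_monom coeff_eq_0)
qed

text \<open>Induction on the degree of \<open>P\<close> in \<open>T\<close>: modulo \<open>P\<close> a power of \<open>reduce P\<close>, which has smaller degree,
  annihilates \<open>u\<close> up to polynomials in \<open>S\<close>.\<close>
lemma const_finite_by_relation:
  assumes V: "\<And>v Q. v \<in> V \<Longrightarrow> act2 Q v \<in> V"
    and rel: "\<And>v. v \<in> V \<Longrightarrow> \<exists>m c. (\<exists>i\<le>m. c i \<noteq> 0) \<and> (\<Sum>i\<le>m. c i \<odot> (S ^^ i) v) = 0"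
    and "u \<in> V" "P \<noteq> 0" "act2 P u = 0"
  shows "const_finite u"
  using assms(3-5)
proof (induction "degree P" arbitrary: P u rule: less_induct)
  case less
  show ?case
  proof (rule ccontr)
    assume nf: "\<not> const_finite u"
    show False
    proof (cases "reduce P = 0")
      case True
      then have "act2 (monom (lead_coeff P) (degree P)) u = 0"
        using reduce_eq_0[OF True] less.prems(3) by simp
      then have "act (lead_coeff P) u = 0"
        unfolding act2_monom by (rule T.funpow_S_eq_0)
      then show False using nf less.prems(2) leading_coeff_0_iff[of P] unfolding const_finite_def by blast
    next
      case False
      let ?D = "euler_deriv c1 c2 P"
      from rel[OF less.prems(1)] obtain m0 c where
        "\<exists>i\<le>m0. c i \<noteq> 0" "(\<Sum>i\<le>m0. c i \<odot> (S ^^ i) u) = 0" by blast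
      from relation_by_powers[OF this] obtain m r where
        r: "r m \<noteq> 0" "(\<Sum>k\<le>m. [:0, 1:] ^ k \<odot> act (r k) u) = 0" by blast
      have "act2 (?D ^ m * [:r m:]) u = 0"
        using r(2) less.prems(3) by (intro relation_derivative) simp_all
      then have *: "act2 (smult (lead_coeff P) ?D ^ m * [:r m:]) u = 0"
        by (simp only: smult_power mult_smult_left act2_smult act_v0)
      \<comment> \<open>Modulo P, \<open>reduce P\<close> is \<open>lead_coeff P\<close> times
        \<delta>P, so their m-th powers agree as well. As P kills u, the relation for (\<delta>P)^m
        passes to \<open>reduce P ^ m\<close>.\<close>
      have "P dvd smult (lead_coeff P) ?D - reduce P"
        by (simp add: reduce_def dvd_smult)
      moreover have "smult (lead_coeff P) ?D - reduce P dvd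
          smult (lead_coeff P) ?D ^ m - reduce P ^ m"
        by (metis power_diff_sumr2 dvd_triv_left)
      ultimately have "P dvd smult (lead_coeff P) ?D ^ m - reduce P ^ m"
        by (rule dvd_trans)
      then obtain Q where "smult (lead_coeff P) ?D ^ m - reduce P ^ m = P * Q"
        by (rule dvdE)
      then have Q: "smult (lead_coeff P) ?D ^ m - reduce P ^ m = Q * P"
        by (simp only: mult.commute)
      have "reduce P ^ m = smult (lead_coeff P) ?D ^ m - Q * P" using Q by (simp add: algebra_simps)
      then have "[:r m:] * reduce P ^ m = smult (lead_coeff P) ?D ^ m * [:r m:] - ([:r m:] * Q) * P"
        by (simp only: left_diff_distrib right_diff_distrib mult_ac)
      then have "act2 ([:r m:] * reduce P ^ m) u = 0"
        using * less.prems(3) by (simp only: act2_diff act2_mult[of _ P] act2_v0 diff_0_right)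
      then have "act (r m) (act2 (reduce P ^ m) u) = 0"
        by (simp only: act2_mult) simp
      then have fin: "const_finite (act2 (reduce P ^ m) u)"
        using r(1) unfolding const_finite_def by blast
      \<comment> \<open>At l = k - 1 finiteness still fails, but one more factor
        \<open>reduce P\<close> restores it. So a nonzero operator of smaller degree in T kills
        \<open>act2 (reduce P ^ l) u\<close>, and the induction hypothesis gives the
        contradiction.\<close>
      define k where "k = (LEAST k. const_finite (act2 (reduce P ^ k) u))"
      have k: "const_finite (act2 (reduce P ^ k) u)"
        unfolding k_def using fin by (rule LeastI)
      have "k \<noteq> 0" using k nf by (intro notI) simp
      then obtain l where l: "k = Suc l" by (cases k) auto
      have nl: "\<not> const_finite (act2 (reduce P ^ l) u)"
        using not_less_Least[of l "\<lambda>k. const_finite (act2 (reduce P ^ k) u)"] l k_def by simp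
      obtain p where p: "p \<noteq> 0" "act p (act2 (reduce P ^ k) u) = 0"
        using k unfolding const_finite_def by blast
      have "act2 (smult p (reduce P)) (act2 (reduce P ^ l) u) = 0"
        using p(2) by (simp add: l act2_smult act2_mult)
      moreover have "smult p (reduce P) \<noteq> 0" "degree (smult p (reduce P)) < degree P"
        using p(1) False reduce_lt[OF less.prems(2)] by auto
      ultimately have "const_finite (act2 (reduce P ^ l) u)"
        using less.hyps V less.prems(1) by blast
      then show False using nl by simp
    qed
  qed
qed

end

section \<open>Denominators along lattice paths\<close>

lemma coprime_if_no_common_root:
  fixes p q :: "complex poly"
  assumes "p \<noteq> 0" "\<And>z. poly p z = 0 \<Longrightarrow> poly q z \<noteq> 0"
  shows "coprime p q"
proof (rule ccontr)
  assume "\<not> coprime p q"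
  then have nu: "\<not> is_unit (gcd p q)" using is_unit_gcd by blast
  have g: "gcd p q \<noteq> 0" using assms by simp
  have "degree (gcd p q) \<noteq> 0"
    using nu g is_unit_iff_degree by blast
  then have "\<not> constant (poly (gcd p q))" by (simp add: constant_degree)
  then obtain z where "poly (gcd p q) z = 0"
    using fundamental_theorem_of_algebra by blast
  then have "poly p z = 0" "poly q z = 0"
    by (meson dvd_trans gcd_dvd1 gcd_dvd2 poly_eq_0_iff_dvd)+
  then show False using assms(2) by blast
qed

lemma pshift_prod: "pshift c (\<Prod>i\<in>I. f i) = (\<Prod>i\<in>I. pshift c (f i))"
  by (induction I rule: infinite_finite_induct) (simp_all add: pcompose_mult pcompose_1)

text \<open>If a clears the denominators of one step by c, this product clears those of n steps
  (\<open>bspan_funpow_S\<close>): one translate of a for each point passed.\<close>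

definition path_prod :: "complex poly \<Rightarrow> complex \<Rightarrow> nat \<Rightarrow> complex poly" where
  "path_prod a c n = (\<Prod>k<n. pshift (of_nat k * c) a)"

lemma path_prod_0 [simp]: "path_prod a c 0 = 1"
  by (simp add: path_prod_def)

lemma path_prod_add:
  "path_prod a c (m + n) = path_prod a c m * pshift (of_nat m * c) (path_prod a c n)"
proof (induction n)
  case (Suc n)
  have "path_prod a c (m + Suc n) = path_prod a c (m + n) * pshift (of_nat (m + n) * c) a"
    by (simp add: path_prod_def mult.commute)
  also have "\<dots> = path_prod a c m * pshift (of_nat m * c) (path_prod a c n * pshift (of_nat n * c) a)"
    by (simp add: Suc pcompose_mult pshift_pshift algebra_simps)
  also have "path_prod a c n * pshift (of_nat n * c) a = path_prod a c (Suc n)"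
    by (simp add: path_prod_def mult.commute)
  finally show ?case .
qed (simp add: pcompose_1)

lemma path_prod_Suc: "path_prod a c (Suc n) = a * pshift c (path_prod a c n)"
  using path_prod_add[of a c 1 n] by (simp add: path_prod_def)

lemma path_prod_eq_0_iff [simp]: "path_prod a c n = 0 \<longleftrightarrow> a = 0 \<and> n \<noteq> 0"
  by (auto simp: path_prod_def)

lemma pshift_path_prod:
  "pshift d (path_prod a c n) = (\<Prod>k<n. pshift (d + of_nat k * c) a)"
  by (simp add: path_prod_def pshift_prod pshift_pshift)

context op_module
begin

text \<open>The degree bound makes this a space of dimension at most \<open>card B * (d + 1)\<close>
  over C, as needed for the count in \<open>constant_coefficient_relation\<close>.\<close>

definition bspan :: "'b set \<Rightarrow> nat \<Rightarrow> 'b set" where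
  "bspan B d = {\<Sum>b\<in>B. r b \<odot> b | r. \<forall>b\<in>B. degree (r b) \<le> d}"

lemma bspan_mono: "v \<in> bspan B d \<Longrightarrow> d \<le> e \<Longrightarrow> v \<in> bspan B e"
  unfolding bspan_def using order_trans by blast

lemma bspan_add:
  assumes "v \<in> bspan B d" "w \<in> bspan B d"
  shows "v + w \<in> bspan B d"
proof -
  obtain r s where "v = (\<Sum>b\<in>B. r b \<odot> b)" "w = (\<Sum>b\<in>B. s b \<odot> b)"
      "\<forall>b\<in>B. degree (r b) \<le> d" "\<forall>b\<in>B. degree (s b) \<le> d"
    using assms unfolding bspan_def by blast
  then show ?thesis unfolding bspan_def
    by (intro CollectI exI[of _ "\<lambda>b. r b + s b"])
       (auto simp: scale_left_distrib sum.distrib intro: degree_add_le)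
qed

lemma bspan_0: "0 \<in> bspan B d"
  unfolding bspan_def by (intro CollectI exI[of _ "\<lambda>_. 0"]) auto

lemma bspan_sum: "(\<And>i. i \<in> I \<Longrightarrow> f i \<in> bspan B d) \<Longrightarrow> (\<Sum>i\<in>I. f i) \<in> bspan B d"
  by (induction I rule: infinite_finite_induct) (simp_all add: bspan_0 bspan_add)

lemma bspan_scale:
  assumes "v \<in> bspan B d"
  shows "p \<odot> v \<in> bspan B (degree p + d)"
proof -
  obtain r where "v = (\<Sum>b\<in>B. r b \<odot> b)" "\<forall>b\<in>B. degree (r b) \<le> d"
    using assms unfolding bspan_def by blast
  then show ?thesis unfolding bspan_def
    by (intro CollectI exI[of _ "\<lambda>b. p * r b"])
       (auto simp: scale_sum_right intro: degree_mult_le[THEN order_trans])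
qed

lemma bspan_subset_span: "bspan B d \<subseteq> span B"
  unfolding bspan_def by (auto intro!: span_sum span_scale intro: span_base)

lemma span_imp_bspan:
  assumes "finite B" "v \<in> span B"
  shows "\<exists>d. v \<in> bspan B d"
proof -
  obtain r where r: "v = (\<Sum>b\<in>B. r b \<odot> b)"
    using assms by (auto simp: span_finite)
  have "degree (r b) \<le> Max (degree ` r ` B)" if "b \<in> B" for b
    using that assms by (intro Max_ge) auto
  then show ?thesis using r unfolding bspan_def by blast
qed

lemma finite_span_imp_bspan:
  assumes "finite B" "finite A" "A \<subseteq> span B"
  shows "\<exists>d. A \<subseteq> bspan B d"
proof -
  have "\<forall>v\<in>A. \<exists>d. v \<in> bspan B d" using assms span_imp_bspan by blast
  then obtain d where d: "\<And>v. v \<in> A \<Longrightarrow> v \<in> bspan B (d v)" by metis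
  have "v \<in> bspan B (Max (d ` A))" if "v \<in> A" for v
    using d[OF that] by (rule bspan_mono) (use that assms in auto)
  then show ?thesis by blast
qed

text \<open>Coordinates over an independent B are unique, so those of e v are e times those of v,
  and dividing by e cannot raise a degree.\<close>

lemma bspan_cancel:
  assumes "finite B" "independent B" "e \<noteq> 0" "v \<in> span B" "e \<odot> v \<in> bspan B d"
  shows "v \<in> bspan B d"
proof -
  obtain r where r: "v = (\<Sum>b\<in>B. r b \<odot> b)" using assms(1,4) by (auto simp: span_finite)
  obtain s where s: "e \<odot> v = (\<Sum>b\<in>B. s b \<odot> b)" "\<forall>b\<in>B. degree (s b) \<le> d"
    using assms(5) unfolding bspan_def by blast
  have "(\<Sum>b\<in>B. (e * r b - s b) \<odot> b) = 0"
    using r s(1) by (simp add: scale_left_diff_distrib sum_subtractf scale_sum_right)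
  then have eq: "e * r b - s b = 0" if "b \<in> B" for b
    by (rule independentD[OF assms(2,1) order_refl _ that])
  have "degree (r b) \<le> d" if "b \<in> B" for b
  proof (cases "r b = 0")
    case False
    then have "degree (r b) \<le> degree (e * r b)" using assms(3) by (simp add: degree_mult_eq)
    also have "e * r b = s b" using eq[OF that] by simp
    finally show ?thesis using s(2) that by force
  qed simp
  then show ?thesis using r unfolding bspan_def by blast
qed

lemma bspan_S:
  assumes "\<And>b. b \<in> B \<Longrightarrow> a \<odot> S b \<in> bspan B D" "v \<in> bspan B d"
  shows "a \<odot> S v \<in> bspan B (d + D)"
proof -
  obtain r where r: "v = (\<Sum>b\<in>B. r b \<odot> b)" "\<forall>b\<in>B. degree (r b) \<le> d"
    using assms(2) unfolding bspan_def by blast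
  have "a \<odot> S v = (\<Sum>b\<in>B. pshift c1 (r b) \<odot> (a \<odot> S b))"
    by (simp add: r S.sum S_scale scale_sum_right mult.commute)
  also have "\<dots> \<in> bspan B (d + D)"
  proof (rule bspan_sum)
    fix b assume b: "b \<in> B"
    have "pshift c1 (r b) \<odot> (a \<odot> S b) \<in> bspan B (degree (pshift c1 (r b)) + D)"
      by (rule bspan_scale[OF assms(1)[OF b]])
    then show "pshift c1 (r b) \<odot> (a \<odot> S b) \<in> bspan B (d + D)"
      by (rule bspan_mono) (use r(2) b in auto)
  qed
  finally show ?thesis .
qed

lemma bspan_funpow_S:
  assumes "\<And>b. b \<in> B \<Longrightarrow> a \<odot> S b \<in> bspan B D" "v \<in> bspan B d"
  shows "path_prod a c1 n \<odot> (S ^^ n) v \<in> bspan B (d + n * D)"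
proof (induction n)
  case (Suc n)
  have "a \<odot> S (path_prod a c1 n \<odot> (S ^^ n) v) \<in> bspan B (d + n * D + D)"
    by (rule bspan_S[OF assms(1) Suc])
  then show ?case by (simp add: S_scale path_prod_Suc algebra_simps)
qed (simp add: assms(2))

lemma maximal_independent:
  assumes "finite A"
  shows "\<exists>B\<subseteq>A. independent B \<and> (\<forall>v\<in>A. almost_in B v)"
  using assms
proof (induction A rule: finite_induct)
  case empty
  then show ?case using independent_empty by blast
next
  case (insert x A)
  then obtain B where B: "B \<subseteq> A" "independent B" "\<And>v. v \<in> A \<Longrightarrow> almost_in B v" by blast
  have fin: "finite B" using B insert.hyps finite_subset by blast
  show ?case
  proof (cases "almost_in B x")
    case True
    then show ?thesis using B by (intro exI[of _ B]) auto
  next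
    case False
    have "independent (insert x B)"
    proof (rule ccontr)
      assume "\<not> independent (insert x B)"
      then obtain u where u: "\<exists>v\<in>insert x B. u v \<noteq> 0" "(\<Sum>v\<in>insert x B. u v \<odot> v) = 0"
        using dependent_finite[of "insert x B"] fin by blast
      have xB: "x \<notin> B" using B insert.hyps by blast
      have eq: "u x \<odot> x + (\<Sum>v\<in>B. u v \<odot> v) = 0" using u(2) fin xB by simp
      show False
      proof (cases "u x = 0")
        case True
        then have "\<forall>v\<in>B. u v = 0"
          using eq independentD[OF B(2) fin order_refl, of u] by simp
        then show False using u(1) True by auto
      next
        case nz: False
        have "u x \<odot> x = - (\<Sum>v\<in>B. u v \<odot> v)" using eq by (simp add: eq_neg_iff_add_eq_0)
        also have "\<dots> \<in> span B" by (intro span_neg span_sum span_scale span_base)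
        finally show False using False nz unfolding almost_in_def by blast
      qed
    qed
    moreover have "almost_in (insert x B) v" if "v \<in> insert x A" for v
    proof (cases "v = x")
      case True
      then show ?thesis by (intro almost_in_span span_base) auto
    next
      case False
      then have "almost_in B v" using that B by auto
      then show ?thesis unfolding almost_in_def
        using span_mono[of B "insert x B"] by blast
    qed
    ultimately show ?thesis using B by (intro exI[of _ "insert x B"]) auto
  qed
qed

end

context two_shifts
begin

text \<open>Incommensurability makes (k, l) \<mapsto> k c1 + l c2 injective, and the differences of
  roots of a form a finite set. R is the lattice distance from which on translates of a are
  coprime.\<close>

lemma finite_common_roots:
  assumes "a \<noteq> 0"
  shows "\<exists>R::nat. \<forall>k l z. poly a z = 0 \<and> poly a (z + of_int k * c1 + of_int l * c2) = 0 \<longrightarrow>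
           \<bar>k\<bar> < int R \<and> \<bar>l\<bar> < int R"
proof -
  define Z where "Z = {z. poly a z = 0}"
  have fin: "finite Z" unfolding Z_def using assms by (rule poly_roots_finite)
  define F where "F = (\<lambda>(k, l). of_int k * c1 + of_int l * c2)"
  have "inj F"
  proof (rule injI)
    fix x y assume "F x = F y"
    then have "of_int (fst x - fst y) * c1 + of_int (snd x - snd y) * c2 = 0"
      by (simp add: F_def case_prod_unfold algebra_simps)
    from incommensurable[OF this] show "x = y" by (simp add: prod_eq_iff)
  qed
  define W where "W = F -` ((\<lambda>(x, y). x - y) ` (Z \<times> Z))"
  have "finite W" unfolding W_def using \<open>inj F\<close> fin by (intro finite_vimageI) auto
  define R where "R = Suc (nat (Max (insert 0 ((\<lambda>(k, l). max \<bar>k\<bar> \<bar>l\<bar>) ` W))))"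
  have "\<bar>k\<bar> < int R \<and> \<bar>l\<bar> < int R"
    if "poly a z = 0 \<and> poly a (z + of_int k * c1 + of_int l * c2) = 0" for k l z
  proof -
    have "F (k, l) = (z + of_int k * c1 + of_int l * c2) - z" by (simp add: F_def)
    then have "(k, l) \<in> W" unfolding W_def using that Z_def by force
    then have "max \<bar>k\<bar> \<bar>l\<bar> \<le> Max (insert 0 ((\<lambda>(k, l). max \<bar>k\<bar> \<bar>l\<bar>) ` W))"
      using \<open>finite W\<close> by (intro Max_ge) force+
    then show ?thesis unfolding R_def by linarith
  qed
  then show ?thesis by blast
qed

lemma coprime_pshift:
  assumes "a \<noteq> 0" "\<And>z. poly a z = 0 \<Longrightarrow> poly a (z + (y - x)) \<noteq> 0"
  shows "coprime (pshift x a) (pshift y a)"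
proof (rule coprime_if_no_common_root)
  fix z assume "poly (pshift x a) z = 0"
  then have "poly a (z + x + (y - x)) \<noteq> 0"
    using assms(2)[of "z + x"] by (simp add: poly_pcompose algebra_simps)
  then show "poly (pshift y a) z \<noteq> 0" by (simp add: poly_pcompose algebra_simps)
qed (use assms in auto)

lemma funpow_commute: "(S ^^ i) ((T ^^ j) v) = (T ^^ j) ((S ^^ i) v)"
proof -
  have "S ((T ^^ j) v) = (T ^^ j) (S v)" for v by (induction j) (simp_all add: commute)
  then show ?thesis by (induction i) simp_all
qed

text \<open>The denominator of \<open>S\<^sup>i T\<^sup>j g\<close> can be read off along two lattice paths, horizontal steps
  first or vertical steps first. Away from their end points these paths are far apart, so that only
  the contributions near the end points survive.\<close>
lemma denominator_near_ends:
  assumes "finite B" "a \<noteq> 0"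
    and aS: "\<And>b. b \<in> B \<Longrightarrow> a \<odot> S b \<in> bspan B D"
    and aT: "\<And>b. b \<in> B \<Longrightarrow> a \<odot> T b \<in> bspan B D"
    and R: "\<And>k l z. poly a z = 0 \<Longrightarrow> poly a (z + of_int k * c1 + of_int l * c2) = 0 \<Longrightarrow>
           \<bar>k\<bar> < int R \<and> \<bar>l\<bar> < int R"
    and ind: "independent B" and g: "g \<in> bspan B d"
  shows "path_prod a c1 R \<odot> (S ^^ (R + i)) ((T ^^ (R + j))
           (pshift (- of_nat R * c2) (path_prod a c2 R) \<odot> g))
         \<in> bspan B (d + (2 * R + i + j) * D)"
proof -
  let ?I = "R + i" and ?J = "R + j"
  define w where "w = (S ^^ ?I) ((T ^^ ?J) g)"
  \<comment> \<open>On the path along S first, \<open>near\<close> collects the first R and the last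
    R steps and \<open>far\<close> everything between; \<open>other\<close> belongs to the path
    along T first. Every point of \<open>far\<close> differs from every point of
    \<open>other\<close> by at least R in one coordinate.\<close>
  define near where "near = path_prod a c1 R *
     pshift (of_nat ?I * c1 + of_nat j * c2) (path_prod a c2 R)"
  define far where "far = pshift (of_nat R * c1) (path_prod a c1 i) *
     pshift (of_nat ?I * c1) (path_prod a c2 j)"
  define other where "other = path_prod a c2 ?J * pshift (of_nat ?J * c2) (path_prod a c1 ?I)"
  have "path_prod a c1 ?I \<odot> (S ^^ ?I) (path_prod a c2 ?J \<odot> (T ^^ ?J) g)
      \<in> bspan B (d + ?J * D + ?I * D)"
    by (intro bspan_funpow_S T.bspan_funpow_S aS aT g)
  moreover have "path_prod a c1 ?I * pshift (of_nat ?I * c1) (path_prod a c2 ?J) = far * near"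
    unfolding path_prod_add[of a c1 R i] path_prod_add[of a c2 j R] add.commute[of R j]
      pcompose_mult pshift_pshift near_def far_def by (simp only: mult_ac)
  moreover have steps: "d + ?J * D + ?I * D = d + (2 * R + i + j) * D"
    by (simp add: algebra_simps)
  ultimately have 1: "far \<odot> (near \<odot> w) \<in> bspan B (d + (2 * R + i + j) * D)"
    by (simp only: funpow_S_scale w_def scale_scale steps)
  have "path_prod a c2 ?J \<odot> (T ^^ ?J) (path_prod a c1 ?I \<odot> (S ^^ ?I) g)
      \<in> bspan B (d + ?I * D + ?J * D)"
    by (intro bspan_funpow_S T.bspan_funpow_S aS aT g)
  then have "other \<odot> w \<in> span B"
    using bspan_subset_span by (auto simp: T.funpow_S_scale w_def other_def funpow_commute)
  then have 2: "other \<odot> (near \<odot> w) \<in> span B"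
    using span_scale[of "other \<odot> w" B near] by (simp add: mult.commute)
  have cop: "coprime (pshift x a) (pshift y a)"
    if "y - x = of_int k * c1 + of_int l * c2" "\<bar>k\<bar> \<ge> int R \<or> \<bar>l\<bar> \<ge> int R" for x y k l
    using R[of _ k l] that assms(2) by (intro coprime_pshift) (auto simp: algebra_simps)
  have "coprime far other"
    unfolding far_def other_def pshift_path_prod path_prod_def[of a c2 ?J]
      coprime_mult_left_iff coprime_mult_right_iff
  proof (intro conjI prod_coprime_left prod_coprime_right)
    fix k k' assume "k \<in> {..<i}" "k' \<in> {..<?J}"
    then show "coprime (pshift (of_nat R * c1 + of_nat k * c1) a) (pshift (of_nat k' * c2) a)"
      by (intro cop[of _ _ "- int (R + k)" "int k'"]) (auto simp: algebra_simps)
  next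
    fix k k' assume "k \<in> {..<i}" "k' \<in> {..<?I}"
    then show "coprime (pshift (of_nat R * c1 + of_nat k * c1) a)
       (pshift (of_nat ?J * c2 + of_nat k' * c1) a)"
      by (intro cop[of _ _ "int k' - int (R + k)" "int ?J"]) (auto simp: algebra_simps)
  next
    fix k k' assume "k \<in> {..<j}" "k' \<in> {..<?J}"
    then show "coprime (pshift (of_nat ?I * c1 + of_nat k * c2) a) (pshift (of_nat k' * c2) a)"
      by (intro cop[of _ _ "- int ?I" "int k' - int k"]) (auto simp: algebra_simps)
  next
    fix k k' assume "k \<in> {..<j}" "k' \<in> {..<?I}"
    then show "coprime (pshift (of_nat ?I * c1 + of_nat k * c2) a)
       (pshift (of_nat ?J * c2 + of_nat k' * c1) a)"
      by (intro cop[of _ _ "int k' - int ?I" "int ?J - int k"]) (auto simp: algebra_simps)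
  qed
  \<comment> \<open>Multiplication by \<open>far\<close> and by \<open>other\<close> both takes
    \<open>near \<odot> w\<close> into the span, so Bezout puts \<open>near \<odot> w\<close> itself
    there. The degree bound then comes from \<open>far\<close> by
    \<open>bspan_cancel\<close>.\<close>
  then obtain u v where uv: "u * far + v * other = 1"
    by (metis bezout_coefficients_fst_snd coprime_iff_gcd_eq_1)
  have "near \<odot> w = u \<odot> (far \<odot> (near \<odot> w)) + v \<odot> (other \<odot> (near \<odot> w))"
    unfolding scale_scale[of u] scale_scale[of v] scale_left_distrib[symmetric] uv by simp
  also have "\<dots> \<in> span B"
    using 1 2 bspan_subset_span by (intro span_add span_scale[of _ B u] span_scale[of _ B v]) auto
  finally have 3: "near \<odot> w \<in> span B" .
  have "far \<noteq> 0" using assms(2) by (simp add: far_def)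
  from bspan_cancel[OF assms(1) ind this 3 1]
  have "near \<odot> w \<in> bspan B (d + (2 * R + i + j) * D)" .
  \<comment> \<open>The factor at the far end, carried back through both shifts onto g, loses its
    dependence on i and j. Thus one fixed multiplier on either side serves all pairs (i, j).\<close>
  moreover have "near \<odot> w = path_prod a c1 R \<odot> (S ^^ ?I) ((T ^^ ?J)
           (pshift (- of_nat R * c2) (path_prod a c2 R) \<odot> g))"
    by (simp add: T.funpow_S_scale funpow_S_scale pshift_pshift near_def w_def algebra_simps)
  ultimately show ?thesis by simp
qed

lemma act2_double_sum:
  "act2 (\<Sum>i<N. \<Sum>j<N. monom (monom (c i j) i) j) v =
     (\<Sum>i<N. \<Sum>j<N. [:c i j:] \<odot> (S ^^ i) ((T ^^ j) v))"
  by (simp add: act2_sum act2_monom act_monom T.funpow_S_const funpow_commute)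

lemma double_sum_poly_nonzero:
  fixes c :: "nat \<Rightarrow> nat \<Rightarrow> complex"
  assumes "i < N" "j < N" "c i j \<noteq> 0"
  shows "(\<Sum>i<N. \<Sum>j<N. monom (monom (c i j) i) j) \<noteq> 0"
proof -
  have "coeff (coeff (\<Sum>i<N. \<Sum>j<N. monom (monom (c i j) i) j) j) i
      = (\<Sum>i'<N. \<Sum>j'<N. if j' = j then (if i' = i then c i' j' else 0) else 0)"
    unfolding coeff_sum by (intro sum.cong) (auto simp: coeff_sum coeff_monom)
  also have "\<dots> = c i j" using assms by simp
  finally show ?thesis using assms(3) by auto
qed

lemma constant_coefficient_relation:
  assumes "finite B" "a \<noteq> 0" "independent B"
    and "\<And>b. b \<in> B \<Longrightarrow> a \<odot> S b \<in> bspan B D" "\<And>b. b \<in> B \<Longrightarrow> a \<odot> T b \<in> bspan B D"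
    and "g \<in> bspan B d"
  shows "\<exists>q N c. q \<noteq> 0 \<and> (\<exists>i<N. \<exists>j<N. c i j \<noteq> 0) \<and>
    (\<Sum>i<N. \<Sum>j<N. [:c i j:] \<odot> (S ^^ i) ((T ^^ j) (q \<odot> g))) = 0"
proof -
  obtain R where R: "\<And>k l z. poly a z = 0 \<Longrightarrow> poly a (z + of_int k * c1 + of_int l * c2) = 0 \<Longrightarrow>
           \<bar>k\<bar> < int R \<and> \<bar>l\<bar> < int R"
    using finite_common_roots[OF assms(2)] by blast
  define q where "q = pshift (- of_nat R * c2) (path_prod a c2 R)"
  define s where "s = path_prod a c1 R"
  have nz: "q \<noteq> 0" "s \<noteq> 0" using assms(2) by (auto simp: q_def s_def)
  \<comment> \<open>There are N^2 unknowns and \<open>card B * (L + 1)\<close> = \<gamma> + N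
    \<beta> equations; with N = \<beta> + \<gamma> + 1 the former number is N \<beta> + N \<gamma> +
    N, which is larger.\<close>
  define \<beta> where "\<beta> = card B * 2 * D"
  define \<gamma> where "\<gamma> = card B * (d + 2 * R * D + 1)"
  define N where "N = \<beta> + \<gamma> + 1"
  define L where "L = d + (2 * R + N + N) * D"
  define u where "u = (\<lambda>(i, j). s \<odot> (S ^^ (R + i)) ((T ^^ (R + j)) (q \<odot> g)))"
  have "u x \<in> bspan B L" if x: "x \<in> {..<N} \<times> {..<N}" for x
  proof -
    obtain i j where ij: "x = (i, j)" "i < N" "j < N" using x by auto
    have "u x \<in> bspan B (d + (2 * R + i + j) * D)"
      unfolding ij u_def s_def q_def prod.case using assms R by (intro denominator_near_ends)
    then show ?thesis
      by (rule bspan_mono) (use ij in \<open>auto simp: L_def intro!: mult_right_mono\<close>)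
  qed
  then have "\<forall>x\<in>{..<N} \<times> {..<N}. \<exists>r. u x = (\<Sum>b\<in>B. r b \<odot> b) \<and> (\<forall>b\<in>B. degree (r b) \<le> L)"
    unfolding bspan_def by blast
  then obtain r where r: "\<And>x. x \<in> {..<N} \<times> {..<N} \<Longrightarrow> u x = (\<Sum>b\<in>B. r x b \<odot> b)"
      "\<And>x b. x \<in> {..<N} \<times> {..<N} \<Longrightarrow> b \<in> B \<Longrightarrow> degree (r x b) \<le> L"
    by metis
  have "card (B \<times> {..L}) = \<gamma> + N * \<beta>"
    by (simp add: card_cartesian_product \<beta>_def \<gamma>_def L_def algebra_simps)
  also have "\<dots> < N + N * \<gamma> + N * \<beta>"
    by (simp add: N_def algebra_simps)
  also have "\<dots> = card ({..<N} \<times> {..<N})"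
    by (simp add: card_cartesian_product N_def algebra_simps)
  finally have card: "card (B \<times> {..L}) < card ({..<N} \<times> {..<N})" .
  obtain c where c: "\<exists>x\<in>{..<N} \<times> {..<N}. c x \<noteq> 0"
    "\<And>t. t \<in> B \<times> {..L} \<Longrightarrow> (\<Sum>x\<in>{..<N} \<times> {..<N}. c x * (case t of (b, n) \<Rightarrow> coeff (r x b) n)) = 0"
    using underdetermined_system_solution[OF _ _ card,
        of "\<lambda>x t. case t of (b, n) \<Rightarrow> coeff (r x b) n"] assms(1) by auto
  have zero: "(\<Sum>x\<in>{..<N} \<times> {..<N}. [:c x:] * r x b) = 0" if "b \<in> B" for b
  proof (rule poly_eqI)
    fix n
    show "coeff (\<Sum>x\<in>{..<N} \<times> {..<N}. [:c x:] * r x b) n = coeff 0 n"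
    proof (cases "n \<le> L")
      case True
      then show ?thesis using c(2)[of "(b, n)"] that by (simp add: coeff_sum)
    next
      case False
      then have "coeff (r x b) n = 0" if "x \<in> {..<N} \<times> {..<N}" for x
        using r(2)[OF that \<open>b \<in> B\<close>] by (intro coeff_eq_0) simp
      then show ?thesis by (simp add: coeff_sum)
    qed
  qed
  have "(\<Sum>x\<in>{..<N} \<times> {..<N}. [:c x:] \<odot> u x) =
      (\<Sum>x\<in>{..<N} \<times> {..<N}. \<Sum>b\<in>B. ([:c x:] * r x b) \<odot> b)"
    by (intro sum.cong) (simp_all only: r scale_sum_right scale_scale)
  also have "\<dots> = (\<Sum>b\<in>B. (\<Sum>x\<in>{..<N} \<times> {..<N}. [:c x:] * r x b) \<odot> b)"
    by (subst sum.swap) (simp only: scale_sum_left)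
  also have "\<dots> = 0" using zero by simp
  finally have 1: "(\<Sum>x\<in>{..<N} \<times> {..<N}. [:c x:] \<odot> u x) = 0" .
  define w where "w = (\<Sum>i<N. \<Sum>j<N. [:c (i, j):] \<odot> (S ^^ i) ((T ^^ j) (q \<odot> g)))"
  have comb: "(S ^^ R) ((T ^^ R) ((S ^^ i) ((T ^^ j) v))) = (S ^^ (R + i)) ((T ^^ (R + j)) v)" for i j v
    by (simp only: funpow_add o_apply funpow_commute[of i R, symmetric])
  \<comment> \<open>The degree estimate covers exponents from R on, so the relation found is the
    wanted one after applying S^R T^R and multiplying by s, both injective.\<close>
  have "(S ^^ R) ((T ^^ R) w) =
      (\<Sum>i<N. \<Sum>j<N. [:c (i, j):] \<odot> (S ^^ (R + i)) ((T ^^ (R + j)) (q \<odot> g)))"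
    by (simp only: w_def funpow_S_sum T.funpow_S_sum funpow_S_const T.funpow_S_const comb)
  then have "s \<odot> (S ^^ R) ((T ^^ R) w) = (\<Sum>i<N. \<Sum>j<N. [:c (i, j):] \<odot> u (i, j))"
    by (simp only: scale_sum_right u_def prod.case scale_left_commute[of s])
  also have "\<dots> = 0" using 1 by (simp add: sum.cartesian_product)
  finally have "(S ^^ R) ((T ^^ R) w) = 0" using nz torsion_free by blast
  then have "w = 0" by (blast dest: funpow_S_eq_0 T.funpow_S_eq_0)
  then show ?thesis using nz(1) c(1) unfolding w_def
    by (intro exI[of _ q] exI[of _ N] exI[of _ "\<lambda>i j. c (i, j)"]) auto
qed

lemma const_finite_S:
  assumes "finite B"
    and "\<And>b. b \<in> B \<Longrightarrow> almost_in B (S b)" "\<And>b. b \<in> B \<Longrightarrow> almost_in B (T b)"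
    and "almost_in B h" "i < N" "j < N" "c i j \<noteq> 0"
    and "(\<Sum>i<N. \<Sum>j<N. [:c i j:] \<odot> (S ^^ i) ((T ^^ j) h)) = 0"
  shows "const_finite h"
proof (rule const_finite_by_relation[where P = "\<Sum>i<N. \<Sum>j<N. monom (monom (c i j) i) j"])
  show "h \<in> {v. almost_in B v}" using assms(4) by simp
  show "act2 Q v \<in> {v. almost_in B v}" if "v \<in> {v. almost_in B v}" for v Q
    using that
  proof (induction Q)
    case (pCons p P)
    then show ?case
      using almost_in_act[OF assms(2)] T.almost_in_S[OF assms(3)]
      by (auto intro!: almost_in_add)
  qed (simp add: almost_in_span span_zero)
  show "\<exists>m c. (\<exists>i\<le>m. c i \<noteq> 0) \<and> (\<Sum>i\<le>m. c i \<odot> (S ^^ i) v) = 0" if "v \<in> {v. almost_in B v}" for v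
    using shift_relation[OF assms(1,2)] that by blast
qed (use assms(8) double_sum_poly_nonzero[of i N j c, OF assms(5-7)] act2_double_sum in auto)

section \<open>A finite basis stable under both shifts\<close>

definition box :: "'b \<Rightarrow> nat \<Rightarrow> nat \<Rightarrow> 'b set" where
  "box f m n = (\<lambda>(i, j). (S ^^ i) ((T ^^ j) f)) ` ({..<m} \<times> {..<n})"

lemma in_box: "i < m \<Longrightarrow> j < n \<Longrightarrow> (S ^^ i) ((T ^^ j) f) \<in> box f m n"
  unfolding box_def by force

text \<open>At the edge i + 1 = m the T^j-translate of the relation expresses S^m T^j f by lower
  powers of S. Its leading coefficient is a translate of \<open>a m\<close>, hence nonzero.\<close>

lemma almost_in_box_S:
  assumes "a m \<noteq> 0" "(\<Sum>i\<le>m. a i \<odot> (S ^^ i) f) = 0" "v \<in> box f m n"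
  shows "almost_in (box f m n) (S v)"
proof -
  obtain i j where ij: "v = (S ^^ i) ((T ^^ j) f)" "i < m" "j < n"
    using assms(3) unfolding box_def by auto
  show ?thesis
  proof (cases "Suc i < m")
    case True
    have "S v = (S ^^ Suc i) ((T ^^ j) f)" by (simp add: ij)
    then show ?thesis using in_box[OF True ij(3)] by (simp add: almost_in_span span_base)
  next
    case False
    then have m: "m = Suc i" using ij by simp
    have "0 = (T ^^ j) (\<Sum>i\<le>m. a i \<odot> (S ^^ i) f)" using assms(2) by simp
    also have "\<dots> = (\<Sum>i\<le>m. pshift (of_nat j * c2) (a i) \<odot> (S ^^ i) ((T ^^ j) f))"
      by (simp add: T.funpow_S_sum T.funpow_S_scale funpow_commute)
    also have "\<dots> = (\<Sum>i<m. pshift (of_nat j * c2) (a i) \<odot> (S ^^ i) ((T ^^ j) f)) +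
        pshift (of_nat j * c2) (a m) \<odot> S v"
      by (simp add: ij m lessThan_Suc_atMost[symmetric])
    finally have "pshift (of_nat j * c2) (a m) \<odot> S v =
        - (\<Sum>i<m. pshift (of_nat j * c2) (a i) \<odot> (S ^^ i) ((T ^^ j) f))"
      by (simp add: eq_neg_iff_add_eq_0 add.commute)
    also have "\<dots> \<in> span (box f m n)" using in_box[OF _ ij(3)]
      by (auto intro!: span_neg span_sum span_scale intro: span_base)
    finally show ?thesis unfolding almost_in_def
      using assms(1) by (intro exI[of _ "pshift (of_nat j * c2) (a m)"]) auto
  qed
qed

lemma box_swapped: "two_shifts.box T S f n m = box f m n"
proof -
  interpret sw: two_shifts scale T S c2 c1 by (rule swapped)
  show ?thesis unfolding sw.box_def box_def funpow_commute by force
qed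

lemma two_shift_relation_basis:
  assumes "a m \<noteq> 0" "(\<Sum>i\<le>m. a i \<odot> (S ^^ i) f) = 0" "m > 0"
    and "b n \<noteq> 0" "(\<Sum>j\<le>n. b j \<odot> (T ^^ j) f) = 0" "n > 0"
  shows "\<exists>B. finite B \<and> independent B \<and> almost_in B f \<and>
     (\<forall>v\<in>B. almost_in B (S v)) \<and> (\<forall>v\<in>B. almost_in B (T v))"
proof -
  interpret sw: two_shifts scale T S c2 c1 by (rule swapped)
  let ?A = "box f m n"
  have fin: "finite ?A" by (simp add: box_def)
  have ST: "almost_in ?A (S v)" "almost_in ?A (T v)" if "v \<in> ?A" for v
    using almost_in_box_S[OF assms(1,2) that] sw.almost_in_box_S[OF assms(4,5)] that
    unfolding box_swapped by blast+
  obtain B where B: "B \<subseteq> ?A" "independent B" "\<And>v. v \<in> ?A \<Longrightarrow> almost_in B v"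
    using maximal_independent[OF fin] by blast
  have "almost_in B (S v)" "almost_in B (T v)" if "v \<in> B" for v
    using ST[of v] that B by (auto intro: almost_in_trans[OF B(3)])
  moreover have "almost_in B f" using B(3) in_box[of 0 m 0 n f] assms(3,6) by simp
  moreover have "finite B" using fin B finite_subset by blast
  ultimately show ?thesis using B(2) by blast
qed

text \<open>The relation with constant coefficients is symmetric in S and T, so the same multiplier
  works for both: the half about T is the half about S in the swapped locale.\<close>

theorem two_shift_const_finite:
  assumes "a m \<noteq> 0" "(\<Sum>i\<le>m. a i \<odot> (S ^^ i) f) = 0" "m > 0"
    and "b n \<noteq> 0" "(\<Sum>j\<le>n. b j \<odot> (T ^^ j) f) = 0" "n > 0"
  shows "\<exists>q. q \<noteq> 0 \<and> const_finite (q \<odot> f) \<and> T.const_finite (q \<odot> f)"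
proof -
  obtain B where B: "finite B" "independent B" "almost_in B f"
     "\<And>v. v \<in> B \<Longrightarrow> almost_in B (S v)" "\<And>v. v \<in> B \<Longrightarrow> almost_in B (T v)"
    using two_shift_relation_basis[OF assms] by blast
  have "almost_in B v" if "v \<in> S ` B \<union> T ` B" for v
    using that B(4,5) by blast
  then obtain e0 where e0: "e0 \<noteq> 0" "\<forall>v\<in>S ` B \<union> T ` B. e0 \<odot> v \<in> span B"
    using common_denominator[of "S ` B \<union> T ` B" B] B(1) by blast
  then obtain D where D: "(\<lambda>v. e0 \<odot> v) ` (S ` B \<union> T ` B) \<subseteq> bspan B D"
    using finite_span_imp_bspan[OF B(1), of "(\<lambda>v. e0 \<odot> v) ` (S ` B \<union> T ` B)"] B(1) by blast
  obtain e where e: "e \<noteq> 0" "e \<odot> f \<in> span B" using B(3) unfolding almost_in_def by blast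
  obtain d where d: "e \<odot> f \<in> bspan B d" using span_imp_bspan[OF B(1) e(2)] by blast
  have "e0 \<odot> S b \<in> bspan B D" "e0 \<odot> T b \<in> bspan B D" if "b \<in> B" for b
    using D that by blast+
  from constant_coefficient_relation[OF B(1) e0(1) B(2) this d] obtain q N c i j where
    q: "q \<noteq> 0" "i < N" "j < N" "c i j \<noteq> 0"
       "(\<Sum>i<N. \<Sum>j<N. [:c i j:] \<odot> (S ^^ i) ((T ^^ j) (q \<odot> (e \<odot> f)))) = 0"
    by blast
  have h: "almost_in B (q \<odot> (e \<odot> f))" by (intro almost_in_scale B(3))
  have "const_finite (q \<odot> (e \<odot> f))"
    using const_finite_S[OF B(1,4,5) h q(2-5)] .
  moreover have "T.const_finite (q \<odot> (e \<odot> f))"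
  proof -
    interpret sw: two_shifts scale T S c2 c1 by (rule swapped)
    have "(\<Sum>j<N. \<Sum>i<N. [:c i j:] \<odot> (T ^^ j) ((S ^^ i) (q \<odot> (e \<odot> f)))) = 0"
      using q(5) by (subst sum.swap) (simp only: funpow_commute)
    from sw.const_finite_S[OF B(1,5,4) h q(3,2) _ this] q(4) show ?thesis by blast
  qed
  ultimately show ?thesis using q(1) e(1) by (intro exI[of _ "q * e"]) simp
qed

end

section \<open>Generalized eigenvectors\<close>

context op_module
begin

text \<open>Bezout splits off the full power of one root of p at a time. \<open>Q\<close> carries
  properties preserved by the operators down to the generalized eigenvectors, while the goal
  \<open>G\<close> has to be additive.\<close>

lemma act_eigen_induct:
  assumes "p \<noteq> 0" "act p h = 0" "Q h"
    and Q: "\<And>q v. Q v \<Longrightarrow> Q (act q v)"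
    and G0: "G 0" and Gadd: "\<And>v w. G v \<Longrightarrow> G w \<Longrightarrow> G (v + w)"
    and eigen: "\<And>\<mu> n v. Q v \<Longrightarrow> act ([:- \<mu>, 1:] ^ n) v = 0 \<Longrightarrow> G v"
  shows "G h"
  using assms(1-3)
proof (induction "degree p" arbitrary: p h rule: less_induct)
  case less
  show ?case
  proof (cases "degree p = 0")
    case True
    then obtain c where c: "p = [:c:]" by (rule degree_eq_zeroE)
    then have "[:c:] \<odot> h = 0" "[:c:] \<noteq> 0" using less.prems by auto
    then have "h = 0" using torsion_free by blast
    then show ?thesis using G0 by simp
  next
    case False
    then have "\<not> constant (poly p)" by (simp add: constant_degree)
    then obtain z where z: "poly p z = 0" using fundamental_theorem_of_algebra by blast
    define n where "n = order z p"
    obtain q where q: "p = [:- z, 1:] ^ n * q" "\<not> [:- z, 1:] dvd q"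
      using order_decomp[OF less.prems(1), of z] unfolding n_def by blast
    have n: "n \<noteq> 0" using z less.prems(1) by (simp add: n_def order_root)
    have "q \<noteq> 0" using q(2) by auto
    have "degree p = n + degree q"
      unfolding q(1) using \<open>q \<noteq> 0\<close> by (simp add: degree_mult_eq degree_power_eq)
    then have deg: "degree q < degree p" using n by simp
    have "poly q z \<noteq> 0" using q(2) by (simp add: poly_eq_0_iff_dvd)
    then have "coprime ([:- z, 1:] ^ n) q"
      by (intro coprime_if_no_common_root) auto
    then obtain u v where uv: "u * [:- z, 1:] ^ n + v * q = 1"
      by (metis bezout_coefficients_fst_snd coprime_iff_gcd_eq_1)
    have "h = act (u * [:- z, 1:] ^ n) h + act (v * q) h"
      using uv by (metis act_add act_1)
    moreover have "G (act (u * [:- z, 1:] ^ n) h)"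
    proof (rule less.hyps[OF deg \<open>q \<noteq> 0\<close>])
      have "q * (u * [:- z, 1:] ^ n) = u * p" by (simp add: q mult_ac)
      then show "act q (act (u * [:- z, 1:] ^ n) h) = 0"
        using less.prems(2) by (metis act_mult act_v0)
    qed (rule Q[OF less.prems(3)])
    moreover have "G (act (v * q) h)"
    proof (rule eigen)
      have "[:- z, 1:] ^ n * (v * q) = v * p" by (simp add: q mult_ac)
      then show "act ([:- z, 1:] ^ n) (act (v * q) h) = 0"
        using less.prems(2) by (metis act_mult act_v0)
    qed (rule Q[OF less.prems(3)])
    ultimately show ?thesis using Gadd by metis
  qed
qed

text \<open>Here \<open>g i\<close> stands for a rational function times \<open>(S ^^ i) f\<close>,
  which the module cannot express; \<open>r i\<close> and \<open>d i\<close> are its numerator and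
  denominator.\<close>

lemma clear_denominators:
  assumes "\<And>i. i < m \<Longrightarrow> d i \<noteq> 0" "\<And>i. i < m \<Longrightarrow> d i \<odot> g i = r i \<odot> (S ^^ i) f"
    and "(S ^^ m) f + (\<Sum>i<m. g i) = 0"
  shows "\<exists>a. a m \<noteq> 0 \<and> (\<Sum>i\<le>m. a i \<odot> (S ^^ i) f) = 0"
proof -
  define D where "D = (\<Prod>i<m. d i)"
  define a where "a i = (if i = m then D else (\<Prod>k\<in>{..<m} - {i}. d k) * r i)" for i
  have "a i \<odot> (S ^^ i) f = D \<odot> g i" if "i < m" for i
  proof -
    have "a i \<odot> (S ^^ i) f = (\<Prod>k\<in>{..<m} - {i}. d k) \<odot> (r i \<odot> (S ^^ i) f)"
      using that by (simp add: a_def)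
    also have "\<dots> = (d i * (\<Prod>k\<in>{..<m} - {i}. d k)) \<odot> g i"
      using assms(2)[OF that, symmetric] by (simp add: mult.commute)
    also have "d i * (\<Prod>k\<in>{..<m} - {i}. d k) = D"
      unfolding D_def using that by (subst prod.remove[of _ i]) auto
    finally show ?thesis .
  qed
  then have "(\<Sum>i\<le>m. a i \<odot> (S ^^ i) f) = (\<Sum>i<m. D \<odot> g i) + D \<odot> (S ^^ m) f"
    by (simp add: lessThan_Suc_atMost[symmetric] a_def)
  also have "\<dots> = D \<odot> ((S ^^ m) f + (\<Sum>i<m. g i))"
    by (simp add: scale_right_distrib scale_sum_right add.commute)
  finally have "(\<Sum>i\<le>m. a i \<odot> (S ^^ i) f) = 0" using assms(3) by simp
  moreover have "a m \<noteq> 0" using assms(1) by (simp add: a_def D_def)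
  ultimately show ?thesis by blast
qed

end

section \<open>Laurent series at infinity\<close>

lemma irrational_incommensurable:
  fixes \<alpha> :: complex
  assumes "\<alpha> \<notin> \<rat>" "of_int k * 1 + of_int l * \<alpha> = 0"
  shows "k = 0 \<and> l = 0"
proof (cases "l = 0")
  case False
  then have "\<alpha> = of_int (- k) / of_int l" using assms(2) by (simp add: field_simps eq_neg_iff_add_eq_0)
  then have "\<alpha> \<in> \<rat>" by simp
  then show ?thesis using assms(1) by blast
qed (use assms in auto)

lemma poly_at_infinity_0 [simp]: "poly_at_infinity 0 = 0"
  by (simp add: poly_at_infinity_def)

lemma poly_at_infinity_pCons:
  "poly_at_infinity (pCons a p) = fls_const a + fls_X_inv * poly_at_infinity p"
  by (cases "a = 0 \<and> p = 0") (auto simp: poly_at_infinity_def map_poly_pCons)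

lemma poly_at_infinity_const [simp]: "poly_at_infinity [:a:] = fls_const a"
  by (simp add: poly_at_infinity_pCons)

lemma poly_at_infinity_add: "poly_at_infinity (p + q) = poly_at_infinity p + poly_at_infinity q"
  by (induction p q rule: poly_induct2)
     (simp_all add: poly_at_infinity_pCons fls_plus_const[symmetric] algebra_simps)

lemma poly_at_infinity_smult: "poly_at_infinity (smult c p) = fls_const c * poly_at_infinity p"
  by (induction p) (simp_all add: poly_at_infinity_pCons algebra_simps fls_const_mult_const)

lemma poly_at_infinity_mult: "poly_at_infinity (p * q) = poly_at_infinity p * poly_at_infinity q"
  by (induction p)
     (simp_all add: poly_at_infinity_pCons poly_at_infinity_add poly_at_infinity_smult algebra_simps)

lemma poly_at_infinity_1 [simp]: "poly_at_infinity 1 = 1"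
  by (simp add: one_pCons)

lemma nth_poly_at_infinity:
  "fls_nth (poly_at_infinity p) k = (if k \<le> 0 then coeff p (nat (- k)) else 0)"
proof (induction p arbitrary: k)
  case (pCons a p)
  have "fls_nth (fls_X_inv * poly_at_infinity p) k = fls_nth (poly_at_infinity p) (k + 1)"
    by (simp add: fls_X_inv_times_conv_shift)
  moreover have "nat (- k) = Suc (nat (- (k + 1)))" if "k < 0" using that by simp
  ultimately show ?case
    by (cases "k < 0") (auto simp: poly_at_infinity_pCons pCons coeff_pCons split: nat.splits)
qed simp

lemma poly_at_infinity_eq_0_iff [simp]: "poly_at_infinity p = 0 \<longleftrightarrow> p = 0"
proof
  assume *: "poly_at_infinity p = 0"
  show "p = 0"
  proof (rule poly_eqI)
    fix n show "coeff p n = coeff 0 n"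
      using nth_poly_at_infinity[of p "- int n"] * by simp
  qed
qed simp

section \<open>The substitution of t / (1 + c t) in power series\<close>

abbreviation mobius :: "complex \<Rightarrow> complex fps" where
  "mobius c \<equiv> fps_X / (1 + fps_const c * fps_X)"

lemma mobius_altdef: "mobius c = fps_X * inverse (1 + fps_const c * fps_X)"
  by (rule fps_divide_unit) simp

lemma mobius_nz [simp]: "mobius c \<noteq> 0" and mobius_0 [simp]: "fps_nth (mobius c) 0 = 0"
  unfolding mobius_altdef by (auto simp: fps_inverse_eq_0_iff)

lemma mobius_compose: "fps_compose (mobius c) (mobius d) = mobius (c + d)"
proof -
  let ?U = "\<lambda>c. 1 + fps_const c * fps_X :: complex fps"
  have U: "?U c * inverse (?U c) = 1" for c by (intro inverse_mult_eq_1') simp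
  have "fps_compose (mobius c) (mobius d) =
      mobius d * inverse (fps_compose (?U c) (mobius d))"
    unfolding mobius_altdef[of c]
    by (simp add: fps_compose_mult_distrib fps_inverse_compose)
  also have "fps_compose (?U c) (mobius d) = 1 + fps_const c * mobius d"
    by (simp add: fps_compose_add_distrib fps_compose_mult_distrib)
  also have "\<dots> = (?U d + fps_const c * fps_X) * inverse (?U d)"
    by (subst distrib_right) (simp only: mobius_altdef U mult.assoc)
  also have "?U d + fps_const c * fps_X = ?U (c + d)" by (simp add: algebra_simps flip: fps_const_add)
  also have "inverse (?U (c + d) * inverse (?U d)) = inverse (?U (c + d)) * ?U d"
    by (simp add: fps_inverse_mult fps_inverse_idempotent)
  also have "mobius d * (inverse (?U (c + d)) * ?U d) =
      fps_X * inverse (?U (c + d)) * (?U d * inverse (?U d))"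
    unfolding mobius_altdef by (simp only: mult_ac)
  finally show ?thesis unfolding U by (simp add: mobius_altdef)
qed

lemma fls_shift_at_infinity_add:
  "fls_shift_at_infinity c (F + G) = fls_shift_at_infinity c F + fls_shift_at_infinity c G"
  unfolding fls_shift_at_infinity_def by (rule fls_compose_fps_add) auto

lemma fls_shift_at_infinity_mult:
  "fls_shift_at_infinity c (F * G) = fls_shift_at_infinity c F * fls_shift_at_infinity c G"
  unfolding fls_shift_at_infinity_def by (rule fls_compose_fps_mult) auto

lemma fls_shift_at_infinity_eq_0: "fls_shift_at_infinity c F = 0 \<Longrightarrow> F = 0"
  unfolding fls_shift_at_infinity_def by (subst (asm) fls_compose_fps_eq_0_iff) auto

lemma fls_shift_at_infinity_shift:
  "fls_shift_at_infinity c (fls_shift_at_infinity d F) = fls_shift_at_infinity (c + d) F"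
  unfolding fls_shift_at_infinity_def
  by (subst fls_compose_fps_assoc) (auto simp: mobius_compose add.commute)

lemma fls_shift_poly_at_infinity:
  "fls_shift_at_infinity c (poly_at_infinity p) = poly_at_infinity (pshift c p)"
proof (induction p)
  case 0
  then show ?case by (simp add: fls_shift_at_infinity_def)
next
  case (pCons a p)
  have "fls_shift_at_infinity c (fls_const a) = fls_const a"
    by (simp add: fls_shift_at_infinity_def)
  moreover have "poly_at_infinity [:c, 1:] = fls_X_inv + fls_const c"
    by (simp add: poly_at_infinity_pCons)
  ultimately show ?case
    by (simp add: poly_at_infinity_pCons fls_shift_at_infinity_add fls_shift_at_infinity_mult
        fls_shift_at_infinity_X_inv pCons pcompose_pCons poly_at_infinity_add poly_at_infinity_mult
        del: mult_pCons_left)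
qed

lemma two_shifts_at_infinity:
  assumes "\<alpha> \<notin> \<rat>"
  shows "two_shifts (\<lambda>p F. poly_at_infinity p * F)
     (fls_shift_at_infinity 1) (fls_shift_at_infinity \<alpha>) 1 \<alpha>"
proof unfold_locales
  show "k = 0 \<and> l = 0" if "of_int k * 1 + of_int l * \<alpha> = 0" for k l
    using irrational_incommensurable[OF assms that] .
qed (auto simp: poly_at_infinity_add poly_at_infinity_mult fls_shift_at_infinity_add
       fls_shift_at_infinity_mult fls_shift_poly_at_infinity fls_shift_at_infinity_shift algebra_simps
     dest: fls_shift_at_infinity_eq_0)

lemma fls_solves_difference_eq_polys:
  assumes "op_module (\<lambda>p F. poly_at_infinity p * F) (fls_shift_at_infinity c) c"
    and "fls_solves_difference_eq c m b F"
  shows "\<exists>a. a m \<noteq> 0 \<and> (\<Sum>i\<le>m. poly_at_infinity (a i) * (fls_shift_at_infinity c ^^ i) F) = 0"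
proof (rule op_module.clear_denominators[OF assms(1)])
  show "poly_at_infinity (snd (quot_of_fract (b i))) *
      (ratfun_at_infinity (b i) * (fls_shift_at_infinity c ^^ i) F) =
      poly_at_infinity (fst (quot_of_fract (b i))) * (fls_shift_at_infinity c ^^ i) F" for i
    by (simp add: ratfun_at_infinity_def)
qed (use assms(2) in \<open>auto simp: fls_solves_difference_eq_def\<close>)

text \<open>With t = 1/x and G = 1 this is (x + c)^(-n) = x^(-n) - n c x^(-n-1) + ...; the second
  coefficient is the one that rules out a remainder in
  \<open>poly_at_infinity_if_eigen\<close>.\<close>

lemma mobius_power_nth:
  "fps_nth (mobius c ^ n * G) n = fps_nth G 0"
  "fps_nth (mobius c ^ n * G) (Suc n) = fps_nth G 1 - of_nat n * c * fps_nth G 0"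
proof -
  define V where "V = inverse (1 + fps_const c * fps_X)"
  have V0: "fps_nth V 0 = 1" by (simp add: V_def)
  have "V * (1 + fps_const c * fps_X) = 1"
    unfolding V_def by (intro inverse_mult_eq_1) simp
  then have "fps_nth (V * (1 + fps_const c * fps_X)) 1 = 0" by simp
  then have V1: "fps_nth V 1 = - c"
    by (simp add: fps_mult_nth_1 V0 eq_neg_iff_add_eq_0 add.commute)
  have Vn: "fps_nth (V ^ n) 0 = 1 \<and> fps_nth (V ^ n) 1 = - (of_nat n * c)"
    by (induction n) (auto simp: fps_mult_nth_1 V0 V1[simplified] algebra_simps)
  have eq: "mobius c ^ n * G = fps_X ^ n * (V ^ n * G)"
    unfolding mobius_altdef V_def[symmetric] power_mult_distrib by (simp only: mult_ac)
  show "fps_nth (mobius c ^ n * G) n = fps_nth G 0"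
    using Vn by (simp add: eq fps_X_power_mult_nth)
  show "fps_nth (mobius c ^ n * G) (Suc n) = fps_nth G 1 - of_nat n * c * fps_nth G 0"
    using Vn by (simp add: eq fps_X_power_mult_nth fps_mult_nth_1)
qed

text \<open>Let the part of F in positive powers of t begin with g t^n, n > 0. The coefficient at
  t^n forces \<mu> = 1, and then the one at t^(n+1) forces n c g = 0, a contradiction.\<close>

lemma poly_at_infinity_if_eigen:
  assumes "c \<noteq> 0" "fls_shift_at_infinity c F - fls_const \<mu> * F \<in> range poly_at_infinity"
  shows "F \<in> range poly_at_infinity"
proof -
  define P where "P = Abs_poly (\<lambda>n. fls_nth F (- int n))"
  have "\<forall>\<^sub>\<infinity>n. fls_nth F (- int n) = 0"
    by (rule MOST_nat[THEN iffD2], rule exI[of _ "nat (- fls_subdegree F)"])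
       (auto intro!: fls_eq0_below_subdegree)
  then have coeff_P: "coeff P n = fls_nth F (- int n)" for n
    unfolding P_def by (simp add: Abs_poly_inverse)
  define W where "W = F - poly_at_infinity P"
  define G where "G = fls_regpart W"
  have nth: "fls_nth W k = (if k \<le> 0 then 0 else fls_nth F k)" for k
    by (auto simp: W_def nth_poly_at_infinity coeff_P)
  have G0: "fps_nth G 0 = 0" by (simp add: G_def nth)
  have "W = fps_to_fls G"
    by (rule fls_eqI) (auto simp: G_def nth)
  then have F: "F = poly_at_infinity P + fps_to_fls G" by (simp add: W_def algebra_simps)
  have "G = 0"
  proof (rule ccontr)
    assume "G \<noteq> 0"
    define n where "n = subdegree G"
    define G' where "G' = fps_shift n G"
    have n: "n > 0" unfolding n_def using G0 \<open>G \<noteq> 0\<close> by (metis gr0I nth_subdegree_nonzero)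
    have GG: "G = fps_X ^ n * G'" unfolding G'_def n_def
      by (subst mult.commute) (rule subdegree_decompose)
    have G'0: "fps_nth G' 0 \<noteq> 0" using \<open>G \<noteq> 0\<close> by (simp add: G'_def n_def)
    have comp: "fps_compose G (mobius c) = mobius c ^ n * fps_compose G' (mobius c)"
      by (simp add: GG fps_compose_mult_distrib fps_compose_power[symmetric])
    obtain p where p: "fls_shift_at_infinity c F - fls_const \<mu> * F = poly_at_infinity p"
      using assms(2) by auto
    define q where "q = p - pshift c P + smult \<mu> P"
    have split: "poly_at_infinity p = poly_at_infinity (pshift c P) + poly_at_infinity (p - pshift c P)"
      using poly_at_infinity_add[of "pshift c P" "p - pshift c P"] by simp
    moreover have "fls_shift_at_infinity c (fps_to_fls G) = fps_to_fls (fps_compose G (mobius c))"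
      unfolding fls_shift_at_infinity_def by (rule fls_compose_fps_to_fls) auto
    ultimately have "fps_to_fls (fps_compose G (mobius c)) - fls_const \<mu> * fps_to_fls G = poly_at_infinity q"
      unfolding q_def poly_at_infinity_add poly_at_infinity_smult
      using p unfolding F fls_shift_at_infinity_add fls_shift_poly_at_infinity
      by (simp add: algebra_simps split)
    then have *: "fps_to_fls (fps_compose G (mobius c) - fps_const \<mu> * G) = poly_at_infinity q"
      by (simp add: fls_times_fps_to_fls)
    have zero: "fps_nth (fps_compose G (mobius c) - fps_const \<mu> * G) k = 0" if "k > 0" for k
      using arg_cong[OF *, of "\<lambda>F. fls_nth F (int k)"] that
      by (simp add: nth_poly_at_infinity del: fps_to_fls_minus)
    have "fps_nth (fps_compose G' (mobius c)) 0 = fps_nth G' 0" by simp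
    moreover have "fps_nth (mobius c) (Suc 0) = 1"
      using mobius_power_nth(1)[of c 1 1] by simp
    then have "fps_nth (fps_compose G' (mobius c)) 1 = fps_nth G' 1"
      by (simp add: fps_compose_nth)
    ultimately have nths: "fps_nth (fps_compose G (mobius c)) n = fps_nth G' 0"
       "fps_nth (fps_compose G (mobius c)) (Suc n) = fps_nth G' 1 - of_nat n * c * fps_nth G' 0"
      unfolding comp mobius_power_nth by simp_all
    have "fps_nth G' 0 = \<mu> * fps_nth G' 0"
      using zero[OF n] nths(1) by (simp add: G'_def)
    then have "\<mu> = 1" using G'0 by simp
    moreover have "fps_nth G' 1 - of_nat n * c * fps_nth G' 0 = \<mu> * fps_nth G' 1"
      using zero[of "Suc n"] nths(2) by (simp add: G'_def)
    ultimately show False using n assms(1) G'0 by simp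
  qed
  then show ?thesis using F by simp
qed

lemma ratfun_at_infinity_Fract:
  assumes "q \<noteq> 0"
  shows "ratfun_at_infinity (Fract p q) = poly_at_infinity p / poly_at_infinity q"
proof -
  let ?r = "Fract p q"
  have "Fract (fst (quot_of_fract ?r)) (snd (quot_of_fract ?r)) = Fract p q" by simp
  then have "fst (quot_of_fract ?r) * q = p * snd (quot_of_fract ?r)"
    using assms by (subst (asm) eq_fract) auto
  then have "poly_at_infinity (fst (quot_of_fract ?r)) * poly_at_infinity q =
      poly_at_infinity p * poly_at_infinity (snd (quot_of_fract ?r))"
    by (simp flip: poly_at_infinity_mult)
  then show ?thesis using assms by (simp add: ratfun_at_infinity_def field_simps)
qed

theorem fls_solution_rational:
  assumes "\<alpha> \<notin> \<rat>" "fls_solves_system \<alpha> F"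
  shows "F \<in> range ratfun_at_infinity"
proof -
  interpret two_shifts "\<lambda>p F. poly_at_infinity p * F"
     "fls_shift_at_infinity 1" "fls_shift_at_infinity \<alpha>" 1 \<alpha>
    by (rule two_shifts_at_infinity[OF assms(1)])
  obtain m1 b1 m2 b2 where "m1 > 0" "fls_solves_difference_eq 1 m1 b1 F"
     "m2 > 0" "fls_solves_difference_eq \<alpha> m2 b2 F"
    using assms(2) unfolding fls_solves_system_def by blast
  moreover from this obtain a1 a2 where
    "a1 m1 \<noteq> 0" "(\<Sum>i\<le>m1. poly_at_infinity (a1 i) * (fls_shift_at_infinity 1 ^^ i) F) = 0"
    "a2 m2 \<noteq> 0" "(\<Sum>i\<le>m2. poly_at_infinity (a2 i) * (fls_shift_at_infinity \<alpha> ^^ i) F) = 0"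
    using fls_solves_difference_eq_polys[OF op_module_axioms, of m1 b1 F]
      fls_solves_difference_eq_polys[OF T.op_module_axioms, of m2 b2 F] by blast
  ultimately obtain q where q: "q \<noteq> 0" "const_finite (poly_at_infinity q * F)"
    using two_shift_const_finite[of a1 m1 F a2 m2] by blast
  obtain p where p: "p \<noteq> 0" "act p (poly_at_infinity q * F) = 0"
    using q(2) unfolding const_finite_def by blast
  have "poly_at_infinity q * F \<in> range poly_at_infinity"
  proof (rule act_eigen_induct[OF p, where Q = "\<lambda>_. True"])
    show "v \<in> range poly_at_infinity" if "act ([:- \<mu>, 1:] ^ n) v = 0" for \<mu> n v
      using that
    proof (induction n arbitrary: v)
      case 0
      then show ?case by (intro range_eqI[of _ _ 0]) simp
    next
      case (Suc n)
      have "act ([:- \<mu>, 1:] ^ n) (act [:- \<mu>, 1:] v) = 0"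
        using Suc.prems unfolding power_Suc2 act_mult .
      then have "act [:- \<mu>, 1:] v \<in> range poly_at_infinity" by (rule Suc.IH)
      moreover have "act [:- \<mu>, 1:] v = fls_shift_at_infinity 1 v - fls_const \<mu> * v"
      proof -
        have "fls_const (- \<mu>) = - fls_const \<mu>" by (rule fls_eqI) simp
        then show ?thesis by simp
      qed
      ultimately have "fls_shift_at_infinity 1 v - fls_const \<mu> * v \<in> range poly_at_infinity"
        by simp
      then show ?case by (rule poly_at_infinity_if_eigen[rotated]) simp
    qed
    show "v + w \<in> range poly_at_infinity"
      if "v \<in> range poly_at_infinity" "w \<in> range poly_at_infinity" for v w
      using that by (auto simp flip: poly_at_infinity_add)
    show "0 \<in> range poly_at_infinity" by (intro range_eqI[of _ _ 0]) simp
  qed simp_all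
  then obtain h where "poly_at_infinity q * F = poly_at_infinity h" by auto
  then have "F = ratfun_at_infinity (Fract h q)"
    using q(1) by (simp add: ratfun_at_infinity_Fract field_simps)
  then show ?thesis by simp
qed

section \<open>Functions modulo sparse sets\<close>

lemma cosparse_translate:
  assumes "\<forall>\<^sub>\<approx>x\<in>UNIV. P x"
  shows "\<forall>\<^sub>\<approx>x\<in>UNIV. P (x + c :: complex)"
proof -
  have "{x. \<not> P (x + c)} = (+) (- c) ` {x. \<not> P x}"
    by (auto intro: image_eqI[of _ _ "_ + c"])
  then show ?thesis using assms sparse_in_translate_UNIV[of "{x. \<not> P x}" "- c"]
    by (simp add: eventually_cosparse)
qed

lemma finite_imp_cosparse: "finite X \<Longrightarrow> \<forall>\<^sub>\<approx>x\<in>UNIV. x \<notin> (X :: complex set)"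
  by (simp add: eventually_cosparse finite_imp_sparse)

lemma poly_nonzero_cosparse: "p \<noteq> 0 \<Longrightarrow> \<forall>\<^sub>\<approx>x\<in>UNIV. poly p (x::complex) \<noteq> 0"
  using finite_imp_cosparse[OF poly_roots_finite[of p]] by simp

quotient_type mfun = "complex \<Rightarrow> complex" / "\<lambda>f g. \<forall>\<^sub>\<approx>x\<in>UNIV. f x = g x"
  morphisms rep_mfun mfun
proof (intro equivpI reflpI sympI transpI)
  fix f g h :: "complex \<Rightarrow> complex"
  assume "\<forall>\<^sub>\<approx>x\<in>UNIV. f x = g x" "\<forall>\<^sub>\<approx>x\<in>UNIV. g x = h x"
  then show "\<forall>\<^sub>\<approx>x\<in>UNIV. f x = h x" by eventually_elim simp
qed (auto elim: eventually_mono)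

lemma mfun_eq_iff: "mfun f = mfun g \<longleftrightarrow> (\<forall>\<^sub>\<approx>x\<in>UNIV. f x = g x)"
  by (rule mfun.abs_eq_iff)

lemma mfun_eqI: "(\<And>x. f x = g x) \<Longrightarrow> mfun f = mfun g"
  by (simp add: mfun_eq_iff)

instantiation mfun :: comm_ring_1
begin

lift_definition zero_mfun :: mfun is "\<lambda>_. 0" .
lift_definition one_mfun :: mfun is "\<lambda>_. 1" .
lift_definition plus_mfun :: "mfun \<Rightarrow> mfun \<Rightarrow> mfun" is "\<lambda>f g x. f x + g x"
  by (erule (1) eventually_elim2) simp
lift_definition minus_mfun :: "mfun \<Rightarrow> mfun \<Rightarrow> mfun" is "\<lambda>f g x. f x - g x"
  by (erule (1) eventually_elim2) simp
lift_definition times_mfun :: "mfun \<Rightarrow> mfun \<Rightarrow> mfun" is "\<lambda>f g x. f x * g x"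
  by (erule (1) eventually_elim2) simp
lift_definition uminus_mfun :: "mfun \<Rightarrow> mfun" is "\<lambda>f x. - f x"
  by (erule eventually_mono) simp

instance
proof
  show "(0 :: mfun) \<noteq> 1" by transfer simp
qed (transfer, simp add: algebra_simps)+

end

lift_definition mshift :: "complex \<Rightarrow> mfun \<Rightarrow> mfun" is "\<lambda>c f x. f (x + c)"
  by (rule cosparse_translate)

lemma mfun_add: "mfun f + mfun g = mfun (\<lambda>x. f x + g x)" by (rule plus_mfun.abs_eq)
lemma mfun_diff: "mfun f - mfun g = mfun (\<lambda>x. f x - g x)" by (rule minus_mfun.abs_eq)
lemma mfun_uminus: "- mfun f = mfun (\<lambda>x. - f x)" by (rule uminus_mfun.abs_eq)
lemma mfun_mult: "mfun f * mfun g = mfun (\<lambda>x. f x * g x)" by (rule times_mfun.abs_eq)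
lemma mfun_0: "0 = mfun (\<lambda>_. 0)" by (rule zero_mfun.abs_eq)
lemma mfun_1: "1 = mfun (\<lambda>_. 1)" by (rule one_mfun.abs_eq)
lemma mshift_mfun: "mshift c (mfun f) = mfun (\<lambda>x. f (x + c))" by (rule mshift.abs_eq)

lemma mfun_eq_0_iff: "mfun f = 0 \<longleftrightarrow> (\<forall>\<^sub>\<approx>x\<in>UNIV. f x = 0)"
  unfolding mfun_0 mfun_eq_iff ..

lemma mfun_sum: "(\<Sum>i\<in>I. mfun (f i)) = mfun (\<lambda>x. \<Sum>i\<in>I. f i x)"
  by (induction I rule: infinite_finite_induct) (simp_all add: mfun_0 mfun_add)

lemma mfun_power: "mfun f ^ n = mfun (\<lambda>x. f x ^ n)"
  by (induction n) (simp_all add: mfun_1 mfun_mult)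

lemma mfun_cases: obtains f where "e = mfun f"
  using mfun.abs_induct[of "\<lambda>e. \<exists>f. e = mfun f"] by blast

lemma mshift_add: "mshift c (e + e') = mshift c e + mshift c e'" by transfer simp
lemma mshift_diff: "mshift c (e - e') = mshift c e - mshift c e'" by transfer simp
lemma mshift_mult: "mshift c (e * e') = mshift c e * mshift c e'" by transfer simp
lemma mshift_0 [simp]: "mshift c 0 = 0" by transfer simp
lemma mshift_1 [simp]: "mshift c 1 = 1" by transfer simp
lemma mshift_power: "mshift c (e ^ n) = mshift c e ^ n"
  by (induction n) (simp_all add: mshift_mult)
lemma mshift_mshift: "mshift c (mshift d e) = mshift (c + d) e"
  by transfer (simp add: add_ac)
lemma mshift_0_left [simp]: "mshift 0 e = e" by transfer simp
lemma mshift_eq_0_iff: "mshift c e = 0 \<Longrightarrow> e = 0"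
  using mshift_mshift[of "- c" c e] by simp

lemma funpow_mshift: "(mshift c ^^ n) (mfun f) = mfun ((shift c ^^ n) f)"
  by (induction n) (simp_all add: mshift_mfun shift_def)

abbreviation mpoly :: "complex poly \<Rightarrow> mfun" where
  "mpoly p \<equiv> mfun (poly p)"

abbreviation mscale :: "complex poly \<Rightarrow> mfun \<Rightarrow> mfun" where
  "mscale p e \<equiv> mpoly p * e"

lemma mpoly_add: "mpoly (p + q) = mpoly p + mpoly q" unfolding mfun_add by (rule mfun_eqI) simp
lemma mpoly_mult: "mpoly (p * q) = mpoly p * mpoly q" unfolding mfun_mult by (rule mfun_eqI) simp
lemma mpoly_1 [simp]: "mpoly 1 = 1" unfolding mfun_1 by (rule mfun_eqI) simp
lemma mpoly_0 [simp]: "mpoly 0 = 0" unfolding mfun_0 by (rule mfun_eqI) simp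

lemma mshift_mpoly: "mshift c (mpoly p) = mpoly (pshift c p)"
  unfolding mshift_mfun by (rule mfun_eqI) (simp add: poly_pcompose add.commute)

lemma mscale_torsion_free:
  assumes "mscale p e = 0"
  shows "p = 0 \<or> e = 0"
proof (cases "p = 0")
  case False
  obtain f where e: "e = mfun f" by (rule mfun_cases)
  have "\<forall>\<^sub>\<approx>x\<in>UNIV. poly p x * f x = 0" using assms by (simp add: e mfun_mult mfun_eq_0_iff)
  with poly_nonzero_cosparse[OF False] have "\<forall>\<^sub>\<approx>x\<in>UNIV. f x = 0"
    by eventually_elim simp
  then show ?thesis by (simp add: e mfun_eq_0_iff)
qed simp

lemma two_shifts_mfun:
  assumes "\<alpha> \<notin> \<rat>"
  shows "two_shifts mscale (mshift 1) (mshift \<alpha>) 1 \<alpha>"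
proof unfold_locales
  show "k = 0 \<and> l = 0" if "of_int k * 1 + of_int l * \<alpha> = 0" for k l
    using irrational_incommensurable[OF assms that] .
  show "p = 0 \<or> e = 0" if "mscale p e = 0" for p e
    using mscale_torsion_free[OF that] .
qed (auto simp: mpoly_add mpoly_mult mshift_add mshift_mult mshift_mpoly mshift_mshift algebra_simps
     dest: mshift_eq_0_iff)

lemma op_module_mfun: "op_module mscale (mshift c) c"
proof unfold_locales
  show "p = 0 \<or> e = 0" if "mscale p e = 0" for p e
    using mscale_torsion_free[OF that] .
qed (auto simp: mpoly_add mpoly_mult mshift_add mshift_mult mshift_mpoly mshift_mshift algebra_simps
     dest: mshift_eq_0_iff)

definition mratfun :: "ratfun \<Rightarrow> mfun" where
  "mratfun r = mfun (ratfun_eval r)"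

lemma mratfun_quot: "mpoly (snd (quot_of_fract r)) * mratfun r = mpoly (fst (quot_of_fract r))"
proof -
  have "\<forall>\<^sub>\<approx>x\<in>UNIV. poly (snd (quot_of_fract r)) x \<noteq> 0"
    by (rule poly_nonzero_cosparse) simp
  then have "\<forall>\<^sub>\<approx>x\<in>UNIV. poly (snd (quot_of_fract r)) x * ratfun_eval r x = poly (fst (quot_of_fract r)) x"
    by eventually_elim (simp add: ratfun_eval_def)
  then show ?thesis by (simp add: mratfun_def mfun_mult mfun_eq_iff)
qed

lemma mscale_cancel: "p \<noteq> 0 \<Longrightarrow> mscale p e = mscale p e' \<Longrightarrow> e = e'"
  using mscale_torsion_free[of p "e - e'"] by (simp add: algebra_simps)

lemma mratfun_Fract:
  assumes "q \<noteq> 0"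
  shows "mpoly q * mratfun (Fract p q) = mpoly p"
proof -
  let ?r = "Fract p q"
  have "Fract (fst (quot_of_fract ?r)) (snd (quot_of_fract ?r)) = Fract p q" by simp
  then have eq: "fst (quot_of_fract ?r) * q = p * snd (quot_of_fract ?r)"
    using assms by (subst (asm) eq_fract) auto
  have "mscale (snd (quot_of_fract ?r)) (mpoly q * mratfun ?r) =
     mpoly q * (mpoly (snd (quot_of_fract ?r)) * mratfun ?r)" by (simp only: mult_ac)
  also have "\<dots> = mscale (snd (quot_of_fract ?r)) (mpoly p)"
    unfolding mratfun_quot mpoly_mult[symmetric] using eq by (simp add: mult_ac)
  finally show ?thesis by (rule mscale_cancel[rotated]) simp
qed

lemma mratfun_0 [simp]: "mratfun 0 = 0"
  unfolding mratfun_def mfun_0 by (rule mfun_eqI) (simp add: ratfun_eval_def)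

lemma solves_difference_eq_mfun:
  "solves_difference_eq c m b f \<longleftrightarrow>
     (mshift c ^^ m) (mfun f) + (\<Sum>i<m. mratfun (b i) * (mshift c ^^ i) (mfun f)) = 0"
  unfolding solves_difference_eq_def
  by (simp add: funpow_mshift mratfun_def mfun_mult mfun_sum mfun_add mfun_eq_0_iff)

lemma solves_difference_eq_imp_polys:
  assumes "solves_difference_eq c m b f"
  shows "\<exists>a. a m \<noteq> 0 \<and> (\<Sum>i\<le>m. mscale (a i) ((mshift c ^^ i) (mfun f))) = 0"
proof (rule op_module.clear_denominators[OF op_module_mfun])
  show "mscale (snd (quot_of_fract (b i))) (mratfun (b i) * (mshift c ^^ i) (mfun f)) =
      mscale (fst (quot_of_fract (b i))) ((mshift c ^^ i) (mfun f))" for i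
    by (simp flip: mult.assoc add: mratfun_quot)
qed (use assms in \<open>auto simp: solves_difference_eq_mfun\<close>)

lemma polys_imp_solves_difference_eq:
  assumes "a m \<noteq> 0" "(\<Sum>i\<le>m. mscale (a i) ((mshift c ^^ i) (mfun f))) = 0"
  shows "solves_difference_eq c m (\<lambda>i. Fract (a i) (a m)) f"
proof -
  let ?e = "\<lambda>i. (mshift c ^^ i) (mfun f)"
  have "mscale (a m) (?e m + (\<Sum>i<m. mratfun (Fract (a i) (a m)) * ?e i)) =
      mscale (a m) (?e m) + (\<Sum>i<m. mscale (a i) (?e i))"
    unfolding distrib_left sum_distrib_left
    using assms(1) by (simp flip: mult.assoc add: mratfun_Fract)
  also have "\<dots> = (\<Sum>i\<le>m. mscale (a i) (?e i))"
    by (simp add: lessThan_Suc_atMost[symmetric])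
  finally show ?thesis
    using assms mscale_torsion_free unfolding solves_difference_eq_mfun by metis
qed

lemma polys_imp_ex_solves_difference_eq:
  assumes "\<exists>i\<le>m. a i \<noteq> 0" "(\<Sum>i\<le>m. mscale (a i) ((mshift c ^^ i) (mfun f))) = 0"
  shows "\<exists>m>0. \<exists>b. solves_difference_eq c m b f"
proof -
  let ?e = "\<lambda>i. (mshift c ^^ i) (mfun f)"
  obtain n where n: "n \<le> m" "a n \<noteq> 0" and gt: "\<And>k. n < k \<Longrightarrow> k \<le> m \<Longrightarrow> a k = 0"
    using assms(1) ex_last_nonzero[of m a] by blast
  have *: "(\<Sum>k\<le>n. mscale (a k) (?e k)) = 0"
    unfolding assms(2)[symmetric] using n gt by (intro sum.mono_neutral_left) auto
  show ?thesis
  proof (cases "n = 0")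
    case True
    then have "mfun f = 0" using * n(2) mscale_torsion_free by fastforce
    \<comment> \<open>The order has to be positive; for f = 0 the equation of order 1 with zero
      coefficients will do.\<close>
    then have "solves_difference_eq c 1 (\<lambda>_. 0) f"
      by (simp add: solves_difference_eq_mfun)
    then show ?thesis by (intro exI[of _ 1]) auto
  next
    case False
    then show ?thesis using polys_imp_solves_difference_eq[of a n, OF n(2) *] by blast
  qed
qed

section \<open>Meromorphic classes\<close>

definition mero :: "mfun \<Rightarrow> bool" where
  "mero e \<longleftrightarrow> (\<exists>f. f meromorphic_on UNIV \<and> e = mfun f)"

lemma meroI: "f meromorphic_on UNIV \<Longrightarrow> mero (mfun f)"
  unfolding mero_def by blast

lemma mero_add: "mero e \<Longrightarrow> mero e' \<Longrightarrow> mero (e + e')"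
  unfolding mero_def[of e] mero_def[of e'] by (auto simp: mfun_add intro!: meroI meromorphic_intros)

lemma mero_diff: "mero e \<Longrightarrow> mero e' \<Longrightarrow> mero (e - e')"
  unfolding mero_def[of e] mero_def[of e'] by (auto simp: mfun_diff intro!: meroI meromorphic_intros)

lemma mero_mult: "mero e \<Longrightarrow> mero e' \<Longrightarrow> mero (e * e')"
  unfolding mero_def[of e] mero_def[of e'] by (auto simp: mfun_mult intro!: meroI meromorphic_intros)

lemma meromorphic_on_translate:
  "f meromorphic_on UNIV \<Longrightarrow> (\<lambda>x. f (x + c)) meromorphic_on UNIV"
  by (rule meromorphic_on_compose[of f UNIV]) (auto intro!: analytic_intros)

lemma mero_mshift: "mero e \<Longrightarrow> mero (mshift c e)"
  unfolding mero_def[of e] by (auto simp: mshift_mfun intro!: meroI meromorphic_on_translate)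

lemma poly_holomorphic: "poly (p :: complex poly) holomorphic_on UNIV"
  unfolding holomorphic_on_def field_differentiable_def
  using poly_DERIV has_field_derivative_at_within by blast

lemma entire_imp_meromorphic: "f holomorphic_on UNIV \<Longrightarrow> f meromorphic_on UNIV"
  by (intro analytic_on_imp_meromorphic_on) (simp add: analytic_on_open)

lemma mero_mpoly: "mero (mpoly p)"
  by (intro meroI entire_imp_meromorphic poly_holomorphic)

lemma mero_act:
  assumes "mero e"
  shows "mero (op_module.act mscale (mshift c) p e)"
proof -
  interpret op_module mscale "mshift c" c by (rule op_module_mfun)
  show ?thesis
    by (induction p) (simp_all add: assms mero_add mero_mult mero_mpoly mero_mshift
        mero_mpoly[of 0, simplified])
qed

theorem solves_system_const_finite:
  assumes "\<alpha> \<notin> \<rat>" "solves_system \<alpha> f"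
  shows "\<exists>q p1 p2. q \<noteq> 0 \<and> p1 \<noteq> 0 \<and> p2 \<noteq> 0 \<and>
     op_module.act mscale (mshift 1) p1 (mscale q (mfun f)) = 0 \<and>
     op_module.act mscale (mshift \<alpha>) p2 (mscale q (mfun f)) = 0"
proof -
  interpret two_shifts mscale "mshift 1" "mshift \<alpha>" 1 \<alpha>
    by (rule two_shifts_mfun[OF assms(1)])
  obtain m1 b1 m2 b2 where "m1 > 0" "solves_difference_eq 1 m1 b1 f"
     "m2 > 0" "solves_difference_eq \<alpha> m2 b2 f"
    using assms(2) unfolding solves_system_def by blast
  moreover from this obtain a1 a2 where
    "a1 m1 \<noteq> 0" "(\<Sum>i\<le>m1. mscale (a1 i) ((mshift 1 ^^ i) (mfun f))) = 0"
    "a2 m2 \<noteq> 0" "(\<Sum>i\<le>m2. mscale (a2 i) ((mshift \<alpha> ^^ i) (mfun f))) = 0"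
    using solves_difference_eq_imp_polys by blast
  ultimately obtain q where "q \<noteq> 0" "const_finite (mscale q (mfun f))"
      "T.const_finite (mscale q (mfun f))"
    using two_shift_const_finite[of a1 m1 "mfun f" a2 m2] by blast
  then show ?thesis unfolding const_finite_def T.const_finite_def by blast
qed

section \<open>Difference operators and entire functions\<close>

abbreviation mact :: "complex \<Rightarrow> complex poly \<Rightarrow> mfun \<Rightarrow> mfun" where
  "mact c \<equiv> op_module.act mscale (mshift c)"

lemma mact_mact: "mact c p (mact d q v) = mact d q (mact c p v)"
proof -
  interpret c: op_module mscale "mshift c" c by (rule op_module_mfun)
  interpret d: op_module mscale "mshift d" d by (rule op_module_mfun)
  have comm: "mshift c (mshift d u) = mshift d (mshift c u)" for u
    by (simp add: mshift_mshift add.commute)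
  have *: "mshift c (d.act q v) = d.act q (mshift c v)" for q v
    by (induction q) (simp_all add: c.S_add c.S_scale comm)
  show ?thesis
    by (induction p) (simp_all add: d.act_add_right d.act_const * )
qed

text \<open>Operators of the two shifts commute, so the equation for the second shift survives the
  splitting for the first.\<close>

lemma joint_eigen_induct:
  assumes "p1 \<noteq> 0" "p2 \<noteq> 0" "mact c p1 h = 0" "mact d p2 h = 0" "A h"
    and A: "\<And>c p v. A v \<Longrightarrow> A (mact c p v)"
    and G0: "G 0" and Gadd: "\<And>v w. G v \<Longrightarrow> G w \<Longrightarrow> G (v + w)"
    and eigen: "\<And>a b m n v. A v \<Longrightarrow> mact c ([:- a, 1:] ^ m) v = 0 \<Longrightarrow>
          mact d ([:- b, 1:] ^ n) v = 0 \<Longrightarrow> G v"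
  shows "G h"
proof (rule op_module.act_eigen_induct[OF op_module_mfun[of c] assms(1,3),
         where Q = "\<lambda>v. A v \<and> mact d p2 v = 0"])
  interpret c: op_module mscale "mshift c" c by (rule op_module_mfun)
  show "A (mact c q v) \<and> mact d p2 (mact c q v) = 0" if "A v \<and> mact d p2 v = 0" for q v
    using that A by (simp add: mact_mact[of d p2])
  show "G v" if v: "A v \<and> mact d p2 v = 0" "mact c ([:- a, 1:] ^ m) v = 0" for a m v
  proof (rule op_module.act_eigen_induct[OF op_module_mfun[of d] assms(2),
         where Q = "\<lambda>v. A v \<and> mact c ([:- a, 1:] ^ m) v = 0"])
    show "A (mact d q v) \<and> mact c ([:- a, 1:] ^ m) (mact d q v) = 0"
      if "A v \<and> mact c ([:- a, 1:] ^ m) v = 0" for q v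
    proof -
      interpret d: op_module mscale "mshift d" d by (rule op_module_mfun)
      show ?thesis using that A by (simp add: mact_mact[of c _ d])
    qed
  qed (use v eigen G0 Gadd in auto)
qed (use assms in auto)

abbreviation mconst :: "complex \<Rightarrow> mfun" where
  "mconst k \<equiv> mpoly [:k:]"

lemma mconst_eq: "mconst k = mfun (\<lambda>_. k)"
  by (rule mfun_eqI) simp

lemma mconst_1 [simp]: "mconst 1 = 1"
  unfolding mconst_eq mfun_1 ..

lemma mshift_mconst [simp]: "mshift c (mconst k) = mconst k"
  by (simp add: mshift_mpoly)

section \<open>Difference operators\<close>

definition mdelta :: "complex \<Rightarrow> mfun \<Rightarrow> mfun" where
  "mdelta c e = mshift c e - e"

lemma mdelta_diff: "mdelta c (v - w) = mdelta c v - mdelta c w"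
  by (simp add: mdelta_def mshift_diff)

lemma funpow_mdelta_diff: "(mdelta c ^^ n) (v - w) = (mdelta c ^^ n) v - (mdelta c ^^ n) w"
  by (induction n) (simp_all add: mdelta_diff)

lemma mdelta_0 [simp]: "mdelta c 0 = 0"
  by (simp add: mdelta_def)

lemma mdelta_1 [simp]: "mdelta c 1 = 0"
  by (simp add: mdelta_def)

lemma funpow_mdelta_0 [simp]: "(mdelta c ^^ n) 0 = 0"
  by (induction n) simp_all

lemma mdelta_commute: "mdelta c (mdelta d v) = mdelta d (mdelta c v)"
  by (simp add: mdelta_def mshift_diff mshift_mshift algebra_simps)

lemma funpow_mdelta_commute: "(mdelta c ^^ m) ((mdelta d ^^ n) v) = (mdelta d ^^ n) ((mdelta c ^^ m) v)"
proof -
  have "mdelta c ((mdelta d ^^ n) v) = (mdelta d ^^ n) (mdelta c v)" for v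
    by (induction n) (simp_all add: mdelta_commute[of c d])
  then show ?thesis by (induction m) simp_all
qed

lemma funpow_mdelta_mult_invariant:
  assumes "mshift c w = w"
  shows "(mdelta c ^^ n) (v * w) = (mdelta c ^^ n) v * w"
  by (induction n) (simp_all add: mdelta_def mshift_mult assms algebra_simps)

text \<open>As s has an invariant increment a, it behaves under differences as x does under
  derivatives. It will be x itself, or \<open>coord1\<close> and \<open>coord2\<close> in the
  nonreal case.\<close>

lemma funpow_mdelta_mult:
  assumes "mshift c s = s + a" "mshift c a = a"
  shows "(mdelta c ^^ n) (s * v) =
     (s + of_nat n * a) * (mdelta c ^^ n) v + of_nat n * a * (mdelta c ^^ (n - 1)) v"
proof (induction n)
  case (Suc n)
  have of_nat: "mshift c (of_nat n) = of_nat n" by (induction n) (simp_all add: mshift_add)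
  have "(mdelta c ^^ Suc n) (s * v) = mdelta c ((s + of_nat n * a) * (mdelta c ^^ n) v +
      of_nat n * a * (mdelta c ^^ (n - 1)) v)" by (simp add: Suc)
  also have "\<dots> = (s + of_nat (Suc n) * a) * mdelta c ((mdelta c ^^ n) v) + a * (mdelta c ^^ n) v +
      of_nat n * a * mdelta c ((mdelta c ^^ (n - 1)) v)"
    by (simp add: mdelta_def mshift_add mshift_mult of_nat assms algebra_simps)
  also have "of_nat n * a * mdelta c ((mdelta c ^^ (n - 1)) v) = of_nat n * a * (mdelta c ^^ n) v"
    by (cases n) simp_all
  finally show ?case by (simp add: algebra_simps)
qed simp

lemma funpow_mdelta_power_Suc:
  assumes "mshift c s = s + a" "mshift c a = a" "k < n"
  shows "(mdelta c ^^ n) (s ^ k) = 0"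
  using assms(3)
proof (induction k arbitrary: n)
  case 0
  then show ?case by (cases n) (simp_all add: funpow_Suc_right del: funpow.simps(2))
next
  case (Suc k)
  then show ?case using funpow_mdelta_mult[OF assms(1,2), of n "s ^ k"] by simp
qed

lemma funpow_mdelta_power:
  assumes "mshift c s = s + 1"
  shows "(mdelta c ^^ k) (s ^ k) = of_nat (fact k)"
proof (induction k)
  case (Suc k)
  have "(mdelta c ^^ Suc k) (s * s ^ k) = of_nat (Suc k) * (mdelta c ^^ k) (s ^ k)"
    using funpow_mdelta_mult[OF assms, of "Suc k" "s ^ k"]
      funpow_mdelta_power_Suc[OF assms, of k "Suc k"] by simp
  then show ?case by (simp add: Suc ring_distribs)
qed simp

lemma of_nat_mfun: "of_nat n = mconst (of_nat n)"
  by (induction n) (simp_all add: mconst_eq mfun_add mfun_1 mfun_0)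

text \<open>Pulling out an eigenfunction E turns S - a into a (S - 1), so generalized eigenvectors
  become unipotent ones.\<close>

lemma mact_eigen_conjugate:
  assumes "mshift c E = mconst a * E"
  shows "mact c ([:- a, 1:] ^ n) (E * v) = mconst (a ^ n) * (E * (mdelta c ^^ n) v)"
proof (induction n arbitrary: v)
  case 0
  interpret op_module mscale "mshift c" c by (rule op_module_mfun)
  show ?case by (simp add: mconst_eq flip: mfun_1)
next
  case (Suc n)
  interpret op_module mscale "mshift c" c by (rule op_module_mfun)
  have neg: "mconst (- a) = - mconst a" by (simp add: mconst_eq mfun_uminus)
  have "act [:- a, 1:] (E * v) = mconst (- a) * (E * v) + mshift c (E * v)" by simp
  also have "\<dots> = mconst a * (E * mdelta c v)"
    unfolding neg by (simp add: mshift_mult assms mdelta_def algebra_simps)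
  finally have c1: "act [:- a, 1:] (E * v) = mconst a * (E * mdelta c v)" .
  have "act ([:- a, 1:] ^ Suc n) (E * v) = act ([:- a, 1:] ^ n) (mconst a * (E * mdelta c v))"
    unfolding power_Suc2 act_mult c1 ..
  also have "\<dots> = mconst a * (mconst (a ^ n) * (E * (mdelta c ^^ n) (mdelta c v)))"
    unfolding act_const Suc ..
  also have "\<dots> = mconst (a ^ Suc n) * (E * (mdelta c ^^ Suc n) v)"
    by (simp add: mult.assoc[symmetric] mpoly_mult[symmetric] funpow_Suc_right
        mult.commute[of a "a ^ n"] del: funpow.simps(2))
  finally show ?case .
qed

lemma unipotent_if_eigen:
  assumes "mshift c E = mconst a * E" "E * E' = 1" "a \<noteq> 0" "mact c ([:- a, 1:] ^ n) (E * u) = 0"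
  shows "(mdelta c ^^ n) u = 0"
proof -
  have "mconst (a ^ n) * (E * (mdelta c ^^ n) u) = 0"
    using mact_eigen_conjugate[OF assms(1), of n u] assms(4) by simp
  then have zero: "E * (mdelta c ^^ n) u = 0"
    using mscale_torsion_free[of "[:a ^ n:]"] assms(3) by simp
  have "(mdelta c ^^ n) u = E * E' * (mdelta c ^^ n) u" unfolding assms(2) by simp
  also have "\<dots> = E' * (E * (mdelta c ^^ n) u)" by (simp only: mult_ac)
  finally show ?thesis unfolding zero by simp
qed

section \<open>Entire classes\<close>

definition ent :: "mfun \<Rightarrow> bool" where
  "ent e \<longleftrightarrow> (\<exists>f. f holomorphic_on UNIV \<and> e = mfun f)"

lemma entI: "f holomorphic_on UNIV \<Longrightarrow> ent (mfun f)"
  unfolding ent_def by blast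

lemma ent_add: "ent e \<Longrightarrow> ent e' \<Longrightarrow> ent (e + e')"
  unfolding ent_def[of e] ent_def[of e'] by (auto simp: mfun_add intro!: entI holomorphic_intros)

lemma ent_diff: "ent e \<Longrightarrow> ent e' \<Longrightarrow> ent (e - e')"
  unfolding ent_def[of e] ent_def[of e'] by (auto simp: mfun_diff intro!: entI holomorphic_intros)

lemma ent_mult: "ent e \<Longrightarrow> ent e' \<Longrightarrow> ent (e * e')"
  unfolding ent_def[of e] ent_def[of e'] by (auto simp: mfun_mult intro!: entI holomorphic_intros)

lemma holomorphic_on_translate:
  assumes "f holomorphic_on UNIV"
  shows "(\<lambda>x. f (x + c)) holomorphic_on UNIV"
proof -
  have "(\<lambda>x. x + c) holomorphic_on UNIV" by (intro holomorphic_intros)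
  from holomorphic_on_compose_gen[OF this assms] show ?thesis by (simp add: o_def)
qed

lemma ent_mshift: "ent e \<Longrightarrow> ent (mshift c e)"
  unfolding ent_def[of e] by (auto simp: mshift_mfun intro!: entI holomorphic_on_translate)

lemma ent_mpoly: "ent (mpoly p)"
  by (rule entI[OF poly_holomorphic])

lemma ent_power: "ent e \<Longrightarrow> ent (e ^ n)"
  by (induction n) (auto intro: ent_mult simp: ent_mpoly[of 1, simplified])

lemma ent_mdelta: "ent e \<Longrightarrow> ent ((mdelta c ^^ n) e)"
  by (induction n) (auto simp: mdelta_def intro: ent_diff ent_mshift)

lemma ent_mact:
  assumes "ent e"
  shows "ent (mact c p e)"
proof -
  interpret op_module mscale "mshift c" c by (rule op_module_mfun)
  show ?thesis
    by (induction p) (simp_all add: assms ent_add ent_mult ent_mpoly ent_mshift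
        ent_mpoly[of 0, simplified])
qed

lemma cosparse_eq_continuous:
  fixes f g :: "complex \<Rightarrow> complex"
  assumes "\<forall>\<^sub>\<approx>x\<in>UNIV. f x = g x" "isCont f z" "isCont g z"
  shows "f z = g z"
proof -
  have "eventually (\<lambda>x. f x = g x) (at z)"
    using assms(1) by (simp add: eventually_cosparse_open_eq)
  moreover have "f \<midarrow>z\<rightarrow> f z" "g \<midarrow>z\<rightarrow> g z" using assms(2,3) by (auto simp: isCont_def)
  ultimately show ?thesis
    by (metis LIM_unique tendsto_cong)
qed

lemma holomorphic_UNIV_isCont: "f holomorphic_on UNIV \<Longrightarrow> isCont f z"
  using holomorphic_on_imp_continuous_on continuous_on_eq_continuous_at open_UNIV by blast

lemma cosparse_eq_entire:
  assumes "\<forall>\<^sub>\<approx>x\<in>UNIV. f x = g x" "f holomorphic_on UNIV" "g holomorphic_on UNIV"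
  shows "f z = g z"
  using cosparse_eq_continuous[OF assms(1)] holomorphic_UNIV_isCont assms by blast

text \<open>The modulus is bounded by its maximum over a period parallelogram, so Liouville applies.
  With the hypothesis on the modulus alone, \<open>entire_eigenfunction\<close> can get by with
  multipliers of absolute value 1.\<close>

lemma entire_norm_periodic_constant:
  fixes f :: "complex \<Rightarrow> complex"
  assumes "\<alpha> \<notin> \<real>" "f holomorphic_on UNIV"
    and "\<And>x. norm (f (x + 1)) = norm (f x)" "\<And>x. norm (f (x + \<alpha>)) = norm (f x)"
  shows "\<exists>c. \<forall>x. f x = c"
proof -
  have im: "Im \<alpha> \<noteq> 0" using assms(1) by (simp add: complex_is_Real_iff)
  have per: "norm (f (x + of_int m + of_int n * \<alpha>)) = norm (f x)" for x m n
  proof -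
    have *: "norm (f (x + of_int m * c)) = norm (f x)"
      if c: "\<And>x. norm (f (x + c)) = norm (f x)" for c x m
    proof (induction m arbitrary: x rule: int_induct[of _ 0])
      case (step1 i)
      then show ?case using c[of "x + of_int i * c"] by (simp add: algebra_simps)
    next
      case (step2 i)
      then show ?case using c[of "x + of_int (i - 1) * c"] by (simp add: algebra_simps)
    qed simp
    show ?thesis using *[of \<alpha> "x + of_int m" n] *[of 1 x m] assms(3,4) by simp
  qed
  define K where "K = (\<lambda>(s, t). complex_of_real s + complex_of_real t * \<alpha>) ` ({0..1} \<times> {0..1})"
  have "compact K" unfolding K_def
    by (intro compact_continuous_image compact_Times compact_Icc)
       (auto simp: case_prod_unfold intro!: continuous_intros)
  moreover have "continuous_on K f"
    using assms(2) holomorphic_on_imp_continuous_on continuous_on_subset by blast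
  ultimately have "bounded (f ` K)"
    by (intro compact_imp_bounded compact_continuous_image)
  then obtain B where B: "\<And>x. x \<in> K \<Longrightarrow> norm (f x) \<le> B" unfolding bounded_iff by auto
  have "norm (f x) \<le> B" for x
  proof -
    define t where "t = Im x / Im \<alpha>"
    define s where "s = Re x - t * Re \<alpha>"
    have x: "x = complex_of_real s + complex_of_real t * \<alpha>"
      using im by (simp add: complex_eq_iff s_def t_def)
    define y where "y = complex_of_real (frac s) + complex_of_real (frac t) * \<alpha>"
    have "y \<in> K" unfolding K_def y_def
      by (intro image_eqI[of _ _ "(frac s, frac t)"]) (auto simp: frac_lt_1 less_imp_le)
    moreover have "x = y + of_int \<lfloor>s\<rfloor> + of_int \<lfloor>t\<rfloor> * \<alpha>"
      unfolding x y_def frac_def by (simp add: algebra_simps)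
    ultimately show ?thesis using B per by metis
  qed
  then have "bounded (range f)" unfolding bounded_iff by blast
  from Liouville_theorem[OF assms(2) this] show ?thesis by (auto simp: constant_on_def)
qed

text \<open>The fractional parts of the multiples of \<alpha> are bounded, and distinct because
  \<alpha> is irrational.\<close>

lemma real_multiples_accumulate:
  fixes \<alpha> z :: complex
  assumes "\<alpha> \<in> \<real>" "\<alpha> \<notin> \<rat>"
  shows "\<exists>\<xi>. \<xi> islimpt range (\<lambda>(m, n). z + of_int m + of_int n * \<alpha>)"
proof -
  obtain a where a: "\<alpha> = complex_of_real a" using assms(1) by (auto elim: Reals_cases)
  define g where "g n = z + of_real (frac (real n * a))" for n
  have "inj g"
  proof (rule injI)
    fix m n assume "g m = g n"
    then have "complex_of_real (real m * a - of_int \<lfloor>real m * a\<rfloor>) =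
       complex_of_real (real n * a - of_int \<lfloor>real n * a\<rfloor>)"
      unfolding g_def frac_def by simp
    then have "of_int (\<lfloor>real n * a\<rfloor> - \<lfloor>real m * a\<rfloor>) * 1 + of_int (int m - int n) * \<alpha> = 0"
      unfolding a by (simp add: algebra_simps)
    from irrational_incommensurable[OF assms(2) this] show "m = n" by simp
  qed
  then have inf: "infinite (range g)" by (rule range_inj_infinite)
  have "norm (g n) \<le> norm z + 1" for n
    unfolding g_def by (rule norm_triangle_le) (auto simp: frac_lt_1 less_imp_le)
  then have "range g \<subseteq> cball 0 (norm z + 1)" by auto
  then obtain \<xi> where "\<xi> islimpt range g"
    using inf compact_cball[of 0 "norm z + 1"] unfolding compact_eq_Bolzano_Weierstrass by blast
  moreover have "range g \<subseteq> range (\<lambda>(m, n). z + of_int m + of_int n * \<alpha>)"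
  proof
    fix y assume "y \<in> range g"
    then obtain n where "y = g n" by auto
    then have "y = (\<lambda>(m, n). z + of_int m + of_int n * \<alpha>) (- \<lfloor>real n * a\<rfloor>, int n)"
      by (simp add: g_def frac_def a)
    then show "y \<in> range (\<lambda>(m, n). z + of_int m + of_int n * \<alpha>)" by blast
  qed
  ultimately show ?thesis using islimpt_subset by blast
qed

lemma lattice_invariant:
  assumes "\<And>x :: complex. P x \<longleftrightarrow> P (x + 1)" "\<And>x. P x \<longleftrightarrow> P (x + \<alpha>)" "P z"
  shows "P (z + of_int m + of_int n * \<alpha>)"
proof -
  have *: "P x \<longleftrightarrow> P (x + of_int m * c)" if c: "\<And>x. P x \<longleftrightarrow> P (x + c)" for c x m
  proof (induction m rule: int_induct[of _ 0])
    case (step1 i)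
    then show ?case using c[of "x + of_int i * c"] by (simp add: algebra_simps)
  next
    case (step2 i)
    then show ?case using c[of "x + of_int (i - 1) * c"] by (simp add: algebra_simps)
  qed simp
  show ?thesis using *[of \<alpha> "z + of_int m" n] *[of 1 z m] assms by simp
qed

lemma entire_zero_if_lattice_zeros:
  assumes "\<alpha> \<in> \<real>" "\<alpha> \<notin> \<rat>" "f holomorphic_on UNIV"
    and "\<And>m n. f (z + of_int m + of_int n * \<alpha>) = 0"
  shows "f x = 0"
proof -
  obtain \<xi> where "\<xi> islimpt range (\<lambda>(m, n). z + of_int m + of_int n * \<alpha>)"
    using real_multiples_accumulate[OF assms(1,2)] by blast
  then show ?thesis
    by (rule analytic_continuation[OF assms(3), rotated 4]) (use assms(4) in auto)
qed

lemma entire_doubly_periodic_constant: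
  assumes "\<alpha> \<notin> \<rat>" "f holomorphic_on UNIV"
    and "\<And>x. f (x + 1) = f x" "\<And>x. f (x + \<alpha>) = f x"
  shows "\<exists>c. \<forall>x. f x = c"
proof (cases "\<alpha> \<in> \<real>")
  case False
  then show ?thesis using assms by (intro entire_norm_periodic_constant) auto
next
  case True
  have "f x - f 0 = 0" for x
  proof (rule entire_zero_if_lattice_zeros[OF True assms(1), of "\<lambda>x. f x - f 0" 0])
    show "f (0 + of_int m + of_int n * \<alpha>) - f 0 = 0" for m n
      using lattice_invariant[of "\<lambda>x. f x - f 0 = 0" \<alpha> 0 m n] assms by simp
  qed (intro holomorphic_intros assms)
  then show ?thesis by (intro exI[of _ "f 0"]) simp
qed

lemma deriv_translate:
  assumes "f holomorphic_on UNIV"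
  shows "deriv (\<lambda>x. f (x + c)) x = deriv f (x + c)"
proof -
  have "(f has_field_derivative deriv f (x + c)) (at (x + c))"
    using assms holomorphic_derivI by blast
  then show ?thesis by (intro DERIV_imp_deriv) (simp add: DERIV_shift)
qed

lemma deriv_constant_imp_affine:
  assumes "f holomorphic_on UNIV" "\<And>x. deriv f x = k"
  shows "f x = k * x + f 0"
proof -
  have "((\<lambda>x. f x - k * x) has_field_derivative 0) (at x)" for x
    using holomorphic_derivI[OF assms(1), of x] assms(2)
    by (auto intro!: derivative_eq_intros)
  then obtain c where "\<And>x. f x - k * x = c"
    using has_field_derivative_zero_constant[of UNIV "\<lambda>x. f x - k * x"] by auto
  then show ?thesis by (metis diff_0_right diff_eq_eq mult_zero_right add.commute)
qed

lemma entire_eigenfunction: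
  assumes "\<alpha> \<notin> \<rat>" "w holomorphic_on UNIV" "a \<noteq> 0" "b \<noteq> 0"
    and S: "\<And>x. w (x + 1) = a * w x" and T: "\<And>x. w (x + \<alpha>) = b * w x"
  shows "\<exists>k c. \<forall>x. w x = k * exp (c * x)"
proof (cases "\<alpha> \<in> \<real>")
  case False
  then have im: "Im \<alpha> \<noteq> 0" by (simp add: complex_is_Real_iff)
  define r where "r = ln (norm a)"
  \<comment> \<open>Re c = ln |a| and Re (c \<alpha>) = ln |b| are two real conditions on c,
    solvable since Im \<alpha> is nonzero. Dividing by e^(cx) then makes the modulus doubly
    periodic.\<close>
  define c where "c = Complex r ((r * Re \<alpha> - ln (norm b)) / Im \<alpha>)"
  have Re_c: "exp (Re c) = norm a" "exp (Re (c * \<alpha>)) = norm b"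
    using assms(3,4) im by (simp_all add: c_def r_def)
  have exp_shift: "exp (- c * (x + p)) = exp (- c * x) * inverse (exp (c * p))" for x p
    unfolding exp_minus[symmetric] exp_add[symmetric] by (simp add: algebra_simps)
  have norms: "norm (exp c) = norm a" "norm (exp (c * \<alpha>)) = norm b"
    unfolding norm_exp_eq_Re by (rule Re_c)+
  have "\<exists>k. \<forall>x. w x * exp (- c * x) = k"
  proof (rule entire_norm_periodic_constant[OF False])
    show "norm (w (x + 1) * exp (- c * (x + 1))) = norm (w x * exp (- c * x))" for x
      unfolding S exp_shift norm_mult norm_inverse using norms assms(3) by simp
    show "norm (w (x + \<alpha>) * exp (- c * (x + \<alpha>))) = norm (w x * exp (- c * x))" for x
      unfolding T exp_shift norm_mult norm_inverse using norms assms(4) by simp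
  qed (intro holomorphic_intros assms)
  then obtain k where "\<And>x. w x * exp (- c * x) = k" by blast
  then have "w x = k * exp (c * x)" for x by (simp add: exp_minus field_simps)
  then show ?thesis by blast
next
  case True
  \<comment> \<open>For real \<alpha> a zero would spread to a set with a limit point. Without zeros
    w'/w is entire and doubly periodic, hence constant.\<close>
  show ?thesis
  proof (cases "\<exists>z. w z = 0")
    case z: True
    then obtain z where "w z = 0" by blast
    then have "w (z + of_int m + of_int n * \<alpha>) = 0" for m n
      using lattice_invariant[of "\<lambda>x. w x = 0" \<alpha> z m n] assms by simp
    then have "w x = 0" for x
      using entire_zero_if_lattice_zeros[OF True assms(1,2)] by blast
    then show ?thesis by (intro exI[of _ 0]) auto
  next
    case nz: False
    have w': "deriv w (x + 1) = a * deriv w x" "deriv w (x + \<alpha>) = b * deriv w x" for x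
      using deriv_translate[OF assms(2), of 1 x] deriv_translate[OF assms(2), of \<alpha> x]
        deriv_cmult[of w x] assms(2) holomorphic_on_imp_differentiable_at[of w UNIV x]
      unfolding S T by auto
    have "\<exists>c. \<forall>x. deriv w x / w x = c"
      by (rule entire_doubly_periodic_constant[OF assms(1)])
         (use nz assms w' in \<open>auto intro!: holomorphic_intros\<close>)
    then obtain c where c: "\<And>x. deriv w x / w x = c" by blast
    have "((\<lambda>x. w x * exp (- c * x)) has_field_derivative 0) (at x)" for x
    proof -
      have "deriv w x = c * w x" using c[of x] nz by (simp add: field_simps)
      then show ?thesis using holomorphic_derivI[OF assms(2), of x]
        by (auto intro!: derivative_eq_intros)
    qed
    then obtain k where "\<And>x. w x * exp (- c * x) = k"
      using has_field_derivative_zero_constant[of UNIV "\<lambda>x. w x * exp (- c * x)"] by auto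
    then have "w x = k * exp (c * x)" for x by (simp add: exp_minus field_simps)
    then show ?thesis by blast
  qed
qed

lemma remove_sings_entire:
  assumes "f meromorphic_on UNIV" "\<And>z. \<exists>L. f \<midarrow>z\<rightarrow> L"
  shows "remove_sings f holomorphic_on UNIV" "\<forall>\<^sub>\<approx>x\<in>UNIV. remove_sings f x = f x"
proof -
  have "remove_sings f analytic_on {z}" for z
  proof -
    obtain L where "f \<midarrow>z\<rightarrow> L" using assms(2) by blast
    moreover have "isolated_singularity_at f z"
      using assms(1) meromorphic_on_isolated_singularity meromorphic_on_subset by blast
    ultimately show ?thesis using remove_sings_analytic_at by blast
  qed
  then have "remove_sings f analytic_on UNIV"
    using analytic_on_analytic_at by blast
  then show "remove_sings f holomorphic_on UNIV" by (rule analytic_imp_holomorphic)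
  show "\<forall>\<^sub>\<approx>x\<in>UNIV. remove_sings f x = f x" by (rule eventually_remove_sings_eq[OF assms(1)])
qed

lemma tendsto_if_not_pole:
  assumes "f meromorphic_on UNIV" "\<not> is_pole f z"
  shows "\<exists>L. f \<midarrow>z\<rightarrow> L"
proof -
  have "not_essential f z"
    using assms(1) meromorphic_on_not_essential meromorphic_on_subset by blast
  then show ?thesis using assms(2) unfolding not_essential_def by blast
qed

lemma ent_if_no_poles:
  assumes "f meromorphic_on UNIV" "\<And>z. \<not> is_pole f z"
  shows "ent (mfun f)"
proof -
  have *: "\<exists>L. f \<midarrow>z\<rightarrow> L" for z using tendsto_if_not_pole assms by blast
  have "mfun f = mfun (remove_sings f)"
    using remove_sings_entire(2)[OF assms(1) *] by (simp add: mfun_eq_iff eq_commute)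
  then show ?thesis using entI[OF remove_sings_entire(1)[OF assms(1) *]] by simp
qed

section \<open>Propagation of poles\<close>

lemma mact_mfun: "mact c p (mfun f) = mfun (\<lambda>x. \<Sum>i\<le>degree p. coeff p i * f (x + of_nat i * c))"
proof -
  interpret op_module mscale "mshift c" c by (rule op_module_mfun)
  have sh: "(shift c ^^ i) f x = f (x + of_nat i * c)" for i x
    by (induction i arbitrary: x) (simp_all add: shift_def algebra_simps)
  have "mact c p (mfun f) = mact c (\<Sum>i\<le>degree p. monom (coeff p i) i) (mfun f)"
    by (simp add: poly_as_sum_of_monoms)
  also have "\<dots> = (\<Sum>i\<le>degree p. mconst (coeff p i) * mfun ((shift c ^^ i) f))"
    by (simp add: act_sum act_monom funpow_mshift)
  finally show ?thesis by (simp add: mconst_eq mfun_mult mfun_sum sh)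
qed

text \<open>If all other terms of the recurrence had finite limits, solving for the j-th term would
  give f a finite limit at z.\<close>

lemma pole_propagates:
  assumes "f meromorphic_on UNIV" "mact c p (mfun f) = 0" "is_pole f z"
    and j: "j \<le> degree p" "coeff p j \<noteq> 0"
  shows "\<exists>i\<le>degree p. i \<noteq> j \<and> coeff p i \<noteq> 0 \<and> is_pole f (z + (of_nat i - of_nat j) * c)"
proof (rule ccontr)
  assume contra: "\<not> ?thesis"
  define J where "J = {i. i \<le> degree p \<and> i \<noteq> j \<and> coeff p i \<noteq> 0}"
  have "\<exists>L. (\<lambda>x. f (x + (of_nat i - of_nat j) * c)) \<midarrow>z\<rightarrow> L" if "i \<in> J" for i
  proof -
    have "\<not> is_pole f (z + (of_nat i - of_nat j) * c)" using contra that unfolding J_def by blast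
    then obtain L where "f \<midarrow>z + (of_nat i - of_nat j) * c\<rightarrow> L"
      using tendsto_if_not_pole[OF assms(1)] by blast
    from LIM_offset[OF this, of "(of_nat i - of_nat j) * c"] show ?thesis by auto
  qed
  then obtain L where L: "\<And>i. i \<in> J \<Longrightarrow> (\<lambda>x. f (x + (of_nat i - of_nat j) * c)) \<midarrow>z\<rightarrow> L i"
    by metis
  have "\<forall>\<^sub>\<approx>x\<in>UNIV. (\<Sum>i\<le>degree p. coeff p i * f (x + of_nat i * c)) = 0"
    using assms(2) unfolding mact_mfun mfun_eq_0_iff .
  from cosparse_translate[OF this, of "- of_nat j * c"]
  have "\<forall>\<^sub>\<approx>x\<in>UNIV. (\<Sum>i\<le>degree p. coeff p i * f (x + (of_nat i - of_nat j) * c)) = 0"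
    by (simp add: algebra_simps)
  then have "eventually (\<lambda>x. (\<Sum>i\<le>degree p. coeff p i * f (x + (of_nat i - of_nat j) * c)) = 0) (at z)"
    by (simp add: eventually_cosparse_open_eq)
  then have "eventually (\<lambda>x. - (\<Sum>i\<in>J. coeff p i * f (x + (of_nat i - of_nat j) * c)) / coeff p j = f x) (at z)"
  proof eventually_elim
    case (elim x)
    have "(\<Sum>i\<le>degree p. coeff p i * f (x + (of_nat i - of_nat j) * c)) =
        (\<Sum>i\<in>insert j J. coeff p i * f (x + (of_nat i - of_nat j) * c))"
      using j by (intro sum.mono_neutral_right) (auto simp: J_def)
    also have "\<dots> = coeff p j * f x + (\<Sum>i\<in>J. coeff p i * f (x + (of_nat i - of_nat j) * c))"
      by (subst sum.insert) (auto simp: J_def)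
    finally have "(\<Sum>i\<in>J. coeff p i * f (x + (of_nat i - of_nat j) * c)) = - (coeff p j * f x)"
      using elim by (simp only: eq_neg_iff_add_eq_0 add.commute)
    then show ?case using j by simp
  qed
  moreover have "(\<lambda>x. - (\<Sum>i\<in>J. coeff p i * f (x + (of_nat i - of_nat j) * c)) / coeff p j)
      \<midarrow>z\<rightarrow> - (\<Sum>i\<in>J. coeff p i * L i) / coeff p j"
    using L j by (intro tendsto_intros) auto
  ultimately have "f \<midarrow>z\<rightarrow> - (\<Sum>i\<in>J. coeff p i * L i) / coeff p j"
    by (rule Lim_transform_eventually[rotated])
  then show False
    using assms(3) not_tendsto_and_filterlim_at_infinity[of "at z" f] by (auto simp: is_pole_def)
qed

text \<open>Solving for the nonzero term of least index finds a pole further along c, solving for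
  the top term finds one in the opposite direction.\<close>

lemma pole_propagates_both:
  assumes "f meromorphic_on UNIV" "p \<noteq> 0" "mact c p (mfun f) = 0" "is_pole f z"
  shows "\<exists>k\<in>{1..degree p}. is_pole f (z + of_nat k * c)"
    and "\<exists>k\<in>{1..degree p}. is_pole f (z - of_nat k * c)"
proof -
  define l where "l = (LEAST i. coeff p i \<noteq> 0)"
  have l: "coeff p l \<noteq> 0" "\<And>i. coeff p i \<noteq> 0 \<Longrightarrow> l \<le> i"
    unfolding l_def using LeastI[of "\<lambda>i. coeff p i \<noteq> 0" "degree p"] assms(2) by (auto intro: Least_le)
  have "l \<le> degree p" using l(2)[of "degree p"] assms(2) by simp
  from pole_propagates[OF assms(1,3,4) this l(1)] obtain i where
    i: "i \<le> degree p" "i \<noteq> l" "coeff p i \<noteq> 0" "is_pole f (z + (of_nat i - of_nat l) * c)" by blast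
  then have "l < i" using l(2)[of i] by simp
  then show "\<exists>k\<in>{1..degree p}. is_pole f (z + of_nat k * c)"
    using i by (intro bexI[of _ "i - l"]) (auto simp: of_nat_diff)
  from pole_propagates[OF assms(1,3,4) order_refl] assms(2) obtain i where
    i: "i \<le> degree p" "i \<noteq> degree p" "is_pole f (z + (of_nat i - of_nat (degree p)) * c)" by auto
  then show "\<exists>k\<in>{1..degree p}. is_pole f (z - of_nat k * c)"
    by (intro bexI[of _ "degree p - i"]) (auto simp: of_nat_diff algebra_simps)
qed

text \<open>A pole of greatest real part would have another one to its right.\<close>

lemma no_poles_if_finite:
  assumes "f meromorphic_on UNIV" "p \<noteq> 0" "mact 1 p (mfun f) = 0" "finite {z. is_pole f z}"
  shows "\<not> is_pole f z"
proof
  assume z: "is_pole f z"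
  define M where "M = Max (Re ` {z. is_pole f z})"
  have "M \<in> Re ` {z. is_pole f z}" unfolding M_def using assms(4) z by (intro Max_in) auto
  then obtain y where y: "is_pole f y" "Re y = M" by auto
  obtain k :: nat where k: "k \<ge> 1" "is_pole f (y + of_nat k * 1)"
    using pole_propagates_both(1)[OF assms(1-3) y(1)] by auto
  then have "Re (y + of_nat k * 1) \<le> M"
    unfolding M_def using assms(4) by (intro Max_ge imageI finite_imageI CollectI)
  then show False using k(1) y(2) by simp
qed

text \<open>Starting from a pole one can walk to other poles in steps of bounded length, to the left by
  integers or to the right by multiples of \<open>b\<close>, as one likes. Staying in a bounded window one never
  returns to the same point, so the poles accumulate.\<close>
lemma no_poles_if_dense:
  assumes f: "f meromorphic_on UNIV" and irr: "complex_of_real b \<notin> \<rat>" and b: "b > 0"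
    and bwd: "\<And>z. is_pole f z \<Longrightarrow> \<exists>k\<in>{1..m}. is_pole f (z - of_nat k)"
    and fwd: "\<And>z. is_pole f z \<Longrightarrow> \<exists>k\<in>{1..n}. is_pole f (z + of_nat k * of_real b)"
  shows "\<not> is_pole f z"
proof
  assume z: "is_pole f z"
  define pt where "pt = (\<lambda>(i, j). z + of_real (real j * b - real i))"
  \<comment> \<open>From a nonnegative offset a step to the left stays above -m, from a negative one
    a step to the right stays below n b. Each step raises i + j, which is therefore unbounded on
    W.\<close>
  define W where "W = {(i, j). is_pole f (pt (i, j)) \<and>
     - real m \<le> real j * b - real i \<and> real j * b - real i \<le> real n * b}"
  have step: "\<exists>i j. (i, j) \<in> W \<and> i + j \<ge> N" for N :: nat
  proof (induction N)
    case 0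
    have "(0, 0) \<in> W" using z b by (simp add: W_def pt_def)
    then show ?case by blast
  next
    case (Suc N)
    then obtain i j where ij: "(i, j) \<in> W" "i + j \<ge> N" by blast
    show ?case
    proof (cases "real j * b - real i \<ge> 0")
      case True
      obtain k where k: "1 \<le> k" "k \<le> m" "is_pole f (pt (i, j) - of_nat k)"
        using bwd[of "pt (i, j)"] ij(1) by (auto simp: W_def)
      have "(i + k, j) \<in> W" using k True ij(1) by (auto simp: W_def pt_def algebra_simps)
      then show ?thesis using k(1) ij(2) by (intro exI[of _ "i + k"] exI[of _ j]) auto
    next
      case False
      obtain k where k: "1 \<le> k" "k \<le> n" "is_pole f (pt (i, j) + of_nat k * of_real b)"
        using fwd[of "pt (i, j)"] ij(1) by (auto simp: W_def)
      have "real k * b \<le> real n * b" "0 \<le> real k * b" using k b by (auto intro!: mult_right_mono)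
      then have "(i, j + k) \<in> W"
        using k False ij(1) by (auto simp: W_def pt_def algebra_simps)
      then show ?thesis using k(1) ij(2) by (intro exI[of _ i] exI[of _ "j + k"]) auto
    qed
  qed
  have "infinite W"
  proof
    assume fin: "finite W"
    obtain i j where ij: "(i, j) \<in> W" "i + j \<ge> Suc (Max ((\<lambda>(i, j). i + j) ` W))" using step by blast
    have "(\<lambda>(i, j). i + j) (i, j) \<le> Max ((\<lambda>(i, j). i + j) ` W)"
      using fin ij(1) by (intro Max_ge imageI) auto
    then show False using ij(2) by simp
  qed
  moreover have "inj_on pt W"
  proof (rule inj_onI)
    fix x y assume "pt x = pt y"
    then have "complex_of_real (real (snd x) * b - real (fst x)) = of_real (real (snd y) * b - real (fst y))"
      unfolding pt_def case_prod_unfold by (metis add_left_cancel)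
    then have "of_int (int (fst y) - int (fst x)) * 1 + of_int (int (snd x) - int (snd y)) * complex_of_real b = 0"
      by (simp add: algebra_simps)
    from irrational_incommensurable[OF irr this] show "x = y" by (simp add: prod_eq_iff)
  qed
  ultimately have inf: "infinite (pt ` W)" using finite_image_iff by blast
  have "pt ` W \<subseteq> cball z (real m + real n * b) \<inter> {z. is_pole f z}"
  proof
    fix y assume "y \<in> pt ` W"
    then obtain i j where ij: "(i, j) \<in> W" "y = pt (i, j)" by auto
    then have eq: "norm (y - z) = \<bar>real j * b - real i\<bar>" by (simp only: pt_def prod.case add_diff_cancel_left' norm_of_real)
    have "0 \<le> real n * b" using b by simp
    then have "\<bar>real j * b - real i\<bar> \<le> real m + real n * b"
      using ij(1) by (auto simp: W_def abs_le_iff)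
    then show "y \<in> cball z (real m + real n * b) \<inter> {z. is_pole f z}"
      using ij eq by (auto simp: W_def dist_norm norm_minus_commute)
  qed
  moreover have "{z. is_pole f z} sparse_in UNIV"
    using meromorphic_on_imp_not_pole_cosparse[OF f] by (simp add: eventually_cosparse)
  then have "finite (cball z (real m + real n * b) \<inter> {z. is_pole f z})"
    by (intro sparse_in_compact_finite) (auto intro: sparse_in_subset)
  ultimately show False using inf finite_subset by blast
qed

lemma no_poles:
  assumes "\<alpha> \<notin> \<rat>" "f meromorphic_on UNIV"
    and "p1 \<noteq> 0" "mact 1 p1 (mfun f) = 0" "p2 \<noteq> 0" "mact \<alpha> p2 (mfun f) = 0"
    and "\<alpha> \<in> \<real> \<or> finite {z. is_pole f z}"
  shows "\<not> is_pole f z"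
proof (cases "finite {z. is_pole f z}")
  case True
  then show ?thesis using no_poles_if_finite assms by blast
next
  case False
  then obtain a where a: "\<alpha> = complex_of_real a" using assms(7) by (auto elim: Reals_cases)
  have "a \<noteq> 0" using assms(1) a by auto
  have irr: "complex_of_real \<bar>a\<bar> \<notin> \<rat>" using assms(1) a by (auto simp: abs_if split: if_splits)
  note P1 = pole_propagates_both[OF assms(2,3,4)] and P2 = pole_propagates_both[OF assms(2,5,6)]
  show ?thesis
  proof (rule no_poles_if_dense[OF assms(2) irr, of "degree p1" "degree p2"])
    show "\<exists>k\<in>{1..degree p1}. is_pole f (z - of_nat k)" if "is_pole f z" for z
      using P1(2)[OF that] by simp
    \<comment> \<open>If a is negative, a step to the right goes backwards along \<alpha>.\<close>
    show "\<exists>k\<in>{1..degree p2}. is_pole f (z + of_nat k * of_real \<bar>a\<bar>)" if "is_pole f z" for z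
      using P2[OF that] by (cases "a > 0") (auto simp: a)
  qed (use \<open>a \<noteq> 0\<close> in auto)
qed

text \<open>By induction the increment of w under \<alpha> is a constant, so w' is entire and doubly
  periodic, hence constant. An affine function with period 1 is constant.\<close>

lemma invariant_nilpotent_constant:
  assumes "\<alpha> \<notin> \<rat>" "ent w" "mshift 1 w = w" "(mdelta \<alpha> ^^ n) w = 0"
  shows "\<exists>k. w = mconst k"
  using assms(2-)
proof (induction n arbitrary: w)
  case 0
  then show ?case by (intro exI[of _ 0]) (simp add: mfun_0)
next
  case (Suc n)
  have "\<exists>k. mdelta \<alpha> w = mconst k"
  proof (rule Suc.IH)
    show "ent (mdelta \<alpha> w)" using ent_mdelta[OF Suc.prems(1), of 1 \<alpha>] by simp
    have "mshift 1 (mdelta \<alpha> w) = mdelta \<alpha> (mshift 1 w)"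
      by (simp add: mdelta_def mshift_diff mshift_mshift add.commute)
    then show "mshift 1 (mdelta \<alpha> w) = mdelta \<alpha> w" using Suc.prems(2) by simp
    show "(mdelta \<alpha> ^^ n) (mdelta \<alpha> w) = 0"
      using Suc.prems(3) by (simp add: funpow_Suc_right del: funpow.simps(2))
  qed
  then obtain k where k: "mdelta \<alpha> w = mconst k" by blast
  obtain f where f: "f holomorphic_on UNIV" "w = mfun f" using Suc.prems(1) unfolding ent_def by blast
  have "\<forall>\<^sub>\<approx>x\<in>UNIV. f (x + 1) = f x"
    using Suc.prems(2) unfolding f mshift_mfun mfun_eq_iff .
  then have S: "f (x + 1) = f x" for x
    by (rule cosparse_eq_entire) (intro f holomorphic_on_translate[OF f(1)])+
  have "\<forall>\<^sub>\<approx>x\<in>UNIV. f (x + \<alpha>) - f x = k"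
    using k unfolding f mdelta_def mshift_mfun mfun_diff mconst_eq mfun_eq_iff .
  then have "f (x + \<alpha>) - f x = k" for x
    by (rule cosparse_eq_entire) (intro f(1) holomorphic_on_translate[OF f(1)] holomorphic_on_diff holomorphic_on_const)+
  then have T: "f (x + \<alpha>) = f x + k" for x by (metis diff_eq_eq add.commute)
  have "\<exists>c. \<forall>x. deriv f x = c"
  proof (rule entire_doubly_periodic_constant[OF assms(1)])
    show "deriv f (x + 1) = deriv f x" for x
      using deriv_translate[OF f(1), of 1 x] unfolding S by simp
    have "deriv (\<lambda>x. f x + k) x = deriv f x" for x
      using holomorphic_derivI[OF f(1), of x] by (intro DERIV_imp_deriv) (auto intro!: derivative_eq_intros)
    then show "deriv f (x + \<alpha>) = deriv f x" for x
      using deriv_translate[OF f(1), of \<alpha> x] unfolding T by simp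
  qed (intro holomorphic_deriv f open_UNIV)
  then obtain c where "\<And>x. deriv f x = c" by blast
  then have aff: "f x = c * x + f 0" for x using deriv_constant_imp_affine[OF f(1)] by blast
  have "c = 0" using aff[of 1] S[of 0] by simp
  then have "f = (\<lambda>_. f 0)" using aff by (auto simp: fun_eq_iff)
  then have "w = mconst (f 0)" unfolding f mconst_eq by (metis)
  then show ?case by blast
qed

text \<open>The m-th difference of u for the shift by 1 is a constant k, and subtracting k x^m / m!
  removes it.\<close>

lemma unipotent_entire_poly:
  assumes "\<alpha> \<notin> \<rat>" "ent u" "(mdelta 1 ^^ m) u = 0" "(mdelta \<alpha> ^^ n) u = 0"
  shows "\<exists>p. u = mpoly p"
  using assms(2-)
proof (induction m arbitrary: u n)
  case 0
  then show ?case by (intro exI[of _ 0]) (simp add: mfun_0)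
next
  case (Suc m)
  define X where "X = mpoly [:0, 1:]"
  have X: "mshift c X = X + mconst c" for c
    unfolding X_def mshift_mpoly by (simp add: pcompose_pCons flip: mpoly_add)
  have X1: "mshift 1 X = X + 1" using X[of 1] by simp
  have "\<exists>k. (mdelta 1 ^^ m) u = mconst k"
  proof (rule invariant_nilpotent_constant[OF assms(1)])
    show "ent ((mdelta 1 ^^ m) u)" by (rule ent_mdelta[OF Suc.prems(1)])
    show "mshift 1 ((mdelta 1 ^^ m) u) = (mdelta 1 ^^ m) u"
      using Suc.prems(2) by (simp add: mdelta_def[of 1 "(mdelta 1 ^^ m) u"])
    show "(mdelta \<alpha> ^^ n) ((mdelta 1 ^^ m) u) = 0"
      by (simp add: funpow_mdelta_commute[where c = \<alpha> and d = 1] Suc.prems(3))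
  qed
  then obtain k where k: "(mdelta 1 ^^ m) u = mconst k" by blast
  define c where "c = k / of_nat (fact m)"
  have inv: "mshift d (mconst c) = mconst c" for d by simp
  \<comment> \<open>The m + 1st difference for \<alpha> kills x^m, but lower ones need not. The
    nilpotency order therefore grows during the induction, which is why n is arbitrary
    there.\<close>
  define N where "N = n + Suc m"
  have big: "(mdelta \<alpha> ^^ N) v = (mdelta \<alpha> ^^ Suc m) ((mdelta \<alpha> ^^ n) v)" for v
    unfolding N_def by (subst add.commute) (simp add: funpow_add)
  have "\<exists>p. u - X ^ m * mconst c = mpoly p"
  proof (rule Suc.IH)
    show "ent (u - X ^ m * mconst c)"
      unfolding X_def by (intro ent_diff ent_mult ent_power ent_mpoly Suc.prems(1))
    have "(mdelta 1 ^^ m) (X ^ m * mconst c) = mconst k"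
      unfolding funpow_mdelta_mult_invariant[OF inv] funpow_mdelta_power[OF X1] of_nat_mfun
        mpoly_mult[symmetric] by (simp add: c_def)
    then show "(mdelta 1 ^^ m) (u - X ^ m * mconst c) = 0"
      by (simp add: funpow_mdelta_diff k)
    have "(mdelta \<alpha> ^^ N) (X ^ m * mconst c) = 0"
      unfolding funpow_mdelta_mult_invariant[OF inv]
      using funpow_mdelta_power_Suc[OF X, of \<alpha> m N] by (simp add: N_def)
    moreover have "(mdelta \<alpha> ^^ N) u = 0" unfolding big Suc.prems(3) by (rule funpow_mdelta_0)
    ultimately show "(mdelta \<alpha> ^^ N) (u - X ^ m * mconst c) = 0"
      by (simp add: funpow_mdelta_diff)
  qed
  then obtain p where "u - X ^ m * mconst c = mpoly p" by blast
  then have "u = mpoly p + X ^ m * mconst c" by (simp add: algebra_simps)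
  also have "X ^ m = mpoly ([:0, 1:] ^ m)"
    unfolding X_def mfun_power by (rule mfun_eqI) (simp add: poly_power)
  finally show ?case by (metis mpoly_add mpoly_mult)
qed

abbreviation mexp :: "complex \<Rightarrow> mfun" where
  "mexp c \<equiv> mfun (\<lambda>x. exp (c * x))"

lemma mshift_mexp: "mshift d (mexp c) = mconst (exp (c * d)) * mexp c"
  unfolding mconst_eq mshift_mfun mfun_mult
  by (rule mfun_eqI) (simp add: ring_distribs exp_add)

lemma mexp_inverse: "mexp c * mexp (- c) = 1"
  unfolding mfun_mult mfun_1 by (rule mfun_eqI) (simp flip: exp_add)

lemma (in op_module) act_power_last_nonzero:
  assumes "act (q ^ m) h = 0" "h \<noteq> 0"
  shows "\<exists>i. act (q ^ i) h \<noteq> 0 \<and> act q (act (q ^ i) h) = 0"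
  using assms(1)
proof (induction m)
  case (Suc m)
  then show ?case by (cases "act (q ^ m) h = 0") (auto simp: act_mult)
qed (use assms(2) in simp)

lemma mact_linear: "mact c [:- a, 1:] v = mshift c v - mconst a * v"
proof -
  interpret op_module mscale "mshift c" c by (rule op_module_mfun)
  have "mconst (- a) = - mconst a" by (simp add: mconst_eq mfun_uminus)
  then show ?thesis by simp
qed

lemma mact_0_right: "mact c p 0 = 0"
proof -
  interpret op_module mscale "mshift c" c by (rule op_module_mfun)
  show ?thesis by simp
qed

text \<open>One exponent c has to meet both e^c = a and e^(c \<alpha>) = b, which is possible for
  special pairs only. The last nonzero iterates under S - a and T - b give a true joint
  eigenfunction, and \<open>entire_eigenfunction\<close> reads c off it.\<close>

lemma entire_generalized_eigenfunction:
  assumes "\<alpha> \<notin> \<rat>" "ent h"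
    and "mact 1 ([:- a, 1:] ^ m) h = 0" "mact \<alpha> ([:- b, 1:] ^ n) h = 0"
  shows "\<exists>p c. h = mpoly p * mexp c"
proof (cases "h = 0")
  case True
  then show ?thesis by (intro exI[of _ 0]) (simp add: mfun_0 mfun_mult)
next
  case False
  obtain i where i: "mact 1 ([:- a, 1:] ^ i) h \<noteq> 0"
     "mact 1 [:- a, 1:] (mact 1 ([:- a, 1:] ^ i) h) = 0"
    using op_module.act_power_last_nonzero[OF op_module_mfun assms(3) False] by blast
  define h1 where "h1 = mact 1 ([:- a, 1:] ^ i) h"
  have "mact \<alpha> ([:- b, 1:] ^ n) h1 = 0"
    unfolding h1_def mact_mact[of \<alpha> _ 1] assms(4) by (rule mact_0_right)
  then obtain j where j: "mact \<alpha> ([:- b, 1:] ^ j) h1 \<noteq> 0"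
     "mact \<alpha> [:- b, 1:] (mact \<alpha> ([:- b, 1:] ^ j) h1) = 0"
    using op_module.act_power_last_nonzero[OF op_module_mfun] i(1) h1_def by blast
  define h2 where "h2 = mact \<alpha> ([:- b, 1:] ^ j) h1"
  have "mact 1 [:- a, 1:] h2 = 0"
    unfolding h2_def mact_mact[of 1 _ \<alpha>] using i(2) h1_def by (simp add: mact_0_right)
  then have S: "mshift 1 h2 = mconst a * h2" by (simp add: mact_linear)
  have T: "mshift \<alpha> h2 = mconst b * h2" using j(2) by (simp add: mact_linear h2_def)
  have nz: "h2 \<noteq> 0" using j(1) h2_def by simp
  \<comment> \<open>Shifts are injective, so 0 is not an eigenvalue.\<close>
  have ab: "a \<noteq> 0" "b \<noteq> 0" using S T nz mshift_eq_0_iff by (auto simp: mconst_eq simp flip: mfun_0)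
  have "ent h2" unfolding h2_def h1_def by (intro ent_mact assms(2))
  then obtain w where w: "w holomorphic_on UNIV" "h2 = mfun w" unfolding ent_def by blast
  have wS: "w (x + 1) = a * w x" for x
    using S unfolding w mconst_eq mfun_mult mshift_mfun mfun_eq_iff
    by (rule cosparse_eq_entire) (intro w(1) holomorphic_on_translate[OF w(1)] holomorphic_on_mult holomorphic_on_const)+
  have wT: "w (x + \<alpha>) = b * w x" for x
    using T unfolding w mconst_eq mfun_mult mshift_mfun mfun_eq_iff
    by (rule cosparse_eq_entire) (intro w(1) holomorphic_on_translate[OF w(1)] holomorphic_on_mult holomorphic_on_const)+
  obtain k c where kc: "\<And>x. w x = k * exp (c * x)"
    using entire_eigenfunction[OF assms(1) w(1) ab wS wT] by blast
  have "k \<noteq> 0"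
  proof
    assume "k = 0"
    then have "h2 = 0" unfolding w mfun_0 by (intro mfun_eqI) (simp add: kc)
    then show False using nz by simp
  qed
  then have exps: "exp (c * 1) = a" "exp (c * \<alpha>) = b"
    using wS[of 0] wT[of 0] by (simp_all add: kc)
  define u where "u = mexp (- c) * h"
  have h: "h = mexp c * u" unfolding u_def mult.assoc[symmetric] mexp_inverse by simp
  have unip: "(mdelta d ^^ N) u = 0" if "exp (c * d) = e" "mact d ([:- e, 1:] ^ N) h = 0" for d e N
    using unipotent_if_eigen[OF mshift_mexp[of d c] mexp_inverse, of N u] that h by auto
  have "ent u" unfolding u_def by (intro ent_mult assms(2) entI holomorphic_intros)
  then obtain p where "u = mpoly p"
    using unipotent_entire_poly[OF assms(1) _ unip[OF exps(1) assms(3)] unip[OF exps(2) assms(4)]]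
    by blast
  then show ?thesis using h by (metis mult.commute)
qed

lemma sum_list_as_sum: "sum_list (map g ts) = (\<Sum>i=1..length ts. g (ts ! (i - 1)))"
proof (induction ts rule: rev_induct)
  case (snoc t ts)
  have "(\<Sum>i=1..length ts. g ((ts @ [t]) ! (i - 1))) = (\<Sum>i=1..length ts. g (ts ! (i - 1)))"
    by (intro sum.cong) (auto simp: nth_append)
  then show ?case using snoc by simp
qed simp

text \<open>With lists of terms, closure under addition is concatenation;
  \<open>exp_sum_mfunD\<close> passes to the indices 1, ..., I.\<close>

definition exp_sum :: "mfun \<Rightarrow> bool" where
  "exp_sum e \<longleftrightarrow> (\<exists>ts. e = sum_list (map (\<lambda>(r, a). mratfun r * mexp a) ts))"

lemma exp_sum_term: "exp_sum (mratfun r * mexp a)"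
  unfolding exp_sum_def by (intro exI[of _ "[(r, a)]"]) simp

lemma exp_sum_0: "exp_sum 0"
  unfolding exp_sum_def by (intro exI[of _ "[]"]) simp

lemma exp_sum_add: "exp_sum e \<Longrightarrow> exp_sum e' \<Longrightarrow> exp_sum (e + e')"
  unfolding exp_sum_def by (elim exE, rule_tac x = "ts @ tsa" in exI) simp

lemma exp_sum_mfunD:
  assumes "exp_sum (mfun f)"
  shows "\<exists>I (a :: nat \<Rightarrow> complex) (r :: nat \<Rightarrow> ratfun).
     \<forall>\<^sub>\<approx>x\<in>UNIV. f x = (\<Sum>i=1..I. ratfun_eval (r i) x * exp (a i * x))"
proof -
  obtain ts where "mfun f = sum_list (map (\<lambda>(r, a). mratfun r * mexp a) ts)"
    using assms unfolding exp_sum_def by blast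
  also have "\<dots> = (\<Sum>i=1..length ts. mratfun (fst (ts ! (i - 1))) * mexp (snd (ts ! (i - 1))))"
    by (simp add: sum_list_as_sum case_prod_unfold)
  finally show ?thesis
    unfolding mratfun_def mfun_mult mfun_sum mfun_eq_iff
    by (intro exI[of _ "length ts"] exI[of _ "\<lambda>i. snd (ts ! (i - 1))"]
        exI[of _ "\<lambda>i. fst (ts ! (i - 1))"])
qed

lemma mratfun_split: "q \<noteq> 0 \<Longrightarrow> mratfun (Fract 1 q) * mpoly p = mratfun (Fract p q)"
  by (rule mscale_cancel[of q]) (simp_all add: mratfun_Fract flip: mult.assoc)

lemma mratfun_inverse:
  assumes "q \<noteq> 0"
  shows "mratfun (Fract 1 q) * (mpoly q * e) = e"
proof -
  have "mratfun (Fract 1 q) * (mpoly q * e) = (mpoly q * mratfun (Fract 1 q)) * e"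
    by (simp only: mult_ac)
  then show ?thesis unfolding mratfun_Fract[OF assms] by simp
qed

theorem real_or_finite_poles_solution:
  assumes "\<alpha> \<notin> \<rat>" "f meromorphic_on UNIV" "solves_system \<alpha> f"
    and "\<alpha> \<in> \<real> \<or> finite {z. is_pole f z}"
  shows "\<exists>I (a :: nat \<Rightarrow> complex) (r :: nat \<Rightarrow> ratfun).
     \<forall>\<^sub>\<approx>x\<in>UNIV. f x = (\<Sum>i=1..I. ratfun_eval (r i) x * exp (a i * x))"
proof -
  obtain q p1 p2 where q: "q \<noteq> 0" "p1 \<noteq> 0" "p2 \<noteq> 0"
     "mact 1 p1 (mscale q (mfun f)) = 0" "mact \<alpha> p2 (mscale q (mfun f)) = 0"
    using solves_system_const_finite[OF assms(1,3)] by blast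
  define h where "h = (\<lambda>x. poly q x * f x)"
  have h: "mscale q (mfun f) = mfun h" by (simp add: h_def mfun_mult)
  have mer: "h meromorphic_on UNIV"
    unfolding h_def by (intro meromorphic_on_mult assms(2) entire_imp_meromorphic poly_holomorphic)
  have sub: "{z. is_pole h z} \<subseteq> {z. is_pole f z}"
  proof
    fix z assume z: "z \<in> {z. is_pole h z}"
    show "z \<in> {z. is_pole f z}"
    proof (rule ccontr)
      assume "z \<notin> {z. is_pole f z}"
      then obtain L where "f \<midarrow>z\<rightarrow> L" using tendsto_if_not_pole[OF assms(2)] by blast
      then have "h \<midarrow>z\<rightarrow> poly q z * L" unfolding h_def by (intro tendsto_intros)
      then show False
        using z not_tendsto_and_filterlim_at_infinity[of "at z" h] by (auto simp: is_pole_def)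
    qed
  qed
  have "\<not> is_pole h z" for z
    using no_poles[OF assms(1) mer q(2) _ q(3)] q(4,5) assms(4) finite_subset[OF sub] unfolding h by blast
  then have ent: "ent (mfun h)" by (rule ent_if_no_poles[OF mer])
  have "exp_sum (mratfun (Fract 1 q) * mfun h)"
  proof (rule joint_eigen_induct[OF q(2,3) q(4,5)[unfolded h], where A = ent])
    show "exp_sum (mratfun (Fract 1 q) * v)"
      if v: "ent v" "mact 1 ([:- a, 1:] ^ m) v = 0" "mact \<alpha> ([:- b, 1:] ^ n) v = 0" for a b m n v
    proof -
      obtain p c where "v = mpoly p * mexp c"
        using entire_generalized_eigenfunction[OF assms(1) v] by blast
      then show ?thesis using exp_sum_term[of "Fract p q" c] q(1)
        by (simp add: mratfun_split flip: mult.assoc)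
    qed
    show "exp_sum (mratfun (Fract 1 q) * 0)" using exp_sum_0 by simp
    show "exp_sum (mratfun (Fract 1 q) * (v + w))"
      if "exp_sum (mratfun (Fract 1 q) * v)" "exp_sum (mratfun (Fract 1 q) * w)" for v w
      unfolding distrib_left using that by (rule exp_sum_add)
  qed (use ent ent_mact in auto)
  then show ?thesis
    unfolding h[symmetric] mratfun_inverse[OF q(1)] by (rule exp_sum_mfunD)
qed

section \<open>The Weierstrass functions\<close>

text \<open>The infinite q-Pochhammer symbol (u; q).\<close>

definition qfac :: "complex \<Rightarrow> complex \<Rightarrow> complex" where
  "qfac q u = (\<Prod>n. 1 - q ^ n * u)"

lemma convergent_qfac:
  fixes q u :: complex
  assumes "norm q < 1"
  shows "convergent_prod (\<lambda>n. 1 - q ^ n * u)"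
proof -
  have "summable (\<lambda>n. norm (1 - q ^ n * u - 1))"
    using assms by (auto simp: norm_mult norm_power intro!: summable_mult2 summable_geometric)
  from abs_convergent_prod_imp_convergent_prod[OF summable_imp_abs_convergent_prod[OF this]]
  show ?thesis .
qed

lemma qfac_has_prod: "norm q < 1 \<Longrightarrow> (\<lambda>n. 1 - q ^ n * u) has_prod qfac q u"
  unfolding qfac_def by (intro convergent_prod_has_prod convergent_qfac)

lemma qfac_LIMSEQ: "norm q < 1 \<Longrightarrow> (\<lambda>n. \<Prod>i\<le>n. 1 - q ^ i * u) \<longlonglongrightarrow> qfac q u"
  unfolding qfac_def by (intro convergent_prod_LIMSEQ convergent_qfac)

lemma qfac_shift:
  assumes "norm q < 1"
  shows "qfac q u = (1 - u) * qfac q (q * u)"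
proof (rule LIMSEQ_unique)
  show "(\<lambda>n. \<Prod>i\<le>Suc n. 1 - q ^ i * u) \<longlonglongrightarrow> qfac q u"
    by (rule LIMSEQ_Suc[OF qfac_LIMSEQ[OF assms]])
  have "(\<Prod>i\<le>Suc n. 1 - q ^ i * u) = (1 - u) * (\<Prod>i\<le>n. 1 - q ^ i * (q * u))" for n
    by (subst prod.atMost_Suc_shift) (simp add: mult_ac)
  then show "(\<lambda>n. \<Prod>i\<le>Suc n. 1 - q ^ i * u) \<longlonglongrightarrow> (1 - u) * qfac q (q * u)"
    using tendsto_mult_left[OF qfac_LIMSEQ[OF assms, of "q * u"], of "1 - u"] by simp
qed

lemma qfac_eq_0_iff: "norm q < 1 \<Longrightarrow> qfac q u = 0 \<longleftrightarrow> (\<exists>n. q ^ n * u = 1)"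
  using has_prod_eq_0_iff[OF qfac_has_prod, of q u] by (auto simp: image_iff)

text \<open>On the disc of radius 1 about x the n-th factor differs from 1 by at most |q|^n (|x| +
  1), so the products converge uniformly there.\<close>

lemma qfac_holomorphic:
  assumes "norm q < 1"
  shows "qfac q holomorphic_on UNIV"
proof (rule holomorphic_uniform_sequence)
  show "(\<lambda>u. \<Prod>i<n. 1 - q ^ i * u) holomorphic_on UNIV" for n
    by (intro holomorphic_intros)
  fix x :: complex
  let ?K = "cball x 1"
  have "uniformly_convergent_on ?K (\<lambda>N u. \<Sum>n<N. norm (1 - q ^ n * u - 1))"
  proof (rule Weierstrass_m_test')
    show "norm (norm (1 - q ^ n * u - 1)) \<le> norm q ^ n * (norm x + 1)" if "u \<in> ?K" for n u
    proof -
      have "norm u \<le> norm x + norm (u - x)" using norm_triangle_ineq[of x "u - x"] by simp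
      also have "\<dots> \<le> norm x + 1" using that by (simp add: dist_norm norm_minus_commute)
      finally show ?thesis by (simp add: norm_mult norm_power mult_left_mono)
    qed
    show "summable (\<lambda>n. norm q ^ n * (norm x + 1))"
      using assms by (intro summable_mult2 summable_geometric) simp
  qed
  then have "uniformly_convergent_on ?K (\<lambda>N u. \<Prod>n<N. 1 - q ^ n * u)"
    by (intro uniformly_convergent_on_prod') (auto intro!: continuous_intros)
  then obtain l where l: "uniform_limit ?K (\<lambda>N u. \<Prod>n<N. 1 - q ^ n * u) l sequentially"
    unfolding uniformly_convergent_on_def by blast
  have "l u = qfac q u" if "u \<in> ?K" for u
  proof (rule LIMSEQ_unique)
    show "(\<lambda>n. \<Prod>i<n. 1 - q ^ i * u) \<longlonglongrightarrow> l u"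
      using tendsto_uniform_limitI[OF l that] .
    show "(\<lambda>n. \<Prod>i<n. 1 - q ^ i * u) \<longlonglongrightarrow> qfac q u"
      using qfac_LIMSEQ[OF assms, of u] unfolding lessThan_Suc_atMost[symmetric]
      by (rule LIMSEQ_imp_Suc)
  qed
  then have "uniform_limit ?K (\<lambda>N u. \<Prod>n<N. 1 - q ^ n * u) (qfac q) sequentially"
    using l by (subst uniform_limit_cong'[where g = "\<lambda>N u. \<Prod>n<N. 1 - q ^ n * u" and i = l]) auto
  then show "\<exists>d>0. cball x d \<subseteq> UNIV \<and>
      uniform_limit (cball x d) (\<lambda>N u. \<Prod>n<N. 1 - q ^ n * u) (qfac q) sequentially"
    by (intro exI[of _ 1]) auto
qed auto

text \<open>Jacobi's theta function \<open>\<theta>\<^sub>1\<close> up to a constant factor, in its product form.\<close>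
definition jtheta :: "complex \<Rightarrow> complex \<Rightarrow> complex" where
  "jtheta \<tau> x = (let q = exp (2 * of_real pi * \<i> * \<tau>) in
     sin (of_real pi * x) * (qfac q (q * exp (2 * of_real pi * \<i> * x)) * qfac q (q * exp (- (2 * of_real pi * \<i> * x)))))"

lemma norm_nome: "Im \<tau> > 0 \<Longrightarrow> norm (exp (2 * of_real pi * \<i> * \<tau>)) < 1"
  by simp

lemma jtheta_holomorphic:
  assumes "Im \<tau> > 0"
  shows "jtheta \<tau> holomorphic_on UNIV"
proof -
  let ?q = "exp (2 * of_real pi * \<i> * \<tau>)"
  have *: "(\<lambda>x. qfac ?q (f x)) holomorphic_on UNIV" if "f holomorphic_on UNIV" for f
    using holomorphic_on_compose_gen[OF that qfac_holomorphic[OF norm_nome[OF assms]]]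
    by (simp add: o_def)
  show ?thesis unfolding jtheta_def Let_def
    by (intro holomorphic_on_mult * holomorphic_intros)
qed

lemma jtheta_minus: "jtheta \<tau> (- x) = - jtheta \<tau> x"
  by (simp add: jtheta_def Let_def mult.commute)

lemma jtheta_plus_1: "jtheta \<tau> (x + 1) = - jtheta \<tau> x"
proof -
  have "exp (2 * of_real pi * \<i> * (x + 1)) = exp (2 * of_real pi * \<i> * x)"
    using exp_plus_2pin[of "2 * of_real pi * \<i> * x" 1] by (simp add: algebra_simps)
  moreover have "exp (- (2 * of_real pi * \<i> * (x + 1))) = exp (- (2 * of_real pi * \<i> * x))"
    using exp_plus_2pin[of "- (2 * of_real pi * \<i> * x)" "-1"] by (simp add: algebra_simps)
  moreover have "sin (of_real pi * (x + 1)) = - sin (of_real pi * x)"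
    by (simp add: ring_distribs sin_add cos_of_real sin_of_real)
  ultimately show ?thesis by (simp add: jtheta_def Let_def)
qed

text \<open>In w = e^(2 pi i x) the step by \<tau> is w \<mapsto> q w. One product loses the factor
  1 - q w and the other gains 1 - 1/w; the sine, written with the square roots e of w and t of q,
  accounts for the rest.\<close>

lemma jtheta_plus_tau:
  assumes "Im \<tau> > 0"
  shows "jtheta \<tau> (x + \<tau>) = - exp (- (\<i> * of_real pi * \<tau>)) * exp (- (2 * of_real pi * \<i> * x)) * jtheta \<tau> x"
proof -
  define q where "q = exp (2 * of_real pi * \<i> * \<tau>)"
  define w where "w = exp (2 * of_real pi * \<i> * x)"
  define e where "e = exp (\<i> * of_real pi * x)"
  define t where "t = exp (\<i> * of_real pi * \<tau>)"
  have nz: "e \<noteq> 0" "t \<noteq> 0" by (auto simp: e_def t_def)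
  have w: "w = e ^ 2" and q: "q = t ^ 2"
    unfolding e_def t_def w_def q_def exp_double[symmetric] by (simp_all only: mult_ac)
  have q1: "norm q < 1" unfolding q_def using assms by (rule norm_nome)
  have iw: "exp (- (2 * of_real pi * \<i> * x)) = inverse w" by (simp add: w_def exp_minus)
  have wt: "exp (2 * of_real pi * \<i> * (x + \<tau>)) = q * w"
    by (simp add: q_def w_def exp_add[symmetric] algebra_simps)
  have iwt: "exp (- (2 * of_real pi * \<i> * (x + \<tau>))) = inverse (q * w)"
    unfolding wt[symmetric] by (simp add: exp_minus)
  have sin1: "sin (of_real pi * x) = (e - inverse e) / (2 * \<i>)"
    by (simp add: sin_exp_eq e_def exp_minus mult_ac)
  have sin2: "sin (of_real pi * (x + \<tau>)) = (e * t - inverse (e * t)) / (2 * \<i>)"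
  proof -
    have "e * t = exp (\<i> * of_real pi * (x + \<tau>))"
      by (simp add: e_def t_def exp_add[symmetric] algebra_simps)
    then show ?thesis by (simp add: sin_exp_eq exp_minus mult_ac)
  qed
  have "jtheta \<tau> (x + \<tau>) = (e * t - inverse (e * t)) / (2 * \<i>) *
      (qfac q (q * (q * w)) * qfac q (q * inverse (q * w)))"
    by (simp only: jtheta_def Let_def q_def[symmetric] wt iwt sin2)
  also have "q * inverse (q * w) = inverse w" using nz by (simp add: q w field_simps)
  also have "qfac q (inverse w) = (1 - inverse w) * qfac q (q * inverse w)"
    by (rule qfac_shift[OF q1])
  also have "(e * t - inverse (e * t)) / (2 * \<i>) *
      (qfac q (q * (q * w)) * ((1 - inverse w) * qfac q (q * inverse w))) =
      - inverse t * inverse w * ((e - inverse e) / (2 * \<i>) *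
       (((1 - q * w) * qfac q (q * (q * w))) * qfac q (q * inverse w)))"
  proof -
    define P Q where "P = qfac q (q * (q * w))" and "Q = qfac q (q * inverse w)"
    have key: "(e * t - inverse (e * t)) * (1 - inverse w) =
        - inverse t * inverse w * (e - inverse e) * (1 - q * w)"
      using nz by (simp add: q w field_simps power2_eq_square)
    have "(e * t - inverse (e * t)) / (2 * \<i>) * (P * ((1 - inverse w) * Q)) =
        ((e * t - inverse (e * t)) * (1 - inverse w)) * (P * Q / (2 * \<i>))"
      by (simp add: mult_ac)
    also have "\<dots> = - inverse t * inverse w * ((e - inverse e) / (2 * \<i>) * (((1 - q * w) * P) * Q))"
      unfolding key by (simp add: mult_ac)
    finally show ?thesis unfolding P_def Q_def .
  qed
  also have "(1 - q * w) * qfac q (q * (q * w)) = qfac q (q * w)"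
    by (rule qfac_shift[OF q1, symmetric])
  also have "(e - inverse e) / (2 * \<i>) * (qfac q (q * w) * qfac q (q * inverse w)) = jtheta \<tau> x"
    unfolding jtheta_def Let_def q_def[symmetric] iw w_def[symmetric] sin1 ..
  moreover have "exp (- (\<i> * of_real pi * \<tau>)) = inverse t" by (simp add: t_def exp_minus)
  ultimately show ?thesis by (simp only: iw)
qed

lemma jtheta_eq_0_iff:
  assumes "Im \<tau> > 0"
  shows "jtheta \<tau> x = 0 \<longleftrightarrow> (\<exists>m n. x = of_int m + of_int n * \<tau>)"
proof
  let ?q = "exp (2 * of_real pi * \<i> * \<tau>)"
  have exp1: "\<exists>m::int. y = of_int m" if y: "exp (2 * of_real pi * \<i> * y) = 1" for y
  proof -
    obtain m :: int where "2 * of_real pi * \<i> * y = of_int (2 * m) * of_real pi * \<i>"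
      using y exp_eq[of "2 * of_real pi * \<i> * y" 0] by auto
    then show ?thesis by auto
  qed
  assume "jtheta \<tau> x = 0"
  then consider "sin (of_real pi * x) = 0" | "qfac ?q (?q * exp (2 * of_real pi * \<i> * x)) = 0"
     | "qfac ?q (?q * exp (- (2 * of_real pi * \<i> * x))) = 0"
    by (auto simp: jtheta_def Let_def)
  then show "\<exists>m n. x = of_int m + of_int n * \<tau>"
  proof cases
    case 1
    then obtain n where "of_real pi * x = of_int n * of_real pi" by (auto simp: sin_eq_0)
    then show ?thesis by (intro exI[of _ n] exI[of _ 0]) auto
  next
    case 2
    then obtain n where "?q ^ n * (?q * exp (2 * of_real pi * \<i> * x)) = 1"
      using qfac_eq_0_iff[OF norm_nome[OF assms]] by blast
    then have "exp (2 * of_real pi * \<i> * (of_nat (Suc n) * \<tau> + x)) = 1"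
      by (simp add: exp_of_nat_mult[symmetric] exp_add[symmetric] algebra_simps)
    from exp1[OF this] obtain m :: int where "of_nat (Suc n) * \<tau> + x = of_int m" by blast
    then show ?thesis
      by (intro exI[of _ m] exI[of _ "- int (Suc n)"]) (simp add: algebra_simps)
  next
    case 3
    then obtain n where "?q ^ n * (?q * exp (- (2 * of_real pi * \<i> * x))) = 1"
      using qfac_eq_0_iff[OF norm_nome[OF assms]] by blast
    then have "exp (2 * of_real pi * \<i> * (of_nat (Suc n) * \<tau> - x)) = 1"
      by (simp add: exp_of_nat_mult[symmetric] exp_add[symmetric] algebra_simps)
    from exp1[OF this] obtain m :: int where "of_nat (Suc n) * \<tau> - x = of_int m" by blast
    then show ?thesis
      by (intro exI[of _ "- m"] exI[of _ "int (Suc n)"]) (simp add: algebra_simps)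
  qed
next
  assume "\<exists>m n. x = of_int m + of_int n * \<tau>"
  then obtain m n where x: "x = 0 + of_int m + of_int n * \<tau>" by auto
  show "jtheta \<tau> x = 0" unfolding x
    by (rule lattice_invariant)
       (simp_all add: jtheta_plus_1 jtheta_plus_tau[OF assms] jtheta_def[of \<tau> 0])
qed

lemma jtheta_deriv_0:
  assumes "Im \<tau> > 0"
  shows "deriv (jtheta \<tau>) 0 \<noteq> 0"
proof -
  define q where "q = exp (2 * of_real pi * \<i> * \<tau>)"
  have q1: "norm q < 1" unfolding q_def using assms by (rule norm_nome)
  define F where "F = (\<lambda>x. qfac q (q * exp (2 * of_real pi * \<i> * x)) * qfac q (q * exp (- (2 * of_real pi * \<i> * x))))"
  have *: "(\<lambda>x. qfac q (f x)) holomorphic_on UNIV" if "f holomorphic_on UNIV" for f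
    using holomorphic_on_compose_gen[OF that qfac_holomorphic[OF q1]] by (simp add: o_def)
  have F: "F holomorphic_on UNIV"
    unfolding F_def by (intro holomorphic_on_mult * holomorphic_intros)
  have eq: "jtheta \<tau> = (\<lambda>x. sin (of_real pi * x) * F x)"
    by (simp add: fun_eq_iff jtheta_def Let_def F_def q_def)
  have "(jtheta \<tau> has_field_derivative of_real pi * F 0) (at 0)"
    unfolding eq using holomorphic_derivI[OF F, of 0]
    by (auto intro!: derivative_eq_intros)
  then have "deriv (jtheta \<tau>) 0 = of_real pi * F 0" by (rule DERIV_imp_deriv)
  moreover have "q ^ n * q \<noteq> 1" for n
  proof
    assume "q ^ n * q = 1"
    then have "norm q ^ Suc n = 1" by (metis norm_one norm_power power_Suc2)
    then show False using q1 power_Suc_less_one[of "norm q" n] by (cases "q = 0") auto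
  qed
  then have "F 0 \<noteq> 0" by (simp add: F_def qfac_eq_0_iff[OF q1])
  ultimately show ?thesis by simp
qed

text \<open>The product requires a positive imaginary part, so it is formed for \<alpha> or for
  -\<alpha>, which span the same lattice; for -\<alpha> the quasi-periodicity is solved for the
  opposite step. The exponent B is 2 pi i up to sign, and B \<noteq> 0 becomes the assumption
  \<open>legendre\<close> below.\<close>

lemma ex_theta:
  assumes "\<alpha> \<notin> \<real>"
  shows "\<exists>\<theta> A B. \<theta> holomorphic_on UNIV \<and> (\<forall>x. \<theta> (- x) = - \<theta> x) \<and> deriv \<theta> 0 = 1 \<and>
     (\<forall>x. \<theta> x = 0 \<longleftrightarrow> (\<exists>m n. x = of_int m + of_int n * \<alpha>)) \<and> (\<forall>x. \<theta> (x + 1) = - \<theta> x) \<and>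
     A \<noteq> 0 \<and> B \<noteq> 0 \<and> (\<forall>x. \<theta> (x + \<alpha>) = A * exp (B * x) * \<theta> x)"
proof -
  have im: "Im \<alpha> \<noteq> 0" using assms by (simp add: complex_is_Real_iff)
  define \<tau> where "\<tau> = (if Im \<alpha> > 0 then \<alpha> else - \<alpha>)"
  have \<tau>: "Im \<tau> > 0" using im by (auto simp: \<tau>_def)
  define k where "k = deriv (jtheta \<tau>) 0"
  have k: "k \<noteq> 0" unfolding k_def by (rule jtheta_deriv_0[OF \<tau>])
  define \<theta> where "\<theta> = (\<lambda>x. jtheta \<tau> x / k)"
  have hol: "\<theta> holomorphic_on UNIV"
    unfolding \<theta>_def by (intro holomorphic_intros jtheta_holomorphic \<tau> k)
  have "(jtheta \<tau> has_field_derivative k) (at 0)"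
    unfolding k_def using jtheta_holomorphic[OF \<tau>] by (rule holomorphic_derivI) auto
  then have "(\<theta> has_field_derivative 1) (at 0)"
    unfolding \<theta>_def using k by (auto intro!: derivative_eq_intros)
  then have der: "deriv \<theta> 0 = 1" by (rule DERIV_imp_deriv)
  have zero: "\<theta> x = 0 \<longleftrightarrow> (\<exists>m n. x = of_int m + of_int n * \<alpha>)" for x
  proof -
    have "\<theta> x = 0 \<longleftrightarrow> (\<exists>m n. x = of_int m + of_int n * \<tau>)"
      using k jtheta_eq_0_iff[OF \<tau>] by (simp add: \<theta>_def)
    also have "\<dots> \<longleftrightarrow> (\<exists>m n. x = of_int m + of_int n * \<alpha>)"
    proof (cases "Im \<alpha> > 0")
      case False
      have "(\<exists>n. x = of_int m + of_int n * - \<alpha>) \<longleftrightarrow> (\<exists>n. x = of_int m + of_int n * \<alpha>)" for m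
        by (metis minus_mult_commute of_int_minus minus_minus)
      then show ?thesis using False by (simp add: \<tau>_def)
    qed (simp add: \<tau>_def)
    finally show ?thesis .
  qed
  have "\<exists>A B. A \<noteq> 0 \<and> B \<noteq> 0 \<and> (\<forall>x. \<theta> (x + \<alpha>) = A * exp (B * x) * \<theta> x)"
  proof (cases "Im \<alpha> > 0")
    case True
    then have "\<tau> = \<alpha>" by (simp add: \<tau>_def)
    then show ?thesis using jtheta_plus_tau[OF \<tau>]
      by (intro exI[of _ "- exp (- (\<i> * of_real pi * \<tau>))"] exI[of _ "- (2 * of_real pi * \<i>)"]) (simp add: \<theta>_def)
  next
    case False
    then have \<alpha>: "\<alpha> = - \<tau>" by (simp add: \<tau>_def)
    have "\<theta> (x + \<alpha>) = - exp (- (\<i> * of_real pi * \<tau>)) * exp (2 * of_real pi * \<i> * x) * \<theta> x" for x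
    proof -
      have "jtheta \<tau> x = - exp (- (\<i> * of_real pi * \<tau>)) * exp (- (2 * of_real pi * \<i> * (x - \<tau>))) * jtheta \<tau> (x - \<tau>)"
        using jtheta_plus_tau[OF \<tau>, of "x - \<tau>"] by simp
      moreover have "exp (- (\<i> * of_real pi * \<tau>)) * exp (- (2 * of_real pi * \<i> * (x - \<tau>))) =
          inverse (exp (- (\<i> * of_real pi * \<tau>)) * exp (2 * of_real pi * \<i> * x))"
        unfolding exp_add[symmetric] exp_minus[symmetric] by (simp add: algebra_simps)
      ultimately have "jtheta \<tau> x =
          - inverse (exp (- (\<i> * of_real pi * \<tau>)) * exp (2 * of_real pi * \<i> * x)) * jtheta \<tau> (x - \<tau>)"
        by (simp only: mult_minus_left)
      moreover have "v = - (E * F) * u" if "u = - inverse (E * F) * v" "E \<noteq> 0" "F \<noteq> 0" for u v E F :: complex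
        using that by (simp add: field_simps)
      ultimately have "jtheta \<tau> (x - \<tau>) =
          - (exp (- (\<i> * of_real pi * \<tau>)) * exp (2 * of_real pi * \<i> * x)) * jtheta \<tau> x"
        by (metis exp_not_eq_zero)
      then show ?thesis by (simp add: \<alpha> \<theta>_def)
    qed
    then show ?thesis
      by (intro exI[of _ "- exp (- (\<i> * of_real pi * \<tau>))"] exI[of _ "2 * of_real pi * \<i>"]) simp
  qed
  moreover have "\<theta> (- x) = - \<theta> x" "\<theta> (x + 1) = - \<theta> x" for x
    by (simp_all add: \<theta>_def jtheta_minus jtheta_plus_1)
  ultimately show ?thesis using hol der zero by blast
qed

text \<open>A nicely meromorphic function takes its limit off the poles and 0 at them, so its class
  determines all values.\<close>

lemma nicely_meromorphic_eqI:
  assumes "f nicely_meromorphic_on UNIV" "g nicely_meromorphic_on UNIV" "\<forall>\<^sub>\<approx>x\<in>UNIV. f x = g x"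
  shows "f = g"
proof
  fix z
  have ev: "eventually (\<lambda>x. f x = g x) (at z)" using assms(3) by (simp add: eventually_cosparse_open_eq)
  have pole: "is_pole f z \<longleftrightarrow> is_pole g z"
    using is_pole_cong[OF ev refl] .
  show "f z = g z"
  proof (cases "is_pole f z")
    case True
    then have "\<not> f \<midarrow>z\<rightarrow> f z" "\<not> g \<midarrow>z\<rightarrow> g z"
      using pole not_tendsto_and_filterlim_at_infinity[of "at z"] by (auto simp: is_pole_def)
    then show ?thesis using assms(1,2) unfolding nicely_meromorphic_on_def by (metis UNIV_I)
  next
    case False
    then have "f \<midarrow>z\<rightarrow> f z" "g \<midarrow>z\<rightarrow> g z"
      using assms(1,2) pole unfolding nicely_meromorphic_on_def by auto
    then show ?thesis using LIM_unique tendsto_cong[OF ev] by metis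
  qed
qed

lemma entire_nonzero_cosparse:
  assumes "f holomorphic_on UNIV" "deriv f 0 \<noteq> 0"
  shows "\<forall>\<^sub>\<approx>x\<in>UNIV. f x \<noteq> 0"
proof -
  have "\<not> z islimpt {x. f x = 0}" for z
  proof
    assume "z islimpt {x. f x = 0}"
    then have "f w = 0" for w
      by (rule analytic_continuation[OF assms(1), rotated 4]) auto
    then have "f = (\<lambda>_. 0)" by blast
    then have "deriv f 0 = 0" by simp
    then show False using assms(2) by simp
  qed
  then have "{x. f x = 0} sparse_in UNIV" by (simp add: sparse_in_open)
  then show ?thesis by (simp add: eventually_cosparse)
qed

text \<open>\<open>\<sigma>\<close> is determined by its zeros and its quasi-periodicity up to factors \<open>exp (k x\<^sup>2 / 2)\<close>; the last assumption
  fixes \<open>k\<close> such that the constant term of \<open>\<wp>\<close> vanishes.\<close>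
locale lattice_sigma =
  fixes \<alpha> :: complex and \<sigma> :: "complex \<Rightarrow> complex" and A1 B1 A2 B2 :: complex and G :: "complex \<Rightarrow> complex"
  assumes nonreal: "\<alpha> \<notin> \<real>"
    and hol: "\<sigma> holomorphic_on UNIV"
    and odd: "\<sigma> (- x) = - \<sigma> x"
    and zeros: "\<sigma> x = 0 \<longleftrightarrow> (\<exists>m n. x = of_int m + of_int n * \<alpha>)"
    and plus_1: "\<sigma> (x + 1) = A1 * exp (B1 * x) * \<sigma> x"
    and plus_\<alpha>: "\<sigma> (x + \<alpha>) = A2 * exp (B2 * x) * \<sigma> x"
    and nonzero: "A1 \<noteq> 0" "A2 \<noteq> 0" and legendre: "B2 \<noteq> \<alpha> * B1"
    and G: "G holomorphic_on UNIV" "\<sigma> x = x * G x" "G 0 = 1"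
    and G2: "deriv (deriv G) 0 = deriv G 0 ^ 2"
begin

lemma im_nonzero: "Im \<alpha> \<noteq> 0"
  using nonreal by (simp add: complex_is_Real_iff)

definition lat :: "complex set" where
  "lat = {x. \<sigma> x = 0}"

lemma \<sigma>_has_deriv: "(\<sigma> has_field_derivative deriv \<sigma> x) (at x)"
  using hol holomorphic_derivI by blast

lemma hol': "deriv \<sigma> holomorphic_on UNIV" and hol'': "deriv (deriv \<sigma>) holomorphic_on UNIV"
  using hol by (simp_all add: holomorphic_deriv)

lemma \<sigma>'_has_deriv: "(deriv \<sigma> has_field_derivative deriv (deriv \<sigma>) x) (at x)"
  using hol' holomorphic_derivI by blast

lemma deriv_quasi:
  assumes "\<And>x. \<sigma> (x + c) = A * exp (B * x) * \<sigma> x"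
  shows "deriv \<sigma> (x + c) = A * exp (B * x) * (deriv \<sigma> x + B * \<sigma> x)"
proof -
  have "deriv \<sigma> (x + c) = deriv (\<lambda>x. \<sigma> (x + c)) x" by (simp add: deriv_translate[OF hol])
  also have "\<dots> = deriv (\<lambda>x. A * exp (B * x) * \<sigma> x) x" by (simp add: assms)
  also have "\<dots> = A * exp (B * x) * (deriv \<sigma> x + B * \<sigma> x)"
    by (rule DERIV_imp_deriv) (auto intro!: derivative_eq_intros \<sigma>_has_deriv simp: algebra_simps)
  finally show ?thesis .
qed

lemma G_has_deriv: "(G has_field_derivative deriv G x) (at x)"
    and G'_has_deriv: "(deriv G has_field_derivative deriv (deriv G) x) (at x)"
  using G(1) holomorphic_derivI holomorphic_deriv by blast+

lemma deriv_\<sigma>_G: "deriv \<sigma> x = G x + x * deriv G x"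
proof -
  have "\<sigma> = (\<lambda>x. x * G x)" using G(2) by blast
  then have "(\<sigma> has_field_derivative G x + x * deriv G x) (at x)"
    by (auto intro!: derivative_eq_intros G_has_deriv)
  then show ?thesis by (rule DERIV_imp_deriv)
qed

lemma deriv2_\<sigma>_G: "deriv (deriv \<sigma>) x = 2 * deriv G x + x * deriv (deriv G) x"
proof -
  have "deriv \<sigma> = (\<lambda>x. G x + x * deriv G x)" using deriv_\<sigma>_G by blast
  then have "(deriv \<sigma> has_field_derivative 2 * deriv G x + x * deriv (deriv G) x) (at x)"
    by (auto intro!: derivative_eq_intros G_has_deriv G'_has_deriv)
  then show ?thesis by (rule DERIV_imp_deriv)
qed

lemma \<sigma>_0: "\<sigma> 0 = 0" and deriv_\<sigma>_0: "deriv \<sigma> 0 = 1"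
  using G(2,3) deriv_\<sigma>_G by auto

text \<open>The zero at 0 is simple, and quasi-periodicity carries this to every lattice
  point.\<close>

lemma deriv_\<sigma>_nonzero:
  assumes "x \<in> lat"
  shows "deriv \<sigma> x \<noteq> 0"
proof -
  obtain m n where x: "x = 0 + of_int m + of_int n * \<alpha>" using assms zeros by (auto simp: lat_def)
  have "\<sigma> x = 0 \<and> deriv \<sigma> x \<noteq> 0" unfolding x
    by (rule lattice_invariant)
       (auto simp: plus_1 plus_\<alpha> deriv_quasi[OF plus_1] deriv_quasi[OF plus_\<alpha>] nonzero \<sigma>_0 deriv_\<sigma>_0)
  then show ?thesis by blast
qed

lemma \<sigma>_cosparse: "\<forall>\<^sub>\<approx>x\<in>UNIV. \<sigma> x \<noteq> 0"
  by (rule entire_nonzero_cosparse[OF hol]) (simp add: deriv_\<sigma>_0)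

lemma lat_sparse: "lat sparse_in UNIV"
  using \<sigma>_cosparse by (simp add: eventually_cosparse lat_def)

lemma closed_lat: "closed lat"
  using lat_sparse by (rule sparse_in_UNIV_imp_closed)

lemma connected_compl_lat: "connected (- lat)"
proof -
  have "connected (UNIV - lat)"
    by (rule sparse_imp_connected) (use lat_sparse in auto)
  then show ?thesis by (simp add: Compl_eq_Diff_UNIV)
qed

text \<open>Division by zero makes both functions vanish at their poles.\<close>

definition Z :: "complex \<Rightarrow> complex" where
  "Z x = - (deriv \<sigma> x / \<sigma> x)"

definition P :: "complex \<Rightarrow> complex" where
  "P x = (deriv \<sigma> x ^ 2 - \<sigma> x * deriv (deriv \<sigma>) x) / \<sigma> x ^ 2"

lemma Z_has_deriv:
  assumes "x \<notin> lat"
  shows "(Z has_field_derivative P x) (at x)"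
proof -
  have "((\<lambda>x. - (deriv \<sigma> x / \<sigma> x)) has_field_derivative P x) (at x)"
    using assms unfolding P_def lat_def
    by (auto intro!: derivative_eq_intros \<sigma>_has_deriv \<sigma>'_has_deriv simp: field_simps power2_eq_square)
  then show ?thesis by (simp add: Z_def[abs_def])
qed

lemma P_analytic: "x \<notin> lat \<Longrightarrow> P analytic_on {x}" and Z_analytic: "x \<notin> lat \<Longrightarrow> Z analytic_on {x}"
proof -
  assume x: "x \<notin> lat"
  have *: "P holomorphic_on - lat" "Z holomorphic_on - lat"
    unfolding P_def[abs_def] Z_def[abs_def] lat_def
    by (auto intro!: holomorphic_intros holomorphic_on_subset[OF hol] holomorphic_on_subset[OF hol']
       holomorphic_on_subset[OF hol''])
  have "open (- lat)" using closed_lat by (simp add: open_Compl)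
  with * x show "P analytic_on {x}" "Z analytic_on {x}"
    using analytic_at by blast+
qed

lemma P_meromorphic: "P meromorphic_on UNIV" and Z_meromorphic: "Z meromorphic_on UNIV"
  unfolding P_def[abs_def] Z_def[abs_def]
  by (intro meromorphic_intros analytic_on_imp_meromorphic_on; simp add: analytic_on_open hol hol' hol'')+

lemma poles:
  assumes "x \<in> lat"
  shows "is_pole P x" "is_pole Z x"
proof -
  have t: "\<sigma> \<midarrow>x\<rightarrow> 0" "deriv \<sigma> \<midarrow>x\<rightarrow> deriv \<sigma> x" "deriv (deriv \<sigma>) \<midarrow>x\<rightarrow> deriv (deriv \<sigma>) x"
    using assms holomorphic_UNIV_isCont[OF hol, of x] holomorphic_UNIV_isCont[OF hol', of x]
      holomorphic_UNIV_isCont[OF hol'', of x] by (auto simp: isCont_def lat_def)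
  have ev: "eventually (\<lambda>x. \<sigma> x \<noteq> 0) (at x)"
    using \<sigma>_cosparse by (simp add: eventually_cosparse_open_eq)
  have f: "filterlim \<sigma> (at 0) (at x)" using t(1) ev by (simp add: filterlim_at)
  have "((\<lambda>x. \<sigma> x ^ 2) \<longlongrightarrow> 0) (at x)" using tendsto_power[OF t(1), of 2] by simp
  then have f2: "filterlim (\<lambda>x. \<sigma> x ^ 2) (at 0) (at x)" using ev by (simp add: filterlim_at)
  show "is_pole Z x" unfolding is_pole_def Z_def
    unfolding minus_divide_left
    by (intro filterlim_divide_at_infinity[OF tendsto_minus[OF t(2)] f])
       (use deriv_\<sigma>_nonzero[OF assms] in auto)
  have t3: "((\<lambda>x. deriv \<sigma> x ^ 2 - \<sigma> x * deriv (deriv \<sigma>) x) \<longlongrightarrow> deriv \<sigma> x ^ 2 - 0 * deriv (deriv \<sigma>) x) (at x)"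
    by (intro tendsto_intros t)
  show "is_pole P x" unfolding is_pole_def P_def
    by (intro filterlim_divide_at_infinity[OF t3 f2]) (use deriv_\<sigma>_nonzero[OF assms] in auto)
qed

lemma is_pole_iff: "is_pole P x \<longleftrightarrow> x \<in> lat" "is_pole Z x \<longleftrightarrow> x \<in> lat"
  using poles P_analytic Z_analytic analytic_at_imp_no_pole by blast+

lemma P_nice: "P nicely_meromorphic_on UNIV" and Z_nice: "Z nicely_meromorphic_on UNIV"
proof -
  have "is_pole P z \<and> P z = 0 \<or> P \<midarrow>z\<rightarrow> P z" for z
    using poles(1)[of z] P_analytic[of z] analytic_at_imp_isCont[of P z]
    by (cases "z \<in> lat") (auto simp: isCont_def P_def lat_def)
  then show "P nicely_meromorphic_on UNIV" using P_meromorphic by (simp add: nicely_meromorphic_on_def)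
  have "is_pole Z z \<and> Z z = 0 \<or> Z \<midarrow>z\<rightarrow> Z z" for z
    using poles(2)[of z] Z_analytic[of z] analytic_at_imp_isCont[of Z z]
    by (cases "z \<in> lat") (auto simp: isCont_def Z_def lat_def)
  then show "Z nicely_meromorphic_on UNIV" using Z_meromorphic by (simp add: nicely_meromorphic_on_def)
qed

text \<open>The logarithmic derivative of the quasi-periodicity; the sign comes from Z =
  -\<sigma>'/\<sigma>.\<close>

lemma Z_quasi:
  assumes "\<And>x. \<sigma> (x + c) = A * exp (B * x) * \<sigma> x" "A \<noteq> 0" "x \<notin> lat"
  shows "Z (x + c) = Z x - B"
  using assms(2,3) unfolding Z_def deriv_quasi[OF assms(1)] assms(1) lat_def by (simp add: field_simps)

lemma P_periodic:
  assumes "\<And>x. \<sigma> (x + c) = A * exp (B * x) * \<sigma> x" "A \<noteq> 0"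
  shows "P (x + c) = P x"
proof (cases "x \<in> lat")
  case True
  then show ?thesis by (simp add: P_def lat_def assms(1))
next
  case False
  then have "x + c \<notin> lat" using assms by (simp add: lat_def)
  then have "((\<lambda>x. Z (x + c)) has_field_derivative P (x + c)) (at x)"
    using Z_has_deriv[of "x + c"] by (simp add: DERIV_shift)
  moreover have "((\<lambda>x. Z (x + c)) has_field_derivative P x) (at x)"
  proof (rule has_field_derivative_transform_within_open)
    show "((\<lambda>x. Z x - B) has_field_derivative P x) (at x)"
      using Z_has_deriv[OF False] by (auto intro!: derivative_eq_intros)
    show "open (- lat)" using closed_lat by (simp add: open_Compl)
  qed (use False Z_quasi[OF assms] in auto)
  ultimately show ?thesis by (rule DERIV_unique)
qed

lemmas P_plus_1 = P_periodic[OF plus_1 nonzero(1)] and P_plus_\<alpha> = P_periodic[OF plus_\<alpha> nonzero(2)]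

lemma Z_odd: "Z (- x) = - Z x"
proof -
  have "((\<lambda>x. \<sigma> (- x)) has_field_derivative deriv \<sigma> (- x) * - 1) (at x)"
    by (rule DERIV_chain2[OF \<sigma>_has_deriv]) (auto intro!: derivative_eq_intros)
  moreover have "((\<lambda>x. \<sigma> (- x)) has_field_derivative - deriv \<sigma> x) (at x)"
    unfolding odd by (auto intro!: derivative_eq_intros \<sigma>_has_deriv)
  ultimately have "deriv \<sigma> (- x) * - 1 = - deriv \<sigma> x" by (rule DERIV_unique)
  then show ?thesis by (simp add: Z_def odd)
qed

definition U :: "complex set" where "U = {x. G x \<noteq> 0}"

lemma open_U: "open U" and zero_U: "0 \<in> U"
proof -
  have "open (G -` (- {0}))" using holomorphic_on_imp_continuous_on[OF G(1)]
    by (intro open_vimage) auto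
  then show "open U" by (simp add: U_def vimage_def)
  show "0 \<in> U" by (simp add: U_def G(3))
qed

text \<open>D is -(log G)'', the regular part of \<open>P\<close> at 0. The assumption
  \<open>G2\<close> says that it vanishes at 0, as the O(x) in the description of \<wp>
  demands.\<close>

definition D :: "complex \<Rightarrow> complex" where
  "D x = (deriv G x ^ 2 - G x * deriv (deriv G) x) / G x ^ 2"

lemma P_expansion:
  assumes "x \<in> U" "x \<noteq> 0"
  shows "P x = 1 / x ^ 2 + D x"
  using assms unfolding P_def D_def deriv_\<sigma>_G deriv2_\<sigma>_G G(2) U_def
  by (simp add: field_simps power2_eq_square)

lemma D_holomorphic: "D holomorphic_on U"
  unfolding D_def[abs_def] U_def
  by (intro holomorphic_intros holomorphic_on_subset[OF G(1)]
      holomorphic_on_subset[OF holomorphic_deriv[OF G(1) open_UNIV]]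
      holomorphic_on_subset[OF holomorphic_deriv[OF holomorphic_deriv[OF G(1) open_UNIV] open_UNIV]]) auto

lemma D_0: "D 0 = 0"
  by (simp add: D_def G(3) G2)

lemma P_bigo: "(\<lambda>x. P x - 1 / x ^ 2) \<in> O[at 0](\<lambda>x. x)"
proof -
  have "(D has_field_derivative deriv D 0) (at 0)"
    using D_holomorphic open_U zero_U by (rule holomorphic_derivI)
  then have "((\<lambda>x. D x / x) \<longlongrightarrow> deriv D 0) (at 0)"
    by (simp add: has_field_derivative_iff D_0)
  then have "D \<in> O[at 0](\<lambda>x. x)"
    by (intro bigoI_tendsto) (auto simp: eventually_at_filter)
  have "eventually (\<lambda>x. P x - 1 / x ^ 2 = D x) (at 0)"
    using eventually_at_in_open[OF open_U zero_U] by eventually_elim (simp add: P_expansion)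
  from landau_o.big.in_cong[OF this, of "\<lambda>x. x"] \<open>D \<in> O[at 0](\<lambda>x. x)\<close>
  show ?thesis by blast
qed

lemma P_zorder: "zorder P 0 = -2"
proof (rule zorder_eqI)
  define g where "g = (\<lambda>x. 1 + x ^ 2 * D x)"
  show "open U" "0 \<in> U" by (rule open_U zero_U)+
  show "g holomorphic_on U" unfolding g_def by (intro holomorphic_intros D_holomorphic)
  show "g 0 \<noteq> 0" by (simp add: g_def)
  show "P w = g w * (w - 0) powi - 2" if "w \<in> U" "w \<noteq> 0" for w
  proof -
    have "(w - 0) powi - 2 = inverse (w ^ 2)" by (simp add: power_int_minus)
    moreover have "1 / w ^ 2 + D w = (1 + w ^ 2 * D w) * inverse (w ^ 2)"
    proof -
      have "w ^ 2 * D w * inverse (w ^ 2) = D w" using that(2) by simp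
      then show ?thesis by (simp only: divide_inverse distrib_right mult_1)
    qed
    ultimately show ?thesis by (simp only: P_expansion[OF that] g_def)
  qed
qed

lemma lat_iff: "x \<in> lat \<longleftrightarrow> (\<exists>m n. x = of_int m + of_int n * \<alpha>)"
  using zeros by (simp add: lat_def)

section \<open>The period parallelogram\<close>

definition cell :: "complex set" where
  "cell = convex hull {1/2 + \<alpha>/2, 1/2 - \<alpha>/2, -1/2 + \<alpha>/2, -1/2 - \<alpha>/2}"

lemma cell_bounds:
  assumes "x \<in> cell"
  shows "\<exists>s t. \<bar>s\<bar> \<le> 1/2 \<and> \<bar>t\<bar> \<le> 1/2 \<and> x = of_real s + of_real t * \<alpha>"
proof -
  define C where "C = (\<lambda>(s, t). complex_of_real s + complex_of_real t * \<alpha>) ` ({-1/2..1/2} \<times> {-1/2..1/2})"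
  have lin: "linear (\<lambda>(s, t). complex_of_real s + complex_of_real t * \<alpha>)"
    by (rule linearI) (auto simp: algebra_simps scaleR_conv_of_real)
  have "convex C" unfolding C_def
    by (intro convex_linear_image lin convex_Times is_interval_convex is_interval_cc)
  moreover have "{1/2 + \<alpha>/2, 1/2 - \<alpha>/2, -1/2 + \<alpha>/2, -1/2 - \<alpha>/2} \<subseteq> C"
  proof -
    have "1/2 + \<alpha>/2 \<in> C" unfolding C_def by (intro image_eqI[of _ _ "(1/2, 1/2)"]) auto
    moreover have "1/2 - \<alpha>/2 \<in> C" unfolding C_def by (intro image_eqI[of _ _ "(1/2, -1/2)"]) auto
    moreover have "-1/2 + \<alpha>/2 \<in> C" unfolding C_def by (intro image_eqI[of _ _ "(-1/2, 1/2)"]) auto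
    moreover have "-1/2 - \<alpha>/2 \<in> C" unfolding C_def by (intro image_eqI[of _ _ "(-1/2, -1/2)"]) auto
    ultimately show ?thesis by blast
  qed
  ultimately have "cell \<subseteq> C" unfolding cell_def by (rule hull_minimal[rotated])
  then have "x \<in> C" using assms by blast
  then obtain p where "p \<in> {-1/2..1/2} \<times> {-1/2..1/2}"
      "x = (\<lambda>(s, t). complex_of_real s + complex_of_real t * \<alpha>) p"
    unfolding C_def by (auto elim!: imageE)
  then show ?thesis
    by (intro exI[of _ "fst p"] exI[of _ "snd p"]) (auto simp: case_prod_unfold abs_le_iff mem_Times_iff)
qed

lemma cell_lat: "x \<in> cell \<Longrightarrow> x \<in> lat \<longleftrightarrow> x = 0"
proof
  assume "x \<in> cell" "x \<in> lat"
  then obtain s t m n where st: "\<bar>s\<bar> \<le> 1/2" "\<bar>t\<bar> \<le> 1/2" "x = of_real s + of_real t * \<alpha>"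
    and mn: "x = of_int m + of_int n * \<alpha>"
    using cell_bounds lat_iff by metis
  then have "of_real s + of_real t * \<alpha> = of_int m + of_int n * \<alpha>" by simp
  then have "t * Im \<alpha> = of_int n * Im \<alpha>" "s + t * Re \<alpha> = of_int m + of_int n * Re \<alpha>"
    by (auto simp: complex_eq_iff)
  then have "t = of_int n" "s = of_int m" using im_nonzero by auto
  then have "n = 0" "m = 0" using st by auto
  then show "x = 0" using mn by simp
next
  assume "x = 0"
  then show "x \<in> lat" by (simp add: lat_def \<sigma>_0)
qed

lemma cell_reduce: "\<exists>y\<in>cell. \<exists>m n. x = y + of_int m + of_int n * \<alpha>"
proof -
  define t where "t = Im x / Im \<alpha>"
  define s where "s = Re x - t * Re \<alpha>"
  have x: "x = complex_of_real s + complex_of_real t * \<alpha>"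
    using im_nonzero by (simp add: complex_eq_iff s_def t_def)
  define s' t' where "s' = s - of_int (round s)" and "t' = t - of_int (round t)"
  have b: "\<bar>s'\<bar> \<le> 1/2" "\<bar>t'\<bar> \<le> 1/2"
    using of_int_round_abs_le[of s] of_int_round_abs_le[of t] by (auto simp: s'_def t'_def abs_minus_commute)
  define y where "y = complex_of_real s' + complex_of_real t' * \<alpha>"
  have cv: "convex cell" unfolding cell_def by (rule convex_convex_hull)
  have v: "1/2 + \<alpha>/2 \<in> cell" "1/2 - \<alpha>/2 \<in> cell" "-1/2 + \<alpha>/2 \<in> cell" "-1/2 - \<alpha>/2 \<in> cell"
    unfolding cell_def by (auto intro: hull_inc)
  have comb: "(1/2 - r) *\<^sub>R u + (1/2 + r) *\<^sub>R w \<in> cell" if "\<bar>r\<bar> \<le> 1/2" "u \<in> cell" "w \<in> cell" for r u w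
    using that by (intro convexD[OF cv]) (auto simp: abs_le_iff)
  \<comment> \<open>A bilinear combination of the four vertices: first along \<alpha> on two
    opposite sides, then between these.\<close>
  have "(1/2 - s') *\<^sub>R ((1/2 - t') *\<^sub>R (-1/2 - \<alpha>/2) + (1/2 + t') *\<^sub>R (-1/2 + \<alpha>/2)) +
     (1/2 + s') *\<^sub>R ((1/2 - t') *\<^sub>R (1/2 - \<alpha>/2) + (1/2 + t') *\<^sub>R (1/2 + \<alpha>/2)) \<in> cell"
    by (intro comb b v)
  also have "(1/2 - s') *\<^sub>R ((1/2 - t') *\<^sub>R (-1/2 - \<alpha>/2) + (1/2 + t') *\<^sub>R (-1/2 + \<alpha>/2)) +
     (1/2 + s') *\<^sub>R ((1/2 - t') *\<^sub>R (1/2 - \<alpha>/2) + (1/2 + t') *\<^sub>R (1/2 + \<alpha>/2)) = y"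
    by (simp add: y_def complex_eq_iff algebra_simps)
  finally have "y \<in> cell" .
  moreover have "x = y + of_int (round s) + of_int (round t) * \<alpha>"
    unfolding x y_def s'_def t'_def by (simp add: algebra_simps)
  ultimately show ?thesis by blast
qed

text \<open>The description inside \<open>weierstrass_p\<close>, repeated literally so that the
  definition can be folded with it.\<close>

definition p_spec :: "(complex \<Rightarrow> complex) \<Rightarrow> bool" where
  "p_spec Q \<longleftrightarrow> Q nicely_meromorphic_on UNIV \<and> elliptic \<alpha> Q \<and>
     (\<forall>z \<in> convex hull {1/2 + \<alpha>/2, 1/2 - \<alpha>/2, -1/2 + \<alpha>/2, -1/2 - \<alpha>/2}.
        is_pole Q z \<longleftrightarrow> z = 0) \<and>
     zorder Q 0 = -2 \<and>
     (\<lambda>x. Q x - 1 / x ^ 2) \<in> O[at 0](\<lambda>x. x)"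

lemma P_spec: "p_spec P"
  unfolding p_spec_def elliptic_def
  using P_nice P_meromorphic P_plus_1 P_plus_\<alpha> is_pole_iff(1) cell_lat P_zorder P_bigo
  by (auto simp: cell_def)

lemma is_pole_periodic:
  assumes "\<forall>\<^sub>\<approx>x\<in>UNIV. f (x + c) = f x"
  shows "is_pole f (x + c) \<longleftrightarrow> is_pole f (x :: complex)"
proof -
  have "eventually (\<lambda>y. f (y + c) = f y) (at x)"
    using assms by (simp add: eventually_cosparse_open_eq)
  then have "is_pole (\<lambda>y. f (y + c)) x \<longleftrightarrow> is_pole f x" by (rule is_pole_cong) simp
  moreover have "is_pole (\<lambda>y. f (y + c)) x \<longleftrightarrow> is_pole f (x + c)"
    using is_pole_shift_iff[of f c x] by (simp add: o_def add.commute)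
  ultimately show ?thesis by simp
qed

lemma tendsto_periodic:
  fixes f :: "complex \<Rightarrow> complex"
  assumes "\<forall>\<^sub>\<approx>x\<in>UNIV. f (x + c) = f x"
  shows "f \<midarrow>x\<rightarrow> L \<longleftrightarrow> f \<midarrow>x + c\<rightarrow> L"
proof -
  have "eventually (\<lambda>y. f (y + c) = f y) (at x)"
    using assms by (simp add: eventually_cosparse_open_eq)
  then have "f \<midarrow>x\<rightarrow> L \<longleftrightarrow> (\<lambda>y. f (y + c)) \<midarrow>x\<rightarrow> L" by (rule tendsto_cong[symmetric])
  also have "\<dots> \<longleftrightarrow> f \<midarrow>x + c\<rightarrow> L"
    using filterlim_shift_iff[of f c "nhds L" "x + c"] by (simp add: o_def add.commute)
  finally show ?thesis .
qed

text \<open>All poles lie on the lattice, and there Q - P tends to 0: at the origin by the O(x)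
  condition, elsewhere by periodicity. So the difference extends to an entire doubly periodic
  function, that is a constant, which is 0.\<close>

lemma p_spec_unique:
  assumes "p_spec Q"
  shows "Q = P"
proof -
  have Q: "Q nicely_meromorphic_on UNIV" "Q meromorphic_on UNIV"
     "\<forall>\<^sub>\<approx>x\<in>UNIV. Q (x + 1) = Q x" "\<forall>\<^sub>\<approx>x\<in>UNIV. Q (x + \<alpha>) = Q x"
     "\<And>z. z \<in> cell \<Longrightarrow> is_pole Q z \<longleftrightarrow> z = 0"
     "(\<lambda>x. Q x - 1 / x ^ 2) \<in> O[at 0](\<lambda>x. x)"
    using assms unfolding p_spec_def elliptic_def cell_def by auto
  have pole: "x \<in> lat" if x: "is_pole Q x" for x
  proof -
    obtain y m n where y: "y \<in> cell" "x = y + of_int m + of_int n * \<alpha>" using cell_reduce by blast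
    have "is_pole Q (x + of_int (- m) + of_int (- n) * \<alpha>)"
      by (rule lattice_invariant[of "is_pole Q", OF is_pole_periodic[OF Q(3), symmetric]
            is_pole_periodic[OF Q(4), symmetric] x])
    then have "y = 0" using Q(5)[OF y(1)] y(2) by simp
    then show ?thesis using y(2) lat_iff by auto
  qed
  define d where "d = (\<lambda>x. Q x - P x)"
  have mer: "d meromorphic_on UNIV"
    unfolding d_def by (intro meromorphic_intros Q P_meromorphic)
  have per: "\<forall>\<^sub>\<approx>x\<in>UNIV. d (x + 1) = d x" "\<forall>\<^sub>\<approx>x\<in>UNIV. d (x + \<alpha>) = d x"
    using Q(3,4) unfolding d_def P_plus_1 P_plus_\<alpha> by (auto elim: eventually_mono)
  have "d \<midarrow>0\<rightarrow> 0"
  proof -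
    have "(\<lambda>x. (Q x - 1 / x ^ 2) - (P x - 1 / x ^ 2)) \<in> O[at 0](\<lambda>x. x)"
      by (intro sum_in_bigo Q(6) P_bigo)
    then have "d \<in> O[at 0](\<lambda>x. x)" by (simp add: d_def)
    then obtain C where "eventually (\<lambda>x. norm (d x) \<le> C * norm x) (at 0)"
      by (auto elim: landau_o.bigE)
    moreover have "((\<lambda>x. C * norm x) \<longlongrightarrow> 0) (at (0 :: complex))"
      by (auto intro!: tendsto_eq_intros)
    ultimately show ?thesis by (rule Lim_null_comparison)
  qed
  then have lat0: "d \<midarrow>z\<rightarrow> 0" if z: "z \<in> lat" for z
  proof -
    obtain m n where "z = 0 + of_int m + of_int n * \<alpha>" using z lat_iff by auto
    moreover have "d \<midarrow>0 + of_int m + of_int n * \<alpha>\<rightarrow> 0"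
      by (rule lattice_invariant) (rule tendsto_periodic per \<open>d \<midarrow>0\<rightarrow> 0\<close>)+
    ultimately show ?thesis by simp
  qed
  have lim: "\<exists>L. d \<midarrow>z\<rightarrow> L" for z
  proof (cases "z \<in> lat")
    case False
    then have "Q analytic_on {z}" "P analytic_on {z}"
      using pole nicely_meromorphic_on_imp_analytic_at[OF Q(1)] P_analytic by blast+
    then have "d analytic_on {z}" unfolding d_def by (intro analytic_intros)
    then show ?thesis using analytic_at_imp_isCont unfolding isCont_def by blast
  qed (use lat0 in blast)
  define e where "e = remove_sings d"
  have e: "e holomorphic_on UNIV" "\<forall>\<^sub>\<approx>x\<in>UNIV. e x = d x"
    unfolding e_def using remove_sings_entire[OF mer lim] by blast+
  have eper: "e (x + c) = e x" if c: "\<forall>\<^sub>\<approx>x\<in>UNIV. d (x + c) = d x" for c x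
  proof (rule cosparse_eq_entire[of "\<lambda>x. e (x + c)"])
    show "\<forall>\<^sub>\<approx>x\<in>UNIV. e (x + c) = e x"
      using cosparse_translate[OF e(2), of c] e(2) c by eventually_elim simp
  qed (intro holomorphic_on_translate[OF e(1)] e(1))+
  obtain k where k: "\<And>x. e x = k"
    using entire_norm_periodic_constant[OF nonreal e(1)] eper[OF per(1)] eper[OF per(2)] by metis
  have "e \<midarrow>0\<rightarrow> 0"
    using \<open>d \<midarrow>0\<rightarrow> 0\<close> tendsto_cong[of e d "at 0"] e(2) by (simp add: eventually_cosparse_open_eq)
  then have "k = 0" unfolding k by (simp add: LIM_const_eq)
  then have "\<forall>\<^sub>\<approx>x\<in>UNIV. Q x = P x"
    using e(2) unfolding k d_def by (auto elim: eventually_mono)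
  then show ?thesis by (rule nicely_meromorphic_eqI[OF Q(1) P_nice])
qed

lemma weierstrass_p_eq: "weierstrass_p \<alpha> = P"
  unfolding weierstrass_p_def p_spec_def[symmetric]
  using P_spec p_spec_unique by (rule the_equality)

text \<open>Two candidates differ by a constant off the lattice, since the complement is connected,
  and oddness makes the constant 0.\<close>

lemma weierstrass_zeta_eq: "weierstrass_zeta \<alpha> = Z"
  unfolding weierstrass_zeta_def weierstrass_p_eq is_pole_iff
proof (rule the_equality)
  show "Z nicely_meromorphic_on UNIV \<and> (\<forall>x. Z (- x) = - Z x) \<and>
      (\<forall>x. x \<notin> lat \<longrightarrow> (Z has_field_derivative P x) (at x))"
    using Z_nice Z_odd Z_has_deriv by blast
next
  fix Y assume Y: "Y nicely_meromorphic_on UNIV \<and> (\<forall>x. Y (- x) = - Y x) \<and>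
      (\<forall>x. x \<notin> lat \<longrightarrow> (Y has_field_derivative P x) (at x))"
  have open_compl: "open (- lat)" using closed_lat by (simp add: open_Compl)
  have der: "((\<lambda>x. Y x - Z x) has_field_derivative 0) (at x)" if "x \<in> - lat" for x
    using DERIV_diff[of Y "P x" x UNIV Z "P x"] Y Z_has_deriv[of x] that by simp
  have "(\<lambda>x. Y x - Z x) constant_on - lat"
    by (rule has_field_derivative_0_imp_constant_on[OF der connected_compl_lat open_compl])
  then obtain c where c: "\<And>x. x \<notin> lat \<Longrightarrow> Y x - Z x = c" unfolding constant_on_def by auto
  have "\<exists>x. x \<notin> lat"
  proof (rule ccontr)
    assume "\<not> ?thesis"
    then have "lat = UNIV" by blast
    then show False using lat_sparse by (simp add: sparse_in_def)
  qed
  then obtain x where x: "x \<notin> lat" by blast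
  then have "- x \<notin> lat" by (simp add: lat_def odd)
  then have "c = - c" using c[of x] c[of "- x"] x Y Z_odd[of x] by (simp add: algebra_simps)
  then have "c = 0" by simp
  have "\<forall>\<^sub>\<approx>x\<in>UNIV. Y x = Z x"
    using \<sigma>_cosparse c unfolding \<open>c = 0\<close> lat_def by (auto elim: eventually_mono)
  then show "Y = Z" using nicely_meromorphic_eqI Y Z_nice by blast
qed

text \<open>A candidate has the same logarithmic derivative as \<sigma>, so their Wronskian vanishes
  and the quotient is a constant; the derivatives at 0 show that it is 1.\<close>

lemma weierstrass_sigma_eq: "weierstrass_sigma \<alpha> = \<sigma>"
  unfolding weierstrass_sigma_def weierstrass_zeta_eq
proof (rule the_equality)
  show "\<sigma> holomorphic_on UNIV \<and> \<sigma> 0 = 0 \<and> deriv \<sigma> 0 = 1 \<and>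
      (\<forall>\<^sub>\<approx>x\<in>UNIV. deriv \<sigma> x / \<sigma> x = - Z x)"
    by (simp add: hol \<sigma>_0 deriv_\<sigma>_0 Z_def)
next
  fix S assume S: "S holomorphic_on UNIV \<and> S 0 = 0 \<and> deriv S 0 = 1 \<and>
      (\<forall>\<^sub>\<approx>x\<in>UNIV. deriv S x / S x = - Z x)"
  then have holS: "S holomorphic_on UNIV" and S1: "deriv S 0 = 1"
    and eq: "\<forall>\<^sub>\<approx>x\<in>UNIV. deriv S x / S x = - Z x" by auto
  have Sd: "(S has_field_derivative deriv S x) (at x)" for x using holS holomorphic_derivI by blast
  have "\<forall>\<^sub>\<approx>x\<in>UNIV. S x \<noteq> 0" by (rule entire_nonzero_cosparse[OF holS]) (simp add: S1)
  with eq \<sigma>_cosparse have "\<forall>\<^sub>\<approx>x\<in>UNIV. deriv S x * \<sigma> x - S x * deriv \<sigma> x = 0"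
    by eventually_elim (simp add: Z_def field_simps)
  then have wr: "deriv S x * \<sigma> x - S x * deriv \<sigma> x = 0" for x
    by (rule cosparse_eq_entire)
       (intro holomorphic_on_diff holomorphic_on_mult hol hol' holS holomorphic_deriv[OF holS open_UNIV]
          holomorphic_on_const)+
  have open_compl: "open (- lat)" using closed_lat by (simp add: open_Compl)
  have der: "((\<lambda>x. S x / \<sigma> x) has_field_derivative 0) (at x)" if "x \<in> - lat" for x
    using DERIV_divide[OF Sd[of x] \<sigma>_has_deriv[of x]] wr[of x] that by (simp add: lat_def)
  have "(\<lambda>x. S x / \<sigma> x) constant_on - lat"
    by (rule has_field_derivative_0_imp_constant_on[OF der connected_compl_lat open_compl])
  then obtain c where c: "\<And>x. x \<notin> lat \<Longrightarrow> S x / \<sigma> x = c" unfolding constant_on_def by auto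
  have "\<forall>\<^sub>\<approx>x\<in>UNIV. S x = c * \<sigma> x"
    using \<sigma>_cosparse by eventually_elim (use c in \<open>auto simp: lat_def field_simps\<close>)
  then have Sc: "S x = c * \<sigma> x" for x
    by (rule cosparse_eq_entire) (intro holS hol holomorphic_on_mult holomorphic_on_const)+
  then have "deriv S 0 = c * deriv \<sigma> 0"
    using DERIV_cmult[OF \<sigma>_has_deriv[of 0], of c] by (intro DERIV_imp_deriv) (simp flip: Sc)
  then show "S = \<sigma>" using Sc S1 deriv_\<sigma>_0 by (simp add: fun_eq_iff)
qed

end

theorem ex_lattice_sigma:
  assumes "\<alpha> \<notin> \<real>"
  shows "\<exists>\<sigma> A1 B1 A2 B2 G. lattice_sigma \<alpha> \<sigma> A1 B1 A2 B2 G"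
proof -
  obtain \<theta> A B where \<theta>: "\<theta> holomorphic_on UNIV" "\<And>x. \<theta> (- x) = - \<theta> x" "deriv \<theta> 0 = 1"
     "\<And>x. \<theta> x = 0 \<longleftrightarrow> (\<exists>m n. x = of_int m + of_int n * \<alpha>)" "\<And>x. \<theta> (x + 1) = - \<theta> x"
     "A \<noteq> 0" "B \<noteq> 0" "\<And>x. \<theta> (x + \<alpha>) = A * exp (B * x) * \<theta> x"
    using ex_theta[OF assms] by blast
  have \<theta>0: "\<theta> 0 = 0" using \<theta>(2)[of 0] by simp
  define G0 where "G0 = (\<lambda>x. if x = 0 then deriv \<theta> 0 else (\<theta> x - \<theta> 0) / (x - 0))"
  have G0: "G0 holomorphic_on UNIV"
    unfolding G0_def by (rule pole_lemma_open[OF \<theta>(1) open_UNIV])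
  have \<theta>G0: "\<theta> x = x * G0 x" for x by (simp add: G0_def \<theta>0)
  have G00: "G0 0 = 1" by (simp add: G0_def \<theta>(3))
  \<comment> \<open>k is -(log G0)''(0): the factor e^(k x^2 / 2) adds k to the second logarithmic
    derivative and so cancels it at 0. The exponents become B1 = k and B2 = k \<alpha> + B, so B2 -
    \<alpha> B1 is still B.\<close>
  define k where "k = deriv G0 0 ^ 2 - deriv (deriv G0) 0"
  define E where "E = (\<lambda>x. exp (k * x ^ 2 / 2))"
  have E: "E holomorphic_on UNIV" unfolding E_def by (intro holomorphic_intros) auto
  have E_shift: "E (x + c) = exp (k * c ^ 2 / 2) * exp (k * c * x) * E x" for x c
    unfolding E_def exp_add[symmetric] by (simp add: power2_eq_square field_simps)
  have dE: "(E has_field_derivative k * x * E x) (at x)" for x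
    unfolding E_def by (auto intro!: derivative_eq_intros)
  have dG0: "(G0 has_field_derivative deriv G0 x) (at x)"
      "(deriv G0 has_field_derivative deriv (deriv G0) x) (at x)" for x
    using G0 holomorphic_derivI holomorphic_deriv by blast+
  define G where "G = (\<lambda>x. E x * G0 x)"
  have dG: "deriv G = (\<lambda>x. E x * (k * x * G0 x + deriv G0 x))"
    by (rule ext, rule DERIV_imp_deriv)
       (auto simp: G_def algebra_simps intro!: derivative_eq_intros dE dG0)
  have "((\<lambda>x. E x * (k * x * G0 x + deriv G0 x)) has_field_derivative k + deriv (deriv G0) 0) (at 0)"
    by (auto simp: G00 E_def intro!: derivative_eq_intros dG0)
  then have ddG: "deriv (deriv G) 0 = k + deriv (deriv G0) 0"
    unfolding dG by (rule DERIV_imp_deriv)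
  have "lattice_sigma \<alpha> (\<lambda>x. E x * \<theta> x) (- exp (k / 2)) k (A * exp (k * \<alpha> ^ 2 / 2)) (k * \<alpha> + B) G"
  proof
    show "\<alpha> \<notin> \<real>" by fact
    show "(\<lambda>x. E x * \<theta> x) holomorphic_on UNIV" by (intro holomorphic_on_mult E \<theta>)
    show "E (- x) * \<theta> (- x) = - (E x * \<theta> x)" for x by (simp add: E_def \<theta>)
    show "E x * \<theta> x = 0 \<longleftrightarrow> (\<exists>m n. x = of_int m + of_int n * \<alpha>)" for x by (simp add: E_def \<theta>)
    show "E (x + 1) * \<theta> (x + 1) = - exp (k / 2) * exp (k * x) * (E x * \<theta> x)" for x
      unfolding E_shift \<theta>(5) by simp
    show "E (x + \<alpha>) * \<theta> (x + \<alpha>) = A * exp (k * \<alpha> ^ 2 / 2) * exp ((k * \<alpha> + B) * x) * (E x * \<theta> x)" for x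
      unfolding E_shift \<theta>(8) ring_distribs exp_add by (simp only: mult_ac)
    show "k * \<alpha> + B \<noteq> \<alpha> * k" using \<theta>(7) by simp
    show "G holomorphic_on UNIV" unfolding G_def by (intro holomorphic_on_mult E G0)
    show "E x * \<theta> x = x * G x" for x by (simp add: G_def \<theta>G0)
    show "G 0 = 1" by (simp add: G_def E_def G00)
    show "deriv (deriv G) 0 = deriv G 0 ^ 2"
      unfolding ddG by (simp add: dG k_def E_def)
  qed (use \<theta>(6) in auto)
  then show ?thesis by blast
qed

section \<open>Nonreal shifts\<close>

lemma mratfun_times_poly: "\<exists>r'. mratfun r * mpoly p = mratfun r'"
proof -
  define a b where "a = fst (quot_of_fract r)" and "b = snd (quot_of_fract r)"
  have b: "b \<noteq> 0" by (simp add: b_def)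
  have "mscale b (mratfun r * mpoly p) = mpoly (a * p)"
    using mratfun_quot[of r] by (simp only: a_def b_def mult.assoc[symmetric] mpoly_mult)
  also have "\<dots> = mscale b (mratfun (Fract (a * p) b))" by (simp only: mratfun_Fract[OF b])
  finally show ?thesis using mscale_cancel[OF b] by blast
qed

definition sigma_form :: "complex \<Rightarrow> (complex \<Rightarrow> complex) \<Rightarrow> bool" where
  "sigma_form \<alpha> f \<longleftrightarrow> (\<exists>I K (a :: nat \<Rightarrow> complex) (\<delta> :: nat \<Rightarrow> complex)
            (r :: nat \<Rightarrow> nat \<Rightarrow> ratfun) (g :: nat \<Rightarrow> nat \<Rightarrow> complex \<Rightarrow> complex).
           (\<forall>i\<in>{1..I}. \<forall>k\<in>{0..K}. elliptic \<alpha> (g i k)) \<and>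
           (\<forall>\<^sub>\<approx>x\<in>UNIV. f x =
              (\<Sum>i=1..I. \<Sum>k=0..K. ratfun_eval (r i k) x * g i k x * weierstrass_zeta \<alpha> x ^ k
                 * exp (a i * x) * weierstrass_rho \<alpha> (\<delta> i) x)))"

context lattice_sigma
begin

section \<open>Elliptic classes and quasi-periodic factors\<close>

definition ell :: "mfun \<Rightarrow> bool" where
  "ell e \<longleftrightarrow> mero e \<and> mshift 1 e = e \<and> mshift \<alpha> e = e"

lemma ell_mfun: "elliptic \<alpha> g \<Longrightarrow> ell (mfun g)"
  unfolding ell_def elliptic_def mshift_mfun mfun_eq_iff by (auto intro: meroI)

lemma ell_ex: "ell e \<Longrightarrow> \<exists>g. elliptic \<alpha> g \<and> e = mfun g"
  unfolding ell_def elliptic_def mero_def by (auto simp: mshift_mfun mfun_eq_iff)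

definition mX :: mfun where "mX = mpoly [:0, 1:]"
definition mZ :: mfun where "mZ = mfun Z"
definition mrho :: "complex \<Rightarrow> mfun" where "mrho \<delta> = mfun (\<lambda>x. \<sigma> (x + \<delta>) / \<sigma> x)"
definition mrho' :: "complex \<Rightarrow> mfun" where "mrho' \<delta> = mfun (\<lambda>x. \<sigma> x / \<sigma> (x + \<delta>))"

lemma mero_mX: "mero mX" and mero_mZ: "mero mZ"
  unfolding mX_def mZ_def by (intro mero_mpoly meroI Z_meromorphic)+

lemma \<sigma>_meromorphic: "(\<lambda>x. \<sigma> (x + \<delta>)) meromorphic_on UNIV"
  using holomorphic_on_translate[OF hol, of \<delta>]
  by (intro analytic_on_imp_meromorphic_on) (simp add: analytic_on_open)

lemma mero_mrho': "mero (mrho' \<delta>)"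
  unfolding mrho'_def
  using meromorphic_on_divide[OF \<sigma>_meromorphic[of 0] \<sigma>_meromorphic[of \<delta>]] by (simp add: meroI)

lemma mrho_inverse: "mrho \<delta> * mrho' \<delta> = 1"
  unfolding mrho_def mrho'_def mfun_mult mfun_1 mfun_eq_iff
  using \<sigma>_cosparse cosparse_translate[OF \<sigma>_cosparse, of \<delta>] by eventually_elim simp

lemma mshift_mX: "mshift d mX = mX + mconst d"
  unfolding mX_def mshift_mpoly by (simp add: pcompose_pCons flip: mpoly_add)

lemma mshift_mZ_quasi:
  assumes "\<And>x. \<sigma> (x + d) = A * exp (B * x) * \<sigma> x" "A \<noteq> 0"
  shows "mshift d mZ = mZ + mconst (- B)"
proof -
  have "\<forall>\<^sub>\<approx>x\<in>UNIV. Z (x + d) = Z x + - B"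
    using \<sigma>_cosparse by eventually_elim (simp add: Z_quasi[OF assms] lat_def)
  then show ?thesis by (simp add: mZ_def mshift_mfun mconst_eq mfun_add mfun_eq_iff)
qed

lemmas mshift_mZ = mshift_mZ_quasi[OF plus_1 nonzero(1)] mshift_mZ_quasi[OF plus_\<alpha> nonzero(2)]

lemma mshift_mrho_quasi:
  assumes "\<And>x. \<sigma> (x + d) = A * exp (B * x) * \<sigma> x" "A \<noteq> 0"
  shows "mshift d (mrho \<delta>) = mconst (exp (B * \<delta>)) * mrho \<delta>"
proof -
  have "\<sigma> (x + d + \<delta>) / \<sigma> (x + d) = exp (B * \<delta>) * (\<sigma> (x + \<delta>) / \<sigma> x)" for x
  proof -
    have "\<sigma> (x + d + \<delta>) = A * exp (B * x) * (exp (B * \<delta>) * \<sigma> (x + \<delta>))"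
      using assms(1)[of "x + \<delta>"] by (simp add: ring_distribs exp_add add_ac mult_ac)
    then show ?thesis using assms by simp
  qed
  then show ?thesis by (simp add: mrho_def mshift_mfun mconst_eq mfun_mult)
qed

text \<open>The family e^(cx) \<rho>(\<delta>, x) of joint eigenfunctions of both shifts, whose two
  parameters reach every pair of nonzero eigenvalues.\<close>

definition mE :: "complex \<Rightarrow> complex \<Rightarrow> mfun" where "mE c \<delta> = mexp c * mrho \<delta>"
definition mE' :: "complex \<Rightarrow> complex \<Rightarrow> mfun" where "mE' c \<delta> = mexp (- c) * mrho' \<delta>"

lemma mE_inverse: "mE c \<delta> * mE' c \<delta> = 1"
proof -
  have "mE c \<delta> * mE' c \<delta> = (mexp c * mexp (- c)) * (mrho \<delta> * mrho' \<delta>)"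
    unfolding mE_def mE'_def by (simp only: mult_ac)
  then show ?thesis unfolding mexp_inverse mrho_inverse by simp
qed

lemma mero_mE': "mero (mE' c \<delta>)"
  unfolding mE'_def
  by (intro mero_mult mero_mrho' meroI analytic_on_imp_meromorphic_on analytic_intros)

lemma mshift_mE_quasi:
  assumes "\<And>x. \<sigma> (x + d) = A * exp (B * x) * \<sigma> x" "A \<noteq> 0"
  shows "mshift d (mE c \<delta>) = mconst (exp (c * d + B * \<delta>)) * mE c \<delta>"
proof -
  have "mconst (exp (c * d + B * \<delta>)) = mconst (exp (c * d)) * mconst (exp (B * \<delta>))"
    unfolding mconst_eq mfun_mult exp_add ..
  then show ?thesis
    unfolding mE_def mshift_mult mshift_mexp mshift_mrho_quasi[OF assms] by (simp only: mult_ac)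
qed

lemmas mshift_mE = mshift_mE_quasi[OF plus_1 nonzero(1)] mshift_mE_quasi[OF plus_\<alpha> nonzero(2)]

text \<open>Polynomials in x and \<zeta> over the elliptic functions. Each rule corresponds to one
  way of absorbing a factor or splitting a sum in \<open>repr_ell_poly\<close>.\<close>

inductive ell_poly :: "mfun \<Rightarrow> bool" where
  ell: "ell e \<Longrightarrow> ell_poly e"
| add: "ell_poly e \<Longrightarrow> ell_poly e' \<Longrightarrow> ell_poly (e + e')"
| const: "ell_poly e \<Longrightarrow> ell_poly (mconst k * e)"
| X: "ell_poly e \<Longrightarrow> ell_poly (mX * e)"
| Z: "ell_poly e \<Longrightarrow> ell_poly (mZ * e)"

text \<open>By Legendre's relation suitable combinations of \<open>x\<close> and \<open>\<zeta>\<close> have the quasi-periods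
  \<open>(1, 0)\<close> and \<open>(0, 1)\<close>.\<close>

definition leg :: complex where "leg = B2 - \<alpha> * B1"

lemma leg_nonzero: "leg \<noteq> 0" using legendre by (simp add: leg_def)

definition coord1 :: mfun where "coord1 = mconst (B2 / leg) * mX + mconst (\<alpha> / leg) * mZ"
definition coord2 :: mfun where "coord2 = mconst (- B1 / leg) * mX + mconst (- 1 / leg) * mZ"

lemma mshift_lin:
  assumes "mshift d mZ = mZ + mconst z" "a * d + b * z = s"
  shows "mshift d (mconst a * mX + mconst b * mZ) = (mconst a * mX + mconst b * mZ) + mconst s"
proof -
  have "mconst s = mconst a * mconst d + mconst b * mconst z"
    unfolding assms(2)[symmetric] mconst_eq mfun_mult mfun_add ..
  then show ?thesis
    unfolding mshift_add mshift_mult mshift_mX assms(1) mshift_mconst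
    by (simp only: distrib_left add_ac)
qed

lemma coord1: "mshift 1 coord1 = coord1 + 1" "mshift \<alpha> coord1 = coord1"
proof -
  have "B2 / leg * 1 + \<alpha> / leg * - B1 = (B2 - \<alpha> * B1) / leg" by (simp add: diff_divide_distrib)
  then have "B2 / leg * 1 + \<alpha> / leg * - B1 = 1" using leg_nonzero by (simp add: leg_def)
  from mshift_lin[OF mshift_mZ(1) this] show "mshift 1 coord1 = coord1 + 1"
    unfolding coord1_def by simp
  have "B2 / leg * \<alpha> + \<alpha> / leg * - B2 = 0" by (simp add: field_simps)
  from mshift_lin[OF mshift_mZ(2) this] show "mshift \<alpha> coord1 = coord1"
    unfolding coord1_def by (simp add: mfun_0[symmetric])
qed

lemma coord2: "mshift 1 coord2 = coord2" "mshift \<alpha> coord2 = coord2 + 1"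
proof -
  have "- B1 / leg * 1 + - 1 / leg * - B1 = 0" by (simp add: field_simps)
  from mshift_lin[OF mshift_mZ(1) this] show "mshift 1 coord2 = coord2"
    unfolding coord2_def by (simp add: mfun_0[symmetric])
  have "- B1 / leg * \<alpha> + - 1 / leg * - B2 = (B2 - \<alpha> * B1) / leg"
    by (simp add: diff_divide_distrib mult.commute)
  then have "- B1 / leg * \<alpha> + - 1 / leg * - B2 = 1" using leg_nonzero by (simp add: leg_def)
  from mshift_lin[OF mshift_mZ(2) this] show "mshift \<alpha> coord2 = coord2 + 1"
    unfolding coord2_def by simp
qed

lemma mero_coord: "mero coord1" "mero coord2"
  unfolding coord1_def coord2_def by (intro mero_add mero_mult mero_mpoly mero_mX mero_mZ)+

lemma ell_poly_coord:
  assumes "ell_poly e"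
  shows "ell_poly (coord1 * e)" "ell_poly (coord2 * e)"
  unfolding coord1_def coord2_def distrib_right mult.assoc
  by (intro ell_poly.add ell_poly.const ell_poly.X ell_poly.Z assms)+

lemma ell_poly_coord_power:
  assumes "ell_poly e"
  shows "ell_poly (coord1 ^ n * e)" "ell_poly (coord2 ^ n * e)"
  by (induction n) (simp_all add: assms ell_poly_coord mult.assoc)

lemma mero_power: "mero e \<Longrightarrow> mero (e ^ n)"
  by (induction n) (auto intro: mero_mult simp: mero_mpoly[of 1, simplified])

lemma mero_mdelta: "mero e \<Longrightarrow> mero ((mdelta c ^^ n) e)"
  by (induction n) (auto simp: mdelta_def intro: mero_diff mero_mshift)

lemma funpow_mdelta_leading:
  assumes "mshift c s = s + 1" "mshift c w = w"
  shows "(mdelta c ^^ n) (s ^ n * (mconst (1 / of_nat (fact n)) * w)) = w"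
proof -
  have "(mdelta c ^^ n) (s ^ n * (mconst (1 / of_nat (fact n)) * w)) =
     of_nat (fact n) * (mconst (1 / of_nat (fact n)) * w)"
    by (subst funpow_mdelta_mult_invariant)
       (simp_all add: mshift_mult assms funpow_mdelta_power[OF assms(1)])
  also have "\<dots> = mconst (of_nat (fact n) * (1 / of_nat (fact n))) * w"
    unfolding of_nat_mfun mconst_eq mfun_mult mult.assoc[symmetric] ..
  finally show ?thesis by simp
qed

lemma mdelta_eq_0_iff: "mdelta c e = 0 \<longleftrightarrow> mshift c e = e"
  by (simp add: mdelta_def)

text \<open>The last nonvanishing difference w0 is elliptic, and \<open>coord2 ^ n\<close> w0 / n!
  has the same n-th difference. Subtracting it keeps the period 1, which \<open>coord2\<close>
  has.\<close>

lemma unipotent_ell_poly1: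
  assumes "mero w" "mshift 1 w = w" "(mdelta \<alpha> ^^ n) w = 0"
  shows "ell_poly w"
  using assms
proof (induction n arbitrary: w)
  case 0
  then show ?case by (intro ell_poly.ell) (simp add: ell_def)
next
  case (Suc n)
  define w0 where "w0 = (mdelta \<alpha> ^^ n) w"
  have inv\<alpha>: "mshift \<alpha> w0 = w0"
    using Suc.prems(3) mdelta_eq_0_iff by (simp add: w0_def)
  have "mdelta 1 w0 = (mdelta \<alpha> ^^ n) (mdelta 1 w)"
    using funpow_mdelta_commute[where c = 1 and m = 1 and d = \<alpha>] by (simp add: w0_def)
  also have "mdelta 1 w = 0" using Suc.prems(2) mdelta_eq_0_iff by blast
  finally have inv1: "mshift 1 w0 = w0" by (simp add: mdelta_eq_0_iff)
  have "ell w0" unfolding ell_def using inv1 inv\<alpha> Suc.prems(1) by (simp add: w0_def mero_mdelta)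
  define y where "y = coord2 ^ n * (mconst (1 / of_nat (fact n)) * w0)"
  have ep_y: "ell_poly y"
    unfolding y_def by (intro ell_poly_coord_power ell_poly.const ell_poly.ell \<open>ell w0\<close>)
  have "mero y" unfolding y_def w0_def
    by (intro mero_mult mero_power mero_coord mero_mpoly mero_mdelta Suc.prems(1))
  have "ell_poly (w - y)"
  proof (rule Suc.IH)
    show "mero (w - y)" using Suc.prems(1) \<open>mero y\<close> by (rule mero_diff)
    show "mshift 1 (w - y) = w - y"
      by (simp add: y_def mshift_diff mshift_mult mshift_power coord2 Suc.prems(2) inv1)
    show "(mdelta \<alpha> ^^ n) (w - y) = 0"
      unfolding funpow_mdelta_diff y_def funpow_mdelta_leading[OF coord2(2) inv\<alpha>]
      by (simp add: w0_def)
  qed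
  from ell_poly.add[OF this ep_y] show ?case by simp
qed

text \<open>Interpolation in \<open>coord1\<close>, whose coefficients are covered by
  \<open>unipotent_ell_poly1\<close>. Since \<open>coord1\<close> is invariant under \<alpha>, the
  order n persists, unlike in \<open>unipotent_entire_poly\<close>.\<close>

lemma unipotent_ell_poly:
  assumes "mero u" "(mdelta 1 ^^ m) u = 0" "(mdelta \<alpha> ^^ n) u = 0"
  shows "ell_poly u"
  using assms
proof (induction m arbitrary: u)
  case 0
  then show ?case by (intro ell_poly.ell) (simp add: ell_def)
next
  case (Suc m)
  define w where "w = (mdelta 1 ^^ m) u"
  have inv1: "mshift 1 w = w"
    using Suc.prems(2) mdelta_eq_0_iff by (simp add: w_def)
  have nil: "(mdelta \<alpha> ^^ n) w = 0"
    unfolding w_def funpow_mdelta_commute[where c = \<alpha> and d = 1] Suc.prems(3) by simp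
  have mero_w: "mero w" unfolding w_def by (rule mero_mdelta[OF Suc.prems(1)])
  have ep_w: "ell_poly w" by (rule unipotent_ell_poly1[OF mero_w inv1 nil])
  define y where "y = coord1 ^ m * (mconst (1 / of_nat (fact m)) * w)"
  have ep_y: "ell_poly y" unfolding y_def by (intro ell_poly_coord_power ell_poly.const ep_w)
  have "mero y" unfolding y_def by (intro mero_mult mero_power mero_coord mero_mpoly mero_w)
  have "ell_poly (u - y)"
  proof (rule Suc.IH)
    show "mero (u - y)" using Suc.prems(1) \<open>mero y\<close> by (rule mero_diff)
    show "(mdelta 1 ^^ m) (u - y) = 0"
      unfolding funpow_mdelta_diff y_def funpow_mdelta_leading[OF coord1(1) inv1]
      by (simp add: w_def)
    have "y = w * (coord1 ^ m * mconst (1 / of_nat (fact m)))" unfolding y_def by (simp only: mult_ac)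
    moreover have "mshift \<alpha> (coord1 ^ m * mconst (1 / of_nat (fact m))) =
        coord1 ^ m * mconst (1 / of_nat (fact m))"
      by (simp add: mshift_mult mshift_power coord1)
    ultimately have "(mdelta \<alpha> ^^ n) y = 0"
      using funpow_mdelta_mult_invariant nil by simp
    then show "(mdelta \<alpha> ^^ n) (u - y) = 0" by (simp add: funpow_mdelta_diff Suc.prems(3))
  qed
  from ell_poly.add[OF this ep_y] show ?case by simp
qed

section \<open>The explicit form of solutions\<close>

fun summand :: "ratfun \<times> nat \<times> (complex \<Rightarrow> complex) \<times> complex \<times> complex \<Rightarrow> mfun" where
  "summand (r, k, g, c, \<delta>) = mratfun r * mfun g * mZ ^ k * mexp c * mrho \<delta>"

text \<open>In a list each term may have its own power of \<zeta>; \<open>repr_mfunD\<close> spreads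
  the list over a rectangle of indices.\<close>

definition repr :: "mfun \<Rightarrow> bool" where
  "repr e \<longleftrightarrow> (\<exists>ts. (\<forall>(r, k, g, c, \<delta>)\<in>set ts. elliptic \<alpha> g) \<and> e = sum_list (map summand ts))"

lemma repr_0: "repr 0"
  unfolding repr_def by (intro exI[of _ "[]"]) simp

lemma repr_add:
  assumes "repr e" "repr e'"
  shows "repr (e + e')"
proof -
  obtain ts ts' where "\<forall>(r, k, g, c, \<delta>)\<in>set ts. elliptic \<alpha> g" "e = sum_list (map summand ts)"
    "\<forall>(r, k, g, c, \<delta>)\<in>set ts'. elliptic \<alpha> g" "e' = sum_list (map summand ts')"
    using assms unfolding repr_def by blast
  then show ?thesis unfolding repr_def by (intro exI[of _ "ts @ ts'"]) auto
qed

lemma repr_term: "elliptic \<alpha> g \<Longrightarrow> repr (mratfun r * mfun g * mZ ^ k * mexp c * mrho \<delta>)"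
  unfolding repr_def by (intro exI[of _ "[(r, k, g, c, \<delta>)]"]) simp

text \<open>Stated for all r and k so that the induction works: constants and factors x are absorbed
  into r, factors \<zeta> into \<open>mZ ^ k\<close>.\<close>

lemma repr_ell_poly:
  assumes "ell_poly u"
  shows "repr (mratfun r * u * mZ ^ k * mexp c * mrho \<delta>)"
  using assms
proof (induction arbitrary: r k)
  case (ell e)
  then obtain g where "elliptic \<alpha> g" "e = mfun g" using ell_ex by blast
  then show ?case by (simp add: repr_term)
next
  case (add e e')
  then show ?case by (simp only: distrib_left distrib_right repr_add)
next
  case (const e a)
  obtain r' where r': "mratfun r * mconst a = mratfun r'" using mratfun_times_poly by blast
  show ?case unfolding mult.assoc[symmetric] r' by (rule const.IH)
next
  case (X e)
  obtain r' where r': "mratfun r * mX = mratfun r'" unfolding mX_def using mratfun_times_poly by blast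
  show ?case unfolding mult.assoc[symmetric] r' by (rule X.IH)
next
  case (Z e)
  have eq: "mratfun r * (mZ * e) * mZ ^ k * mexp c * mrho \<delta> = mratfun r * e * mZ ^ Suc k * mexp c * mrho \<delta>"
    unfolding power_Suc by (simp only: mult_ac)
  show ?case unfolding eq by (rule Z.IH)
qed

lemma mfun_form:
  "mfun (\<lambda>x. \<Sum>i=1..I. \<Sum>k=0..K. ratfun_eval (r i k) x * g i k x * Z x ^ k
      * exp (a i * x) * weierstrass_rho \<alpha> (\<delta> i) x) =
   (\<Sum>i=1..I. \<Sum>k=0..K. mratfun (r i k) * mfun (g i k) * mZ ^ k * mexp (a i) * mrho (\<delta> i))"
  unfolding mratfun_def mZ_def mrho_def mfun_power mfun_mult mfun_sum weierstrass_rho_def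
    weierstrass_sigma_eq ..

lemma repr_mfunD:
  assumes "repr (mfun f)"
  shows "sigma_form \<alpha> f"
proof -
  obtain ts where ts: "\<forall>(r, k, g, c, \<delta>)\<in>set ts. elliptic \<alpha> g" "mfun f = sum_list (map summand ts)"
    using assms unfolding repr_def by blast
  define kk where "kk i = fst (snd (ts ! (i - 1)))" for i
  define rr where "rr i k = (if k = kk i then fst (ts ! (i - 1)) else 0)" for i k
  define gg where "gg i (k :: nat) = fst (snd (snd (ts ! (i - 1))))" for i k
  define aa where "aa i = fst (snd (snd (snd (ts ! (i - 1)))))" for i
  define dd where "dd i = snd (snd (snd (snd (ts ! (i - 1)))))" for i
  \<comment> \<open>A common bound for the exponents of \<zeta>. In row i the coefficient is set to
    0 except at k = \<open>kk i\<close>.\<close>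
  define K where "K = (\<Sum>i=1..length ts. kk i)"
  have ell: "elliptic \<alpha> (gg i k)" if "i \<in> {1..length ts}" for i k
  proof -
    have "ts ! (i - 1) \<in> set ts" using that by (intro nth_mem) auto
    then show ?thesis using ts(1) by (fastforce simp: gg_def case_prod_unfold)
  qed
  have "summand (ts ! (i - 1)) = (\<Sum>k=0..K. mratfun (rr i k) * mfun (gg i k) * mZ ^ k * mexp (aa i) * mrho (dd i))"
    if "i \<in> {1..length ts}" for i
  proof -
    have K: "kk i \<le> K" unfolding K_def using that by (intro member_le_sum) auto
    have "(\<Sum>k=0..K. mratfun (rr i k) * mfun (gg i k) * mZ ^ k * mexp (aa i) * mrho (dd i)) =
       (\<Sum>k=0..K. if k = kk i then summand (ts ! (i - 1)) else 0)"
      by (intro sum.cong refl, cases "ts ! (i - 1)")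
         (auto simp: rr_def kk_def gg_def aa_def dd_def)
    also have "\<dots> = summand (ts ! (i - 1))" using K by simp
    finally show ?thesis by simp
  qed
  then have "mfun f = (\<Sum>i=1..length ts. \<Sum>k=0..K.
     mratfun (rr i k) * mfun (gg i k) * mZ ^ k * mexp (aa i) * mrho (dd i))"
    unfolding ts(2) sum_list_as_sum by (intro sum.cong) auto
  then have "\<forall>\<^sub>\<approx>x\<in>UNIV. f x = (\<Sum>i=1..length ts. \<Sum>k=0..K. ratfun_eval (rr i k) x * gg i k x * Z x ^ k
      * exp (aa i * x) * weierstrass_rho \<alpha> (dd i) x)"
    unfolding mfun_form[symmetric] mfun_eq_iff .
  then show ?thesis unfolding sigma_form_def weierstrass_zeta_eq
    using ell by (intro exI[of _ "length ts"] exI[of _ K] exI[of _ aa] exI[of _ dd] exI[of _ rr] exI[of _ gg]) auto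
qed

lemma repr_generalized_eigenfunction:
  assumes "mero v" "mact 1 ([:- a, 1:] ^ m) v = 0" "mact \<alpha> ([:- b, 1:] ^ n) v = 0"
  shows "repr (mratfun r * v)"
proof (cases "v = 0")
  case True
  then show ?thesis using repr_0 by simp
next
  case False
  have nz: "e \<noteq> 0" if "mact d ([:- e, 1:] ^ N) v = 0" for d e N
  proof
    interpret op_module mscale "mshift d" d by (rule op_module_mfun)
    assume "e = 0"
    then have "act (monom 1 N) v = 0" using that by (simp add: monom_altdef)
    then have "(mshift d ^^ N) v = 0" by (simp add: act_monom)
    then show False using funpow_S_eq_0 False by blast
  qed
  have ab: "a \<noteq> 0" "b \<noteq> 0" using nz assms(2,3) by blast+
  \<comment> \<open>Cramer's rule for c + B1 \<delta> = Ln a and c \<alpha> + B2 \<delta> = Ln b,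
    whose determinant is \<open>leg\<close>.\<close>
  define \<delta> where "\<delta> = (Ln b - \<alpha> * Ln a) / leg"
  define c where "c = Ln a - B1 * \<delta>"
  have "c * 1 + B1 * \<delta> = Ln a" by (simp add: c_def)
  then have E1: "exp (c * 1 + B1 * \<delta>) = a" using ab by simp
  have "c * \<alpha> + B2 * \<delta> = \<alpha> * Ln a + leg * \<delta>" by (simp add: c_def leg_def algebra_simps)
  also have "\<dots> = Ln b" using leg_nonzero by (simp add: \<delta>_def)
  finally have E2: "exp (c * \<alpha> + B2 * \<delta>) = b" using ab by simp
  define u where "u = mE' c \<delta> * v"
  have v: "v = mE c \<delta> * u" unfolding u_def mult.assoc[symmetric] mE_inverse by simp
  have "ell_poly u"
  proof (rule unipotent_ell_poly)
    show "mero u" unfolding u_def by (intro mero_mult mero_mE' assms(1))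
    show "(mdelta 1 ^^ m) u = 0"
      using unipotent_if_eigen[OF mshift_mE(1)[of c \<delta>, unfolded E1] mE_inverse ab(1)] assms(2) v by simp
    show "(mdelta \<alpha> ^^ n) u = 0"
      using unipotent_if_eigen[OF mshift_mE(2)[of c \<delta>, unfolded E2] mE_inverse ab(2)] assms(3) v by simp
  qed
  from repr_ell_poly[OF this, of r 0 c \<delta>] have "repr (mratfun r * (mE c \<delta> * u))"
    unfolding mE_def by (simp add: mult_ac)
  then show ?thesis using v by simp
qed

lemma not_rational: "\<alpha> \<notin> \<rat>"
proof
  assume "\<alpha> \<in> \<rat>"
  then obtain a b where "\<alpha> = of_int a / of_int b" by (rule Rats_cases')
  then show False using nonreal by simp
qed

theorem solution_form:
  assumes "f meromorphic_on UNIV" "solves_system \<alpha> f"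
  shows "sigma_form \<alpha> f"
proof (rule repr_mfunD)
  obtain q p1 p2 where q: "q \<noteq> 0" "p1 \<noteq> 0" "p2 \<noteq> 0"
     "mact 1 p1 (mscale q (mfun f)) = 0" "mact \<alpha> p2 (mscale q (mfun f)) = 0"
    using solves_system_const_finite[OF not_rational assms(2)] by blast
  have "mero (mscale q (mfun f))" by (intro mero_mult mero_mpoly meroI assms(1))
  then have "repr (mratfun (Fract 1 q) * mscale q (mfun f))"
    by (rule joint_eigen_induct[OF q(2-5), where A = mero])
       (auto intro: mero_act repr_add repr_generalized_eigenfunction simp: repr_0 distrib_left)
  then show "repr (mfun f)" unfolding mratfun_inverse[OF q(1)] .
qed

text \<open>The shift fixes the elliptic factors, multiplies e^(cx) \<rho>(\<delta>, x) by a
  constant and sends \<zeta> to \<zeta> - B. So finitely many functions span a stable space over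
  C(x), in which the iterates of f are dependent.\<close>

lemma form_solves:
  fixes I K :: nat
  assumes quasi: "\<And>x. \<sigma> (x + d) = A * exp (B * x) * \<sigma> x" "A \<noteq> 0"
    and g: "\<And>i k. i \<in> {1..I} \<Longrightarrow> k \<in> {0..K} \<Longrightarrow> mshift d (mfun (g i k)) = mfun (g i k)"
    and f: "mfun f = (\<Sum>i=1..I. \<Sum>k=0..K. mratfun (r i k) * mfun (g i k) * mZ ^ k * mexp (a i) * mrho (\<delta> i))"
  shows "\<exists>m>0. \<exists>b. solves_difference_eq d m b f"
proof -
  interpret op_module mscale "mshift d" d by (rule op_module_mfun)
  \<comment> \<open>The power l of \<zeta> runs independently of the index k of the elliptic factor,
    because expanding (\<zeta> - B)^l lowers the power and keeps \<open>g i k\<close>.\<close>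
  define b where "b = (\<lambda>(i, k, l). mfun (g i k) * mZ ^ l * mE (a i) (\<delta> i))"
  define F where "F = b ` ({1..I} \<times> {0..K} \<times> {0..K})"
  have fin: "finite F" by (simp add: F_def)
  have inF: "b (i, k, l) \<in> F" if "i \<in> {1..I}" "k \<in> {0..K}" "l \<in> {0..K}" for i k l
    unfolding F_def using that by blast
  have stable: "almost_in F (mshift d v)" if v: "v \<in> F" for v
  proof -
    obtain i k l where ikl: "i \<in> {1..I}" "k \<in> {0..K}" "l \<in> {0..K}" "v = b (i, k, l)"
      using v unfolding F_def by auto
    define e where "e = exp (a i * d + B * \<delta> i)"
    have "mshift d v = mfun (g i k) * (mZ + mconst (- B)) ^ l * (mconst e * mE (a i) (\<delta> i))"
      unfolding ikl(4) b_def prod.case mshift_mult mshift_power g[OF ikl(1,2)]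
        mshift_mZ_quasi[OF quasi] mshift_mE_quasi[OF quasi] e_def ..
    also have "\<dots> = (\<Sum>j\<le>l. mscale ([:of_nat (l choose j):] * [:- B:] ^ (l - j) * [:e:]) (b (i, k, j)))"
    proof -
      have pw: "mpoly [:- B:] ^ n = mpoly ([:- B:] ^ n)" for n
        by (induction n) (simp_all only: power_0 power_Suc mpoly_1 mpoly_mult)
      show ?thesis
        unfolding binomial_ring sum_distrib_left sum_distrib_right b_def prod.case of_nat_mfun pw mpoly_mult
        by (intro sum.cong refl) (simp only: mult_ac)
    qed
    also have "\<dots> \<in> span F"
      using ikl by (intro span_sum span_scale span_base inF) auto
    finally show ?thesis by (rule almost_in_span)
  qed
  have "almost_in F (mratfun (r i k) * mfun (g i k) * mZ ^ k * mexp (a i) * mrho (\<delta> i))"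
    if ik: "i \<in> {1..I}" "k \<in> {0..K}" for i k
  proof -
    have eq: "mratfun (r i k) * mfun (g i k) * mZ ^ k * mexp (a i) * mrho (\<delta> i) = mratfun (r i k) * b (i, k, k)"
      unfolding b_def prod.case mE_def by (simp only: mult_ac)
    have "mscale (snd (quot_of_fract (r i k))) (mratfun (r i k) * b (i, k, k)) =
        mscale (fst (quot_of_fract (r i k))) (b (i, k, k))"
      unfolding mult.assoc[symmetric] mratfun_quot ..
    also have "\<dots> \<in> span F" using ik by (intro span_scale span_base inF)
    finally have "almost_in F (mscale (snd (quot_of_fract (r i k))) (mratfun (r i k) * b (i, k, k)))"
      by (rule almost_in_span)
    then have "almost_in F (mratfun (r i k) * b (i, k, k))" by (rule almost_in_scaleD) simp
    then show ?thesis unfolding eq .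
  qed
  then have "mfun f \<in> {v. almost_in F v}"
    unfolding f by (intro subspace_sum[OF almost_in_subspace]) auto
  then have "almost_in F (mfun f)" by simp
  from shift_relation[OF fin stable this] obtain m c where
    "\<exists>i\<le>m. c i \<noteq> 0" "(\<Sum>i\<le>m. mscale (c i) ((mshift d ^^ i) (mfun f))) = 0" by blast
  then show ?thesis by (rule polys_imp_ex_solves_difference_eq)
qed

theorem form_solves_system:
  fixes I K :: nat
  assumes "\<forall>i\<in>{1..I}. \<forall>k\<in>{0..K}. elliptic \<alpha> (g i k)"
    and "\<forall>\<^sub>\<approx>x\<in>UNIV. f x =
              (\<Sum>i=1..I. \<Sum>k=0..K. ratfun_eval (r i k) x * g i k x * weierstrass_zeta \<alpha> x ^ k
                 * exp (a i * x) * weierstrass_rho \<alpha> (\<delta> i) x)"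
  shows "solves_system \<alpha> f"
proof -
  have f: "mfun f = (\<Sum>i=1..I. \<Sum>k=0..K. mratfun (r i k) * mfun (g i k) * mZ ^ k * mexp (a i) * mrho (\<delta> i))"
    using assms(2) unfolding mfun_form[symmetric] mfun_eq_iff weierstrass_zeta_eq .
  have g: "mshift 1 (mfun (g i k)) = mfun (g i k)" "mshift \<alpha> (mfun (g i k)) = mfun (g i k)"
    if "i \<in> {1..I}" "k \<in> {0..K}" for i k
    using ell_mfun[of "g i k"] assms(1) that unfolding ell_def by blast+
  show ?thesis unfolding solves_system_def
    using form_solves[OF plus_1 nonzero(1) g(1) f] form_solves[OF plus_\<alpha> nonzero(2) g(2) f] by blast
qed

end

theorem corollary14:
  fixes \<alpha> :: complex
  assumes "\<alpha> \<notin> \<rat>"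
  shows
    "(\<alpha> \<notin> \<real> \<longrightarrow>
       (\<forall>f. f meromorphic_on UNIV \<and> solves_system \<alpha> f \<longrightarrow>
         (\<exists>I K (a :: nat \<Rightarrow> complex) (\<delta> :: nat \<Rightarrow> complex)
            (r :: nat \<Rightarrow> nat \<Rightarrow> ratfun) (g :: nat \<Rightarrow> nat \<Rightarrow> complex \<Rightarrow> complex).
           (\<forall>i\<in>{1..I}. \<forall>k\<in>{0..K}. elliptic \<alpha> (g i k)) \<and>
           (\<forall>\<^sub>\<approx>x\<in>UNIV. f x =
              (\<Sum>i=1..I. \<Sum>k=0..K. ratfun_eval (r i k) x * g i k x * weierstrass_zeta \<alpha> x ^ k
                 * exp (a i * x) * weierstrass_rho \<alpha> (\<delta> i) x)))) \<and>
       (\<forall>f I K (a :: nat \<Rightarrow> complex) (\<delta> :: nat \<Rightarrow> complex)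
            (r :: nat \<Rightarrow> nat \<Rightarrow> ratfun) (g :: nat \<Rightarrow> nat \<Rightarrow> complex \<Rightarrow> complex).
           (\<forall>i\<in>{1..I}. \<forall>k\<in>{0..K}. elliptic \<alpha> (g i k)) \<and>
           (\<forall>\<^sub>\<approx>x\<in>UNIV. f x =
              (\<Sum>i=1..I. \<Sum>k=0..K. ratfun_eval (r i k) x * g i k x * weierstrass_zeta \<alpha> x ^ k
                 * exp (a i * x) * weierstrass_rho \<alpha> (\<delta> i) x)) \<longrightarrow>
           solves_system \<alpha> f)) \<and>
     (\<forall>f. f meromorphic_on UNIV \<and> solves_system \<alpha> f \<and>
          (\<alpha> \<in> \<real> \<or> finite {z. is_pole f z}) \<longrightarrow>
        (\<exists>I (a :: nat \<Rightarrow> complex) (r :: nat \<Rightarrow> ratfun).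
          \<forall>\<^sub>\<approx>x\<in>UNIV. f x = (\<Sum>i=1..I. ratfun_eval (r i) x * exp (a i * x)))) \<and>
     (\<forall>F :: complex fls. fls_solves_system \<alpha> F \<longrightarrow> F \<in> range ratfun_at_infinity)"
proof (intro conjI impI allI; (elim conjE)?)
  fix f assume "\<alpha> \<notin> \<real>" and f: "f meromorphic_on UNIV" "solves_system \<alpha> f"
  then obtain \<sigma> A1 B1 A2 B2 G where "lattice_sigma \<alpha> \<sigma> A1 B1 A2 B2 G"
    using ex_lattice_sigma by blast
  from lattice_sigma.solution_form[OF this f, unfolded sigma_form_def]
  show "\<exists>I K (a :: nat \<Rightarrow> complex) (\<delta> :: nat \<Rightarrow> complex)
            (r :: nat \<Rightarrow> nat \<Rightarrow> ratfun) (g :: nat \<Rightarrow> nat \<Rightarrow> complex \<Rightarrow> complex).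
           (\<forall>i\<in>{1..I}. \<forall>k\<in>{0..K}. elliptic \<alpha> (g i k)) \<and>
           (\<forall>\<^sub>\<approx>x\<in>UNIV. f x =
              (\<Sum>i=1..I. \<Sum>k=0..K. ratfun_eval (r i k) x * g i k x * weierstrass_zeta \<alpha> x ^ k
                 * exp (a i * x) * weierstrass_rho \<alpha> (\<delta> i) x))" .
next
  fix f I K and a \<delta> :: "nat \<Rightarrow> complex" and r :: "nat \<Rightarrow> nat \<Rightarrow> ratfun"
    and g :: "nat \<Rightarrow> nat \<Rightarrow> complex \<Rightarrow> complex"
  assume "\<alpha> \<notin> \<real>" and form: "\<forall>i\<in>{1..I}. \<forall>k\<in>{0..K}. elliptic \<alpha> (g i k)"
    "\<forall>\<^sub>\<approx>x\<in>UNIV. f x =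
              (\<Sum>i=1..I. \<Sum>k=0..K. ratfun_eval (r i k) x * g i k x * weierstrass_zeta \<alpha> x ^ k
                 * exp (a i * x) * weierstrass_rho \<alpha> (\<delta> i) x)"
  then obtain \<sigma> A1 B1 A2 B2 G where "lattice_sigma \<alpha> \<sigma> A1 B1 A2 B2 G"
    using ex_lattice_sigma by blast
  from lattice_sigma.form_solves_system[OF this form] show "solves_system \<alpha> f" .
next
  fix f assume "f meromorphic_on UNIV" "solves_system \<alpha> f" "\<alpha> \<in> \<real> \<or> finite {z. is_pole f z}"
  then show "\<exists>I (a :: nat \<Rightarrow> complex) (r :: nat \<Rightarrow> ratfun).
          \<forall>\<^sub>\<approx>x\<in>UNIV. f x = (\<Sum>i=1..I. ratfun_eval (r i) x * exp (a i * x))"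
    by (rule real_or_finite_poles_solution[OF assms])
next
  fix F :: "complex fls" assume "fls_solves_system \<alpha> F"
  then show "F \<in> range ratfun_at_infinity" by (rule fls_solution_rational[OF assms])
qed

end
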